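(* Consider Enum (enumerate $q(\mathcal D)$) in the dynamic setting. Let $f$ be some function and $\epsilon>0$. (1) If Enum can be solved with arbitrary preprocessing, update time $O(|V_{\mathcal D}|^{1-\epsilon}f(|q|))$ and delay $O(|V_{\mathcal D}|^{1-\epsilon}f(|q|))$, then the OMv-hypothesis fails. (2) If Enum can be solved (combinatorially) with preprocessing $O(|V_{\mathcal D}|^{3-\epsilon}f(|q|))$, update time $O(|V_{\mathcal D}|^{2-\epsilon}f(|q|))$ and delay $O(|V_{\mathcal D}|^{2-\epsilon}f(|q|))$, then the combinatorial BMM-hypothesis fails.
   Context: $\Sigma$ is a fixed finite alphabet of constant size. A graph database over $\Sigma$ is a pair $\mathcal{D}=(V_{\mathcal D},E_{\mathcal D})$ with a finite node set and arc set $E_{\mathcal D}\subseteq V_{\mathcal D}\times\Sigma\times V_{\mathcal D}$, represented by adjacency lists. A path from $u$ to $v$ is a sequence $u=w_0,a_1,w_1,\dots,a_k,w_k=v$ ($k\ge0$) with $(w_{i-1},a_i,w_i)\in E_{\mathcal D}$, labelled by $a_1\cdots a_k$. An RPQ $q$ is a regular expression over $\Sigma$ (built from $\varepsilon$, letters, concatenation, alternation, Kleene plus), $|q|$ its length; $q(\mathcal D)$ is the set of node pairs $(u,v)$ such that some path from $u$ to $v$ is labelled by a word in the language of $q$. Model: RAM with logarithmic word size. Enumeration: preprocessing phase, then enumeration phase outputting every element of $q(\mathcal D)$ exactly once and signalling termination; delay = maximum time between start and first output, between consecutive outputs, and between last output and termination. Dynamic setting: allowed updates are insertion of an arc between existing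 nodes, deletion of an arc, insertion of an isolated node, deletion of an isolated node; after each update an update routine runs (update time), after which enumeration lists the result on the updated database. OMv problem: given a Boolean $n\times n$ matrix $M$ and then, online, Boolean vectors $\vec v^1,\dots,\vec v^n$, output $M\vec v^i$ before receiving $\vec v^{i+1}$. OMv-hypothesis: for every $\epsilon>0$ no algorithm solves OMv in time $O(n^{3-\epsilon})$. Combinatorial BMM-hypothesis: for every $\epsilon>0$ no combinatorial algorithm (informal: not using algebraic fast matrix multiplication) multiplies two Boolean $n\times n$ matrices in time $O(n^{3-\epsilon})$.
   Formalization: "Combinatorial" has no formal definition; part (2) is stated for any class of algorithms, used both for Enum and in the BMM-hypothesis, that is closed under one explicit block-multiplication reduction calling the Enum algorithm. *)

theory Defs
  imports Complex_Main
begin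

(* Nodes and letters are numbers; the alphabet with \<sigma> letters is {..<\<sigma>}. *)

type_synonym arc = "nat \<times> nat \<times> nat"
type_synonym db = "nat set \<times> arc set"

datatype rpq = Eps | Sym nat | Cat rpq rpq | Alt rpq rpq | Plus rpq

inductive_set plus_lang :: "nat list set \<Rightarrow> nat list set" for L where
  base: "w \<in> L \<Longrightarrow> w \<in> plus_lang L"
| step: "w \<in> L \<Longrightarrow> w' \<in> plus_lang L \<Longrightarrow> w @ w' \<in> plus_lang L"

fun lang :: "rpq \<Rightarrow> nat list set" where
  "lang Eps = {[]}"
| "lang (Sym a) = {[a]}"
| "lang (Cat p q) = {v @ w | v w. v \<in> lang p \<and> w \<in> lang q}"
| "lang (Alt p q) = lang p \<union> lang q"
| "lang (Plus p) = plus_lang (lang p)"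

fun rpq_over :: "nat \<Rightarrow> rpq \<Rightarrow> bool" where
  "rpq_over \<sigma> Eps \<longleftrightarrow> True"
| "rpq_over \<sigma> (Sym a) \<longleftrightarrow> a < \<sigma>"
| "rpq_over \<sigma> (Cat p q) \<longleftrightarrow> rpq_over \<sigma> p \<and> rpq_over \<sigma> q"
| "rpq_over \<sigma> (Alt p q) \<longleftrightarrow> rpq_over \<sigma> p \<and> rpq_over \<sigma> q"
| "rpq_over \<sigma> (Plus p) \<longleftrightarrow> rpq_over \<sigma> p"

fun rpq_length :: "rpq \<Rightarrow> nat" where
  "rpq_length Eps = 1"
| "rpq_length (Sym a) = 1"
| "rpq_length (Cat p q) = Suc (rpq_length p + rpq_length q)"
| "rpq_length (Alt p q) = Suc (rpq_length p + rpq_length q)"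
| "rpq_length (Plus p) = Suc (rpq_length p)"

inductive labelled_path :: "db \<Rightarrow> nat \<Rightarrow> nat list \<Rightarrow> nat \<Rightarrow> bool" for D where
  nil: "u \<in> fst D \<Longrightarrow> labelled_path D u [] u"
| cons: "(u, a, v) \<in> snd D \<Longrightarrow> labelled_path D v w x \<Longrightarrow> labelled_path D u (a # w) x"

definition answers :: "rpq \<Rightarrow> db \<Rightarrow> (nat \<times> nat) set" where
  "answers q D = {(u, v). \<exists>w \<in> lang q. labelled_path D u w v}"

(* The RAM.  Programs are while-programs over finitely many registers and one random-access
   memory, with a separate random-access input; every node of an expression and every command
   costs one step.  No word larger than W can be produced: a program that tries to (or that reads
   outside its input) has no run.  Below, W is always polynomial in the input size, i.e. words
   have logarithmically many bits. *)

datatype binop = Add | Sub | Mul | Div | Mod | BitAnd | BitOr | BitXor | Shl | Shr | Less | Eq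

datatype exp = Num nat | Var nat | Mem exp | Inp exp | Bin binop exp exp

datatype com =
    Skip
  | Assign nat exp
  | Store exp exp
  | Out "exp list"
  | Seq com com
  | If exp com com
  | While exp com

record ram =
  regs :: "nat \<Rightarrow> nat"
  mem :: "nat \<Rightarrow> nat"
  inp :: "nat list"

definition start :: "nat list \<Rightarrow> ram" where
  "start xs = \<lparr>regs = (\<lambda>_. 0), mem = (\<lambda>_. 0), inp = xs\<rparr>"

(* Sub is truncated, division by 0 yields 0, Shl and Shr shift the first argument. *)
fun binop_val :: "binop \<Rightarrow> nat \<Rightarrow> nat \<Rightarrow> nat" where
  "binop_val Add x y = x + y"
| "binop_val Sub x y = x - y"
| "binop_val Mul x y = x * y"
| "binop_val Div x y = x div y"
| "binop_val Mod x y = x mod y"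
| "binop_val BitAnd x y = and x y"
| "binop_val BitOr x y = or x y"
| "binop_val BitXor x y = xor x y"
| "binop_val Shl x y = push_bit y x"
| "binop_val Shr x y = drop_bit y x"
| "binop_val Less x y = of_bool (x < y)"
| "binop_val Eq x y = of_bool (x = y)"

definition word :: "nat \<Rightarrow> nat \<Rightarrow> nat option" where
  "word W x = (if x \<le> W then Some x else None)"

fun eval_exp :: "nat \<Rightarrow> ram \<Rightarrow> exp \<Rightarrow> nat option" where
  "eval_exp W s (Num n) = word W n"
| "eval_exp W s (Var x) = word W (regs s x)"
| "eval_exp W s (Mem e) = Option.bind (eval_exp W s e) (\<lambda>i. word W (mem s i))"
| "eval_exp W s (Inp e) = Option.bind (eval_exp W s e)
     (\<lambda>i. if i < length (inp s) then word W (inp s ! i) else None)"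
| "eval_exp W s (Bin f e e') = Option.bind (eval_exp W s e)
     (\<lambda>x. Option.bind (eval_exp W s e') (\<lambda>y. word W (binop_val f x y)))"

fun cost :: "exp \<Rightarrow> nat" where
  "cost (Num n) = 1"
| "cost (Var x) = 1"
| "cost (Mem e) = Suc (cost e)"
| "cost (Inp e) = Suc (cost e)"
| "cost (Bin f e e') = Suc (cost e + cost e')"

(* A run leaves a trace with one event per time step; Emit outputs a tuple of words. *)
datatype event = Tick | Emit "nat list"

abbreviation ticks :: "nat \<Rightarrow> event list" where
  "ticks k \<equiv> replicate k Tick"

inductive exec :: "nat \<Rightarrow> com \<Rightarrow> ram \<Rightarrow> event list \<Rightarrow> ram \<Rightarrow> bool" for W where
  Skip: "exec W Skip s [] s"
| Assign: "eval_exp W s e = Some v \<Longrightarrow>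
    exec W (Assign x e) s (ticks (Suc (cost e))) (s\<lparr>regs := (regs s)(x := v)\<rparr>)"
| Store: "eval_exp W s e = Some a \<Longrightarrow> eval_exp W s e' = Some v \<Longrightarrow>
    exec W (Store e e') s (ticks (Suc (cost e + cost e'))) (s\<lparr>mem := (mem s)(a := v)\<rparr>)"
| Out: "map (eval_exp W s) es = map Some vs \<Longrightarrow>
    exec W (Out es) s (ticks (sum_list (map cost es)) @ [Emit vs]) s"
| Seq: "exec W c s tr s' \<Longrightarrow> exec W c' s' tr' s'' \<Longrightarrow> exec W (Seq c c') s (tr @ tr') s''"
| If_true: "eval_exp W s e = Some v \<Longrightarrow> v \<noteq> 0 \<Longrightarrow> exec W c s tr s' \<Longrightarrow>
    exec W (If e c c') s (ticks (Suc (cost e)) @ tr) s'"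
| If_false: "eval_exp W s e = Some 0 \<Longrightarrow> exec W c' s tr s' \<Longrightarrow>
    exec W (If e c c') s (ticks (Suc (cost e)) @ tr) s'"
| While_true: "eval_exp W s e = Some v \<Longrightarrow> v \<noteq> 0 \<Longrightarrow> exec W c s tr s' \<Longrightarrow>
    exec W (While e c) s' tr' s'' \<Longrightarrow>
    exec W (While e c) s (ticks (Suc (cost e)) @ tr @ tr') s''"
| While_false: "eval_exp W s e = Some 0 \<Longrightarrow>
    exec W (While e c) s (ticks (Suc (cost e))) s"

fun emitted :: "event list \<Rightarrow> nat list list" where
  "emitted [] = []"
| "emitted (Tick # tr) = emitted tr"
| "emitted (Emit vs # tr) = vs # emitted tr"

(* Lengths of the intervals between start, successive outputs and termination; k counts the
   steps already spent in the current interval. *)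
fun gaps :: "nat \<Rightarrow> event list \<Rightarrow> nat list" where
  "gaps k [] = [k]"
| "gaps k (Tick # tr) = gaps (Suc k) tr"
| "gaps k (Emit vs # tr) = Suc k # gaps 0 tr"

definition delay :: "event list \<Rightarrow> nat" where
  "delay tr = Max (set (gaps 0 tr))"

(* Adjacency lists of a database with nodes 0, ..., n - 1: entry u lists the pairs (a, v) of the
   arcs (u, a, v), in any order.  They are stored as n, then n + 1 offsets (the number of arcs
   that precede the list of u), then all lists, and finally the query in prefix notation. *)
type_synonym adjacency = "(nat \<times> nat) list list"

definition adjacency_over :: "nat \<Rightarrow> adjacency \<Rightarrow> bool" where
  "adjacency_over \<sigma> ls \<longleftrightarrow>
     (\<forall>l \<in> set ls. distinct l \<and> (\<forall>(a, v) \<in> set l. a < \<sigma> \<and> v < length ls))"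

definition db_of :: "adjacency \<Rightarrow> db" where
  "db_of ls = ({..<length ls}, {(u, a, v). u < length ls \<and> (a, v) \<in> set (ls ! u)})"

fun enc_rpq :: "rpq \<Rightarrow> nat list" where
  "enc_rpq Eps = [0]"
| "enc_rpq (Sym a) = [1, a]"
| "enc_rpq (Cat p q) = 2 # enc_rpq p @ enc_rpq q"
| "enc_rpq (Alt p q) = 3 # enc_rpq p @ enc_rpq q"
| "enc_rpq (Plus p) = 4 # enc_rpq p"

definition enc_instance :: "adjacency \<Rightarrow> rpq \<Rightarrow> nat list" where
  "enc_instance ls q =
     length ls # map (\<lambda>u. length (concat (take u ls))) [0..<Suc (length ls)]
       @ concat (map (\<lambda>(a, v). [a, v]) (concat ls)) @ enc_rpq q"

datatype update = InsArc nat nat nat | DelArc nat nat nat | InsNode nat | DelNode nat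

fun enc_update :: "update \<Rightarrow> nat list" where
  "enc_update (InsArc u a v) = [0, u, a, v]"
| "enc_update (DelArc u a v) = [1, u, a, v]"
| "enc_update (InsNode v) = [2, v]"
| "enc_update (DelNode v) = [3, v]"

(* Names of inserted nodes are below N. *)
fun allowed :: "nat \<Rightarrow> nat \<Rightarrow> db \<Rightarrow> update \<Rightarrow> bool" where
  "allowed \<sigma> N (V, E) (InsArc u a v) \<longleftrightarrow> u \<in> V \<and> a < \<sigma> \<and> v \<in> V \<and> (u, a, v) \<notin> E"
| "allowed \<sigma> N (V, E) (DelArc u a v) \<longleftrightarrow> (u, a, v) \<in> E"
| "allowed \<sigma> N (V, E) (InsNode v) \<longleftrightarrow> v \<notin> V \<and> v < N"
| "allowed \<sigma> N (V, E) (DelNode v) \<longleftrightarrow> v \<in> V \<and> (\<forall>(u, a, u') \<in> E. u \<noteq> v \<and> u' \<noteq> v)"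

fun apply_update :: "update \<Rightarrow> db \<Rightarrow> db" where
  "apply_update (InsArc u a v) (V, E) = (V, insert (u, a, v) E)"
| "apply_update (DelArc u a v) (V, E) = (V, E - {(u, a, v)})"
| "apply_update (InsNode v) (V, E) = (insert v V, E)"
| "apply_update (DelNode v) (V, E) = (V - {v}, E)"

datatype request = Update update | Enumerate

(* From machine state s, which stores database D, the routines upd and enm serve every request of
   the sequence in time; bu and bd bound the update time and the delay in terms of |V|.  Registers
   and memory persist between the routines. *)
fun serves :: "nat \<Rightarrow> nat \<Rightarrow> nat \<Rightarrow> com \<Rightarrow> com \<Rightarrow> rpq \<Rightarrow> (nat \<Rightarrow> real) \<Rightarrow> (nat \<Rightarrow> real)
    \<Rightarrow> db \<Rightarrow> ram \<Rightarrow> request list \<Rightarrow> bool" where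
  "serves \<sigma> N W upd enm q bu bd D s [] \<longleftrightarrow> True"
| "serves \<sigma> N W upd enm q bu bd D s (Update x # rs) \<longleftrightarrow>
     (allowed \<sigma> N D x \<longrightarrow>
       (\<exists>tr s'. exec W upd (s\<lparr>inp := enc_update x\<rparr>) tr s' \<and> emitted tr = []
          \<and> real (length tr) \<le> bu (card (fst (apply_update x D)))
          \<and> serves \<sigma> N W upd enm q bu bd (apply_update x D) s' rs))"
| "serves \<sigma> N W upd enm q bu bd D s (Enumerate # rs) \<longleftrightarrow>
     (\<exists>tr s'. exec W enm (s\<lparr>inp := []\<rparr>) tr s'
        \<and> distinct (emitted tr) \<and> set (emitted tr) = (\<lambda>(u, v). [u, v]) ` answers q D
        \<and> real (delay tr) \<le> bd (card (fst D))
        \<and> serves \<sigma> N W upd enm q bu bd D s' rs)"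

(* The routines pre, upd and enm solve dynamic Enum with preprocessing O(tp), update time O(tu)
   and delay O(td), where tp, tu and td depend on |V| and |q|.  The word bound is polynomial in
   |q| and in a bound N on the node names of the history. *)
definition solves_Enum :: "nat \<Rightarrow> com \<Rightarrow> com \<Rightarrow> com
    \<Rightarrow> (nat \<Rightarrow> nat \<Rightarrow> real) \<Rightarrow> (nat \<Rightarrow> nat \<Rightarrow> real) \<Rightarrow> (nat \<Rightarrow> nat \<Rightarrow> real) \<Rightarrow> bool" where
  "solves_Enum \<sigma> pre upd enm tp tu td \<longleftrightarrow>
     (\<exists>(C::nat) (d::nat) (c::real). \<forall>ls q N rs.
        adjacency_over \<sigma> ls \<and> rpq_over \<sigma> q \<and> length ls \<le> N \<longrightarrow>
        (let W = C * (N + rpq_length q + 2) ^ d; l = rpq_length q in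
         \<exists>tr s. exec W pre (start (enc_instance ls q)) tr s \<and> emitted tr = []
           \<and> real (length tr) \<le> c * tp (length ls) l
           \<and> serves \<sigma> N W upd enm q (\<lambda>v. c * tu v l) (\<lambda>v. c * td v l) (db_of ls) s rs))"

(* Only the entries with indices below n matter; matrices are passed row by row. *)
type_synonym bmat = "nat \<Rightarrow> nat \<Rightarrow> bool"
type_synonym bvec = "nat \<Rightarrow> bool"

definition enc_vec :: "nat \<Rightarrow> bvec \<Rightarrow> nat list" where
  "enc_vec n v = map (\<lambda>i. of_bool (v i)) [0..<n]"

definition enc_mat :: "nat \<Rightarrow> bmat \<Rightarrow> nat list" where
  "enc_mat n M = concat (map (\<lambda>i. enc_vec n (M i)) [0..<n])"

definition mat_vec :: "nat \<Rightarrow> bmat \<Rightarrow> bvec \<Rightarrow> bvec" where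
  "mat_vec n M v i \<longleftrightarrow> (\<exists>j<n. M i j \<and> v j)"

definition mat_mul :: "nat \<Rightarrow> bmat \<Rightarrow> bmat \<Rightarrow> bmat" where
  "mat_mul n A B i j \<longleftrightarrow> (\<exists>k<n. A i k \<and> B k j)"

(* One run of rnd per vector, each starting in the state left by the previous one, so that the
   product with a vector is output before the next vector is available; t is the total time. *)
inductive omv_rounds :: "nat \<Rightarrow> com \<Rightarrow> nat \<Rightarrow> bmat \<Rightarrow> ram \<Rightarrow> bvec list \<Rightarrow> nat \<Rightarrow> bool"
  for W rnd n M where
  nil: "omv_rounds W rnd n M s [] 0"
| cons: "exec W rnd (s\<lparr>inp := enc_vec n v\<rparr>) tr s' \<Longrightarrow>
    emitted tr = map (\<lambda>b. [b]) (enc_vec n (mat_vec n M v)) \<Longrightarrow>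
    omv_rounds W rnd n M s' vs t \<Longrightarrow>
    omv_rounds W rnd n M s (v # vs) (length tr + t)"

definition solves_OMv :: "com \<Rightarrow> com \<Rightarrow> (nat \<Rightarrow> real) \<Rightarrow> bool" where
  "solves_OMv pre rnd T \<longleftrightarrow>
     (\<exists>(C::nat) (d::nat) (c::real). \<forall>n\<ge>1. \<forall>M vs. length vs = n \<longrightarrow>
        (let W = C * (n + 2) ^ d in
         \<exists>tr s t. exec W pre (start (n # enc_mat n M)) tr s \<and> emitted tr = []
           \<and> omv_rounds W rnd n M s vs t \<and> real (length tr + t) \<le> c * T n))"

definition OMv_hypothesis :: bool where
  "OMv_hypothesis \<longleftrightarrow>
     (\<forall>\<epsilon>>0. \<not> (\<exists>pre rnd. solves_OMv pre rnd (\<lambda>n. real n powr (3 - \<epsilon>))))"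

definition solves_BMM :: "com \<Rightarrow> (nat \<Rightarrow> real) \<Rightarrow> bool" where
  "solves_BMM p T \<longleftrightarrow>
     (\<exists>(C::nat) (d::nat) (c::real). \<forall>n\<ge>1. \<forall>A B.
        \<exists>tr s. exec (C * (n + 2) ^ d) p (start (n # enc_mat n A @ enc_mat n B)) tr s
          \<and> emitted tr = map (\<lambda>b. [b]) (enc_mat n (mat_mul n A B))
          \<and> real (length tr) \<le> c * T n)"

(* "Combinatorial" has no formal definition; comb is an arbitrary class of programs that is read
   as the class of combinatorial ones. *)
definition combinatorial_BMM_hypothesis :: "(com \<Rightarrow> bool) \<Rightarrow> bool" where
  "combinatorial_BMM_hypothesis comb \<longleftrightarrow>
     (\<forall>\<epsilon>>0. \<not> (\<exists>p. comb p \<and> solves_BMM p (\<lambda>n. real n powr (3 - \<epsilon>))))"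

(* What is required of such a class is that it is preserved by the black-box reduction bmm_via
   below.  Closure under arbitrary surrounding code would not do: it would put every program into
   the class, including fast algebraic multiplication.  bmm_via is the schoolbook block
   multiplication with blocks of side s = ceiling (n^(1/4)) in which the product of the blocks
   (I, K) of A and (K, J) of B is computed (naively) only if it contributes a new 1 to C.  This is
   tested with Enum: in a layered graph on 2 + 4 s nodes with arcs from layer to layer

     0 -> row i -> k -> column j -> row i -> 1

   for the ones of A, the ones of B and the zeros of the present C, where the first and last arc
   are inserted for one row i at a time, there is a path of length 5 from 0 to 1 iff row i of the
   block product contributes a new 1; it is the only possible pair at distance 5.

   Memory of the compound program: the cells 4 a hold the memory of the Enum routines, 4 a + 1
   their input, 4 a + 2 a log of the cells they wrote (for resetting them), 4 a + 3 the matrix C.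
   Their register x becomes register x + 14. *)

abbreviation plus_exp :: "exp \<Rightarrow> exp \<Rightarrow> exp" (infixl "+\<^sub>e" 65) where "e +\<^sub>e e' \<equiv> Bin Add e e'"
abbreviation times_exp :: "exp \<Rightarrow> exp \<Rightarrow> exp" (infixl "*\<^sub>e" 70) where "e *\<^sub>e e' \<equiv> Bin Mul e e'"
abbreviation less_exp :: "exp \<Rightarrow> exp \<Rightarrow> exp" (infix "<\<^sub>e" 50) where "e <\<^sub>e e' \<equiv> Bin Less e e'"
abbreviation seq_com :: "com \<Rightarrow> com \<Rightarrow> com" (infixr ";;" 40) where "c ;; c' \<equiv> Seq c c'"
abbreviation assign_com :: "nat \<Rightarrow> exp \<Rightarrow> com" (infix "::=" 45) where "x ::= e \<equiv> Assign x e"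

abbreviation (input) "rn \<equiv> 0::nat"      (* dimension *)
abbreviation (input) "rs \<equiv> 1::nat"      (* side of the blocks *)
abbreviation (input) "rI \<equiv> 2::nat"      (* first row, inner index and column of the current blocks *)
abbreviation (input) "rK \<equiv> 3::nat"
abbreviation (input) "rJ \<equiv> 4::nat"
abbreviation (input) "ri \<equiv> 5::nat"      (* indices within the blocks *)
abbreviation (input) "rk \<equiv> 6::nat"
abbreviation (input) "rj \<equiv> 7::nat"
abbreviation (input) "ru \<equiv> 8::nat"      (* node whose adjacency list is being written *)
abbreviation (input) "rm \<equiv> 9::nat"      (* number of arcs written *)
abbreviation (input) "rlog \<equiv> 10::nat"   (* length of the log *)
abbreviation (input) "rfound \<equiv> 11::nat" (* the Enum routine has produced an output *)
abbreviation (input) "ryes \<equiv> 12::nat"   (* the block product contributes a new 1 *)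

fun embed_exp :: "exp \<Rightarrow> exp" where
  "embed_exp (Num n) = Num n"
| "embed_exp (Var x) = Var (x + 14)"
| "embed_exp (Mem e) = Mem (Num 4 *\<^sub>e embed_exp e)"
| "embed_exp (Inp e) = Mem (Num 4 *\<^sub>e embed_exp e +\<^sub>e Num 1)"
| "embed_exp (Bin f e e') = Bin f (embed_exp e) (embed_exp e')"

fun embed :: "com \<Rightarrow> com" where
  "embed Skip = Skip"
| "embed (Assign x e) = (x + 14 ::= embed_exp e)"
| "embed (Store e e') =
     (Store (Num 4 *\<^sub>e Var rlog +\<^sub>e Num 2) (embed_exp e) ;;
      rlog ::= Var rlog +\<^sub>e Num 1 ;;
      Store (Num 4 *\<^sub>e embed_exp e) (embed_exp e'))"
| "embed (Out es) = (rfound ::= Num 1)"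
| "embed (Seq c c') = (embed c ;; embed c')"
| "embed (If e c c') = If (embed_exp e) (embed c) (embed c')"
| "embed (While e c) = While (embed_exp e) (embed c)"

(* A strict upper bound on the registers used. *)
fun exp_regs :: "exp \<Rightarrow> nat" where
  "exp_regs (Num n) = 0"
| "exp_regs (Var x) = Suc x"
| "exp_regs (Mem e) = exp_regs e"
| "exp_regs (Inp e) = exp_regs e"
| "exp_regs (Bin f e e') = max (exp_regs e) (exp_regs e')"

fun com_regs :: "com \<Rightarrow> nat" where
  "com_regs Skip = 0"
| "com_regs (Assign x e) = max (Suc x) (exp_regs e)"
| "com_regs (Store e e') = max (exp_regs e) (exp_regs e')"
| "com_regs (Out es) = foldr (\<lambda>e. max (exp_regs e)) es 0"
| "com_regs (Seq c c') = max (com_regs c) (com_regs c')"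
| "com_regs (If e c c') = max (exp_regs e) (max (com_regs c) (com_regs c'))"
| "com_regs (While e c) = max (exp_regs e) (com_regs c)"

definition seqs :: "com list \<Rightarrow> com" where
  "seqs cs = foldr Seq cs Skip"

definition upto :: "nat \<Rightarrow> exp \<Rightarrow> exp \<Rightarrow> com \<Rightarrow> com" where
  "upto x b st c = (x ::= Num 0 ;; While (Var x <\<^sub>e b) (c ;; x ::= Var x +\<^sub>e st))"

definition loop :: "nat \<Rightarrow> com \<Rightarrow> com" where
  "loop x c = upto x (Var rs) (Num 1) c"

(* The indices within the blocks as indices of the whole matrices. *)
abbreviation "gi \<equiv> Var rI +\<^sub>e Var ri"
abbreviation "gk \<equiv> Var rK +\<^sub>e Var rk"
abbreviation "gj \<equiv> Var rJ +\<^sub>e Var rj"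

definition if_in_range :: "exp \<Rightarrow> exp \<Rightarrow> com \<Rightarrow> com" where
  "if_in_range e e' c = If (e <\<^sub>e Var rn) (If (e' <\<^sub>e Var rn) c Skip) Skip"

definition if_A :: "com \<Rightarrow> com" where
  "if_A c = if_in_range gi gk (If (Inp (Num 1 +\<^sub>e gi *\<^sub>e Var rn +\<^sub>e gk)) c Skip)"

definition if_B :: "com \<Rightarrow> com" where
  "if_B c = if_in_range gk gj
     (If (Inp (Num 1 +\<^sub>e Var rn *\<^sub>e Var rn +\<^sub>e gk *\<^sub>e Var rn +\<^sub>e gj)) c Skip)"

definition cell_C :: "exp \<Rightarrow> exp \<Rightarrow> exp" where
  "cell_C e e' = Num 4 *\<^sub>e (e *\<^sub>e Var rn +\<^sub>e e') +\<^sub>e Num 3"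

definition if_not_C :: "com \<Rightarrow> com" where
  "if_not_C c = if_in_range gi gj (If (Mem (cell_C gi gj)) Skip c)"

definition put :: "exp \<Rightarrow> exp \<Rightarrow> com" where
  "put e e' = Store (Num 4 *\<^sub>e e +\<^sub>e Num 1) e'"

definition node :: "nat \<Rightarrow> nat \<Rightarrow> exp" where
  "node layer x = Num 2 +\<^sub>e Num layer *\<^sub>e Var rs +\<^sub>e Var x"

(* Position in the instance of the next arc: 2 + (number of nodes) + 2 * (number of arcs). *)
abbreviation "next_pos \<equiv> Num 4 +\<^sub>e Num 4 *\<^sub>e Var rs +\<^sub>e Num 2 *\<^sub>e Var rm"

definition put_arc :: "exp \<Rightarrow> com" where
  "put_arc v = (put next_pos (Num 0) ;; put (next_pos +\<^sub>e Num 1) v ;; rm ::= Var rm +\<^sub>e Num 1)"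

definition put_offset :: com where
  "put_offset = (put (Num 1 +\<^sub>e Var ru) (Var rm) ;; ru ::= Var ru +\<^sub>e Num 1)"

definition five_arcs :: rpq where
  "five_arcs = Cat (Sym 0) (Cat (Sym 0) (Cat (Sym 0) (Cat (Sym 0) (Sym 0))))"

definition put_query :: com where
  "put_query = seqs (map (\<lambda>(i, x). put (next_pos +\<^sub>e Num i) (Num x))
     (zip [0..<length (enc_rpq five_arcs)] (enc_rpq five_arcs)))"

definition build :: com where
  "build =
    (put (Num 0) (Num 2 +\<^sub>e Num 4 *\<^sub>e Var rs) ;;
     rm ::= Num 0 ;; ru ::= Num 0 ;;
     put_offset ;; put_offset ;;
     loop ri (put_offset ;; loop rk (if_A (put_arc (node 1 rk)))) ;;
     loop rk (put_offset ;; loop rj (if_B (put_arc (node 2 rj)))) ;;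
     loop rj (put_offset ;; loop ri (if_not_C (put_arc (node 3 ri)))) ;;
     loop ri put_offset ;;
     put_offset ;;
     put_query)"

definition reset :: "nat \<Rightarrow> com" where
  "reset b =
    (While (Var rlog)
       (rlog ::= Bin Sub (Var rlog) (Num 1) ;;
        Store (Num 4 *\<^sub>e Mem (Num 4 *\<^sub>e Var rlog +\<^sub>e Num 2)) (Num 0)) ;;
     seqs (map (\<lambda>x. x + 14 ::= Num 0) [0..<b]))"

(* opc is 0 for the insertion and 1 for the deletion of the arc (e, 0, e'). *)
definition call_update :: "com \<Rightarrow> nat \<Rightarrow> exp \<Rightarrow> exp \<Rightarrow> com" where
  "call_update upd opc e e' =
    (put (Num 0) (Num opc) ;; put (Num 1) e ;; put (Num 2) (Num 0) ;; put (Num 3) e' ;; embed upd)"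

definition test_blocks :: "com \<Rightarrow> com \<Rightarrow> com \<Rightarrow> com" where
  "test_blocks pre upd enm =
    (reset (max (com_regs pre) (max (com_regs upd) (com_regs enm))) ;;
     build ;; embed pre ;;
     ryes ::= Num 0 ;;
     loop ri
       (call_update upd 0 (Num 0) (node 0 ri) ;;
        call_update upd 0 (node 3 ri) (Num 1) ;;
        rfound ::= Num 0 ;; embed enm ;;
        ryes ::= Bin BitOr (Var ryes) (Var rfound) ;;
        call_update upd 1 (Num 0) (node 0 ri) ;;
        call_update upd 1 (node 3 ri) (Num 1)))"

definition multiply_blocks :: com where
  "multiply_blocks =
     loop ri (loop rk (if_A (loop rj (if_B (Store (cell_C gi gj) (Num 1))))))"

definition bmm_via :: "com \<Rightarrow> com \<Rightarrow> com \<Rightarrow> com" where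
  "bmm_via pre upd enm =
    (rn ::= Inp (Num 0) ;;
     rs ::= Num 1 ;;
     While (Var rs *\<^sub>e Var rs *\<^sub>e Var rs *\<^sub>e Var rs <\<^sub>e Var rn) (rs ::= Var rs +\<^sub>e Num 1) ;;
     upto rI (Var rn) (Var rs) (upto rK (Var rn) (Var rs) (upto rJ (Var rn) (Var rs)
       (test_blocks pre upd enm ;; If (Var ryes) multiply_blocks Skip))) ;;
     upto ri (Var rn) (Num 1) (upto rj (Var rn) (Num 1)
       (Out [Mem (cell_C (Var ri) (Var rj))])))"

definition closed_under_reduction :: "(com \<Rightarrow> bool) \<Rightarrow> bool" where
  "closed_under_reduction comb \<longleftrightarrow>
     (\<forall>pre upd enm. comb pre \<and> comb upd \<and> comb enm \<longrightarrow> comb (bmm_via pre upd enm))"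

end

theory Submission
  imports Defs
begin

text \<open>
  Enum is used only as a test for the existence of a path: in a layered graph in which the two
  outermost layers are the single nodes 0 and 1, the query asking for a path across all layers has
  at most the answer \<open>(0, 1)\<close>, so that one enumeration takes at most twice the delay.

  For OMv, the ones of the matrix are arcs from row nodes to column nodes. A vector is represented by
  arcs from columns to 1, and the \<open>i\<close>-th entry of the product is found by adding the arc from 0 to
  row \<open>i\<close>. Starting from the empty database makes the cost of the preprocessing irrelevant.

  For BMM, the reduction is fixed by the hypothesis on the class of programs. With
  \<open>x = n\<^sup>1\<^sup>/\<^sup>4\<close> and blocks of side about \<open>x\<close>, there are \<open>O(x\<^sup>9)\<close> triples of blocks, each tested
  in time \<open>O(x powr (3 - \<epsilon>))\<close>. A naive multiplication of blocks, of cost \<open>O(x\<^sup>3)\<close>, happens only if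
  it creates a new one in the product; so the number of ones is a potential that pays for these
  multiplications, and they cost \<open>O(x\<^sup>1\<^sup>1)\<close> in total. Everything is bounded by
  \<open>x powr (12 - \<epsilon>) = n powr (3 - \<epsilon> / 4)\<close>.

  All words are kept below \<open>W = B ^ 20\<close>, where \<open>B\<close> bounds the contents of all registers and cells:
  intermediate values of an expression of cost at most 20 then never overflow.
\<close>

section \<open>Weakest preconditions for the RAM\<close>

text \<open>Blocks of side n^a lead to n^(3 - 3a) tests of cost n^(a (3 - eps)), in total n^(3 - a
  eps), and to at most n^2 naive products of cost n^(3a). So a must stay below 1/3, and a = 1/4
  yields the saving eps / 4. Two obstacles shape the BMM half. Every test must start the Enum
  routines on blank registers and memory, while blanking all reachable memory might cost more than
  the test itself; hence the log of written cells, which is no longer than the time bound of the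
  previous test. Moreover, \<open>solves_Enum\<close> promises runs only for a list of requests
  fixed in advance, so the invariants carry the list of all future requests. Replacing eps by
  \<open>min \<epsilon> 1\<close> keeps the exponents of all bounds nonnegative, hence the bounds
  monotone in the number of nodes, and lets the main term absorb the overhead of the reductions. A
  program that overflows has no run, so every \<open>wp\<close> statement includes the absence of
  overflow.\<close>

definition wp :: "nat \<Rightarrow> com \<Rightarrow> ram \<Rightarrow> (nat list list \<Rightarrow> nat \<Rightarrow> ram \<Rightarrow> bool) \<Rightarrow> bool" where
  "wp W c s Q \<longleftrightarrow> (\<exists>tr s'. exec W c s tr s' \<and> Q (emitted tr) (length tr) s')"

lemma emitted_append [simp]: "emitted (tr @ tr') = emitted tr @ emitted tr'"
  by (induction tr rule: emitted.induct) auto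

lemma emitted_ticks [simp]: "emitted (ticks k) = []"
  by (induction k) auto

lemma wp_mono: "wp W c s Q' \<Longrightarrow> (\<And>out t s'. Q' out t s' \<Longrightarrow> Q out t s') \<Longrightarrow> wp W c s Q"
  unfolding wp_def by blast

lemma wp_exec:
  assumes "wp W c s Q"
  obtains tr s' where "exec W c s tr s'" "Q (emitted tr) (length tr) s'"
  using assms unfolding wp_def by blast

lemma wp_Skip: "Q [] 0 s \<Longrightarrow> wp W Skip s Q"
  unfolding wp_def by (intro exI[of _ "[]"] exI[of _ s]) (auto intro: exec.intros)

lemma wp_Seq:
  assumes "wp W c s (\<lambda>out t s'. wp W c' s' (\<lambda>out' t' s''. Q (out @ out') (t + t') s''))"
  shows "wp W (c ;; c') s Q"
  using assms unfolding wp_def by (metis exec.Seq emitted_append length_append)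

lemma wp_bind:
  assumes "wp W c s P"
    and "\<And>out t s'. P out t s' \<Longrightarrow> wp W c' s' (\<lambda>out' t' s''. Q (out @ out') (t + t') s'')"
  shows "wp W (c ;; c') s Q"
  by (intro wp_Seq, rule wp_mono[OF assms(1)], rule assms(2))

text \<open>The four lanes are the interleaved memories of the compound program.\<close>
definition lane :: "nat \<Rightarrow> ram \<Rightarrow> nat \<Rightarrow> nat" where
  "lane k s a = mem s (4 * a + k)"

definition hosted_regs :: "ram \<Rightarrow> nat \<Rightarrow> nat" where
  "hosted_regs s x = regs s (x + 14)"

text \<open>Updates are constants of their own so that the simplifier works with lanes and hosted
  registers instead of addresses of the form \<open>4 * a + k\<close>.\<close>

definition set_reg :: "nat \<Rightarrow> nat \<Rightarrow> ram \<Rightarrow> ram" where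
  "set_reg x v s = s\<lparr>regs := (regs s)(x := v)\<rparr>"

definition set_lane :: "nat \<Rightarrow> nat \<Rightarrow> nat \<Rightarrow> ram \<Rightarrow> ram" where
  "set_lane k a v s = s\<lparr>mem := (mem s)(4 * a + k := v)\<rparr>"

lemma set_reg_simps [simp]:
  "regs (set_reg x v s) = (regs s)(x := v)" "mem (set_reg x v s) = mem s"
  "inp (set_reg x v s) = inp s" "lane k (set_reg x v s) = lane k s"
  "x < 14 \<Longrightarrow> hosted_regs (set_reg x v s) = hosted_regs s"
  "hosted_regs (set_reg (x + 14) v s) = (hosted_regs s)(x := v)"
  by (auto simp: set_reg_def lane_def hosted_regs_def)

lemma lane_inj: "k < 4 \<Longrightarrow> j < 4 \<Longrightarrow> 4 * a + k = 4 * b + j \<longleftrightarrow> a = b \<and> k = (j::nat)"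
  by presburger

lemma set_lane_simps [simp]:
  "regs (set_lane k a v s) = regs s" "inp (set_lane k a v s) = inp s"
  "hosted_regs (set_lane k a v s) = hosted_regs s"
  "k < 4 \<Longrightarrow> j < 4 \<Longrightarrow> lane j (set_lane k a v s) = (if j = k then (lane k s)(a := v) else lane j s)"
  by (auto simp: set_lane_def lane_def hosted_regs_def fun_eq_iff lane_inj)

lemma inp_update_simps [simp]:
  "lane k (s\<lparr>inp := xs\<rparr>) = lane k s" "hosted_regs (s\<lparr>inp := xs\<rparr>) = hosted_regs s"
  by (auto simp: lane_def hosted_regs_def fun_eq_iff)

section \<open>Evaluation of expressions without overflow\<close>

definition bounded :: "nat \<Rightarrow> ram \<Rightarrow> bool" where
  "bounded B s \<longleftrightarrow> (\<forall>x. regs s x \<le> B) \<and> (\<forall>a. mem s a \<le> B) \<and> (\<forall>v \<in> set (inp s). v \<le> B)"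

lemma bounded_set_reg [simp]: "bounded B s \<Longrightarrow> v \<le> B \<Longrightarrow> bounded B (set_reg x v s)"
  by (auto simp: bounded_def)

lemma bounded_set_lane [simp]: "bounded B s \<Longrightarrow> v \<le> B \<Longrightarrow> bounded B (set_lane k a v s)"
  by (auto simp: bounded_def set_lane_def)

lemma bounded_regs: "bounded B s \<Longrightarrow> regs s x \<le> B"
  by (auto simp: bounded_def)

text \<open>Evaluation without the overflow check. Reads beyond the input, which here yield an
  unspecified value, are excluded by \<open>safe\<close>.\<close>

fun val :: "ram \<Rightarrow> exp \<Rightarrow> nat" where
  "val s (Num n) = n"
| "val s (Var x) = regs s x"
| "val s (Mem e) = mem s (val s e)"
| "val s (Inp e) = inp s ! val s e"
| "val s (Bin f e e') = binop_val f (val s e) (val s e')"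

text \<open>Sums and products are the only growing operations, so the value of such an expression is
  at most \<open>B ^ cost e\<close> if its leaves are at most \<open>B\<close>.\<close>
fun safe :: "nat \<Rightarrow> ram \<Rightarrow> exp \<Rightarrow> bool" where
  "safe B s (Num n) \<longleftrightarrow> n \<le> B"
| "safe B s (Var x) \<longleftrightarrow> True"
| "safe B s (Mem e) \<longleftrightarrow> safe B s e"
| "safe B s (Inp e) \<longleftrightarrow> safe B s e \<and> val s e < length (inp s)"
| "safe B s (Bin f e e') \<longleftrightarrow> f \<in> {Add, Sub, Mul, Less, Eq} \<and> safe B s e \<and> safe B s e'"

lemma cost_pos [simp]: "0 < cost e"
  by (cases e) auto

lemma val_le:
  assumes "bounded B s" "2 \<le> B" "safe B s e"
  shows "val s e \<le> B ^ cost e"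
  using assms(3)
proof (induction e)
  case (Num n)
  then show ?case by simp
next
  case (Var x)
  then show ?case using assms by (simp add: bounded_def)
next
  case (Mem e)
  have "mem s (val s e) \<le> B ^ 1" using assms by (simp add: bounded_def)
  also have "\<dots> \<le> B ^ cost (Mem e)" using assms by (intro power_increasing) auto
  finally show ?case by simp
next
  case (Inp e)
  have "inp s ! val s e \<le> B ^ 1" using assms Inp by (simp add: bounded_def)
  also have "\<dots> \<le> B ^ cost (Inp e)" using assms by (intro power_increasing) auto
  finally show ?case by simp
next
  case (Bin f e e')
  let ?x = "val s e" and ?y = "val s e'"
  have IH: "?x \<le> B ^ cost e" "?y \<le> B ^ cost e'" using Bin by auto
  have ge: "B ^ cost e \<ge> 2" "B ^ cost e' \<ge> 2"
    using assms power_increasing[of 1 "cost e" B] power_increasing[of 1 "cost e'" B]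
    by (auto simp: Suc_le_eq)
  have prod: "B ^ cost e * B ^ cost e' \<le> B ^ cost (Bin f e e')"
    using assms by (simp add: power_add)
  \<comment> \<open>For factors at least 2 the product dominates the sum, so addition grows no
    faster than multiplication.\<close>
  have sum: "B ^ cost e + B ^ cost e' \<le> B ^ cost e * B ^ cost e'"
  proof -
    obtain p r where "B ^ cost e = p + 2" "B ^ cost e' = r + 2"
      using ge by (metis add.commute le_Suc_ex)
    then show ?thesis by (simp add: algebra_simps)
  qed
  have one: "1 \<le> B ^ cost e" using ge by simp
  have "?x * ?y \<le> B ^ cost e * B ^ cost e'" using IH by (intro mult_mono) auto
  moreover have "?x + ?y \<le> B ^ cost e + B ^ cost e'" using IH by simp
  ultimately show ?case using Bin.prems prod sum one IH
    by (cases f) (auto simp del: cost.simps intro: order_trans)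
qed

lemma eval_exp_safe:
  assumes "bounded B s" "2 \<le> B" "safe B s e" "B ^ cost e \<le> W"
  shows "eval_exp W s e = Some (val s e)"
  using assms(3,4)
proof (induction e)
  case (Mem e)
  have "B ^ cost e \<le> B ^ cost (Mem e)" using assms by (intro power_increasing) auto
  then have "B ^ cost e \<le> W" using Mem.prems(2) by (rule order_trans)
  then show ?case using Mem val_le[OF assms(1,2) Mem.prems(1)] by (simp add: word_def)
next
  case (Inp e)
  have "B ^ cost e \<le> B ^ cost (Inp e)" using assms by (intro power_increasing) auto
  then have "B ^ cost e \<le> W" using Inp.prems(2) by (rule order_trans)
  then show ?case using Inp val_le[OF assms(1,2) Inp.prems(1)] by (simp add: word_def)
next
  case (Bin f e e')
  have "B ^ cost e \<le> B ^ cost (Bin f e e')" "B ^ cost e' \<le> B ^ cost (Bin f e e')"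
    using assms by (auto intro!: power_increasing simp del: power_Suc)
  from this[THEN order_trans, OF Bin.prems(2)]
  have "B ^ cost e \<le> W" "B ^ cost e' \<le> W" .
  then show ?case using Bin val_le[OF assms(1,2) Bin.prems(1)] by (simp add: word_def)
next
  case (Num n)
  then show ?case using val_le[OF assms(1,2) Num.prems(1)] by (simp add: word_def)
next
  case (Var x)
  then show ?case using val_le[OF assms(1,2) Var.prems(1)] by (simp add: word_def)
qed

text \<open>The exponent 20 covers every expression of the compound programs outside the hosted
  routines, and \<open>20 \<le> B\<close> makes their numerals safe.\<close>

locale words =
  fixes W B :: nat
  assumes B_ge: "20 \<le> B" and W_ge: "B ^ 20 \<le> W"
begin

lemma eval_safe:
  assumes "bounded B s" "safe B s e" "cost e \<le> 20"
  shows "eval_exp W s e = Some (val s e)"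
proof -
  have "B ^ cost e \<le> B ^ 20" using B_ge assms(3) by (intro power_increasing) auto
  then have "B ^ cost e \<le> W" using W_ge by (rule order_trans)
  then show ?thesis using assms B_ge by (intro eval_exp_safe) simp_all
qed

lemma wp_Assign:
  assumes "bounded B s" "safe B s e" "cost e \<le> 20"
    and "Q [] (Suc (cost e)) (set_reg x (val s e) s)"
  shows "wp W (x ::= e) s Q"
  unfolding wp_def using exec.Assign[OF eval_safe[OF assms(1-3)]] assms(4)
  by (fastforce simp: set_reg_def)

lemma wp_Store:
  assumes "bounded B s" "safe B s e" "cost e \<le> 20" "safe B s e'" "cost e' \<le> 20"
    and "val s e = 4 * a + k" and "Q [] (Suc (cost e + cost e')) (set_lane k a (val s e') s)"
  shows "wp W (Store e e') s Q"
  unfolding wp_def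
  using exec.Store[OF eval_safe[OF assms(1-3)] eval_safe[OF assms(1,4,5)]] assms(6,7)
  by (fastforce simp: set_lane_def)

text \<open>\<open>put\<close> turns the address \<open>e\<close> into \<open>4 * e + 1\<close>,
  which adds 4 to its cost; this explains the bound 16 in place of 20.\<close>

lemma wp_put:
  assumes "bounded B s" "safe B s e" "cost e \<le> 16" "safe B s e'" "cost e' \<le> 20"
    and "Q [] (cost e + cost e' + 5) (set_lane 1 (val s e) (val s e') s)"
  shows "wp W (put e e') s Q"
  unfolding put_def
  by (rule wp_Store[where a = "val s e" and k = 1])
    (use assms B_ge in \<open>auto simp: eval_nat_numeral\<close>)

lemma wp_Out:
  assumes "bounded B s" "safe B s e" "cost e \<le> 20" and "Q [[val s e]] (Suc (cost e)) s"
  shows "wp W (Out [e]) s Q"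
  unfolding wp_def using exec.Out[of W s "[e]" "[val s e]"] eval_safe[OF assms(1-3)] assms(4)
  by fastforce

lemma wp_If:
  assumes "bounded B s" "safe B s e" "cost e \<le> 20"
    and "val s e \<noteq> 0 \<Longrightarrow> wp W c s (\<lambda>out t. Q out (Suc (cost e + t)))"
    and "val s e = 0 \<Longrightarrow> wp W c' s (\<lambda>out t. Q out (Suc (cost e + t)))"
  shows "wp W (If e c c') s Q"
proof (cases "val s e = 0")
  case True
  obtain tr s' where "exec W c' s tr s'" "Q (emitted tr) (Suc (cost e + length tr)) s'"
    using assms(5)[OF True] unfolding wp_def by blast
  then show ?thesis unfolding wp_def
    using exec.If_false[of W s e c' tr s' c] eval_safe[OF assms(1-3)] True by fastforce
next
  case False
  obtain tr s' where "exec W c s tr s'" "Q (emitted tr) (Suc (cost e + length tr)) s'"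
    using assms(4)[OF False] unfolding wp_def by blast
  then show ?thesis unfolding wp_def
    using exec.If_true[of W s e _ c tr s' c'] eval_safe[OF assms(1-3)] False by fastforce
qed

lemma wp_While_true:
  assumes "bounded B s" "safe B s e" "cost e \<le> 20" "val s e \<noteq> 0"
    and "wp W c s (\<lambda>out t s'. wp W (While e c) s'
           (\<lambda>out' t' s''. Q (out @ out') (Suc (cost e + t + t')) s''))"
  shows "wp W (While e c) s Q"
proof -
  obtain tr s' tr' s'' where "exec W c s tr s'" "exec W (While e c) s' tr' s''"
    "Q (emitted tr @ emitted tr') (Suc (cost e + length tr + length tr')) s''"
    using assms(5) unfolding wp_def by blast
  then show ?thesis unfolding wp_def
    using exec.While_true[of W s e _ c tr s' tr' s''] eval_safe[OF assms(1-3)] assms(4)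
    by (fastforce simp: add.assoc)
qed

lemma wp_While_false:
  assumes "bounded B s" "safe B s e" "cost e \<le> 20" "val s e = 0" "Q [] (Suc (cost e)) s"
  shows "wp W (While e c) s Q"
  unfolding wp_def using exec.While_false[of W s e c] eval_safe[OF assms(1-3)] assms(4,5)
  by fastforce

text \<open>The cost of an iteration is amortized by a potential of lane 3, which holds the matrix C.\<close>
lemma wp_upto:
  fixes \<Phi> :: "(nat \<Rightarrow> nat) \<Rightarrow> nat" and N S M T :: nat
  assumes cost: "cost b \<le> 18" "cost st \<le> 18"
    and init: "bounded B s" "P 0 (set_reg x 0 s)"
    and inv: "\<And>m s. m \<le> M \<Longrightarrow> P m s \<Longrightarrow> bounded B s \<and> regs s x = m * S \<and> safe B s b \<and> val s b = N
                \<and> safe B s st \<and> val s st = S"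
    and below: "\<And>m. m < M \<Longrightarrow> m * S < N" and above: "N \<le> M * S"
    and body: "\<And>m s. m < M \<Longrightarrow> P m s \<Longrightarrow> wp W c s (\<lambda>out t s'. out = res m
        \<and> t + \<Phi> (lane 3 s) \<le> T + \<Phi> (lane 3 s') \<and> bounded B s' \<and> safe B s' st
        \<and> P (Suc m) (set_reg x (regs s' x + val s' st) s'))"
    and post: "\<And>t s'. P M s' \<Longrightarrow> t + \<Phi> (lane 3 s) \<le> M * (T + 50) + 50 + \<Phi> (lane 3 s')
        \<Longrightarrow> Q (concat (map res [0..<M])) t s'"
  shows "wp W (upto x b st c) s Q"
proof -
  \<comment> \<open>A test of the condition and an increment take at most 21 steps each, because
    \<open>b\<close> and \<open>st\<close> cost at most 18; so the 50 steps charged per iteration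
    suffice. The 21 outside the product is the last, failing test.\<close>
  have loop: "wp W (While (Var x <\<^sub>e b) (c ;; x ::= Var x +\<^sub>e st)) s (\<lambda>out t s'.
      out = concat (map res [m..<M]) \<and> t + \<Phi> (lane 3 s) \<le> (M - m) * (T + 50) + 21 + \<Phi> (lane 3 s')
      \<and> P M s')"
    if "P m s" "m \<le> M" for m s
    using that
  proof (induction "M - m" arbitrary: m s)
    case 0
    then have m: "m = M" by simp
    show ?case
    proof (rule wp_While_false)
      show "val s (Var x <\<^sub>e b) = 0" using inv[OF _ 0(2)] above m by simp
    qed (use inv[OF _ 0(2)] 0 m cost in auto)
  next
    case (Suc d)
    then have m: "m < M" by simp
    note P = inv[OF less_imp_le[OF m] Suc.prems(1)]
    show ?case
    proof (rule wp_While_true)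
      show "val s (Var x <\<^sub>e b) \<noteq> 0" using P below[OF m] by simp
      have "wp W (c ;; x ::= Var x +\<^sub>e st) s (\<lambda>out t s'. out = res m
          \<and> t + \<Phi> (lane 3 s) \<le> T + 21 + \<Phi> (lane 3 s') \<and> P (Suc m) s')"
      proof (intro wp_Seq, rule wp_mono[OF body[OF m Suc.prems(1)]], elim conjE, rule wp_Assign)
      qed (use cost in auto)
      then show "wp W (c ;; x ::= Var x +\<^sub>e st) s (\<lambda>out t s'.
          wp W (While (Var x <\<^sub>e b) (c ;; x ::= Var x +\<^sub>e st)) s' (\<lambda>out' t' s''.
            out @ out' = concat (map res [m..<M]) \<and>
            Suc (cost (Var x <\<^sub>e b) + t + t') + \<Phi> (lane 3 s)
              \<le> (M - m) * (T + 50) + 21 + \<Phi> (lane 3 s'') \<and> P M s''))"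
      proof (rule wp_mono, elim conjE)
        fix out t s' assume *: "out = res m" "t + \<Phi> (lane 3 s) \<le> T + 21 + \<Phi> (lane 3 s')"
          "P (Suc m) s'"
        have "M - m = Suc (M - Suc m)" using m by simp
        then have eq: "(M - m) * (T + 50) = (M - Suc m) * (T + 50) + T + 50" by simp
        show "wp W (While (Var x <\<^sub>e b) (c ;; x ::= Var x +\<^sub>e st)) s' (\<lambda>out' t' s''.
            out @ out' = concat (map res [m..<M]) \<and>
            Suc (cost (Var x <\<^sub>e b) + t + t') + \<Phi> (lane 3 s)
              \<le> (M - m) * (T + 50) + 21 + \<Phi> (lane 3 s'') \<and> P M s'')"
          using * m Suc.hyps cost unfolding eq
          by (intro wp_mono[OF Suc.hyps(1)[of "Suc m" s']]) (auto simp: upt_conv_Cons)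
      qed
    qed (use P cost in auto)
  qed
  show ?thesis unfolding upto_def
  proof (intro wp_Seq wp_Assign)
    show "wp W (While (Var x <\<^sub>e b) (c ;; x ::= Var x +\<^sub>e st)) (set_reg x (val s (Num 0)) s)
     (\<lambda>out' t' s''. Q ([] @ out') (Suc (cost (Num 0)) + t') s'')"
      by (rule wp_mono[OF loop[of 0]]) (use init in \<open>auto intro!: post\<close>)
  qed (use init in auto)
qed

end

section \<open>Running the Enum routines inside another program\<close>

lemma eval_exp_le: "eval_exp V g e = Some v \<Longrightarrow> v \<le> V"
  by (cases e) (auto simp: word_def split: if_splits bind_splits)

lemma exec_inp: "exec V c g tr g' \<Longrightarrow> inp g' = inp g"
  by (induction rule: exec.induct) auto

text \<open>Together with the initial zeros this means that clearing the registers below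
  \<open>com_regs\<close> blanks all registers of a hosted routine.\<close>

lemma exec_regs: "exec V c g tr g' \<Longrightarrow> com_regs c \<le> x \<Longrightarrow> regs g' x = regs g x"
  by (induction rule: exec.induct) auto

text \<open>The input of the hosted machine is kept apart: it is replaced between two calls, while
  registers and memory persist.\<close>

definition hosts :: "ram \<Rightarrow> ram \<Rightarrow> bool" where
  "hosts g s \<longleftrightarrow> hosted_regs s = regs g \<and> lane 0 s = mem g"

text \<open>Lane 1 may contain remnants of longer inputs behind the current one. A hosted run never
  reads them, since reading outside the input has no run.\<close>

definition input_in :: "nat list \<Rightarrow> ram \<Rightarrow> bool" where
  "input_in xs s \<longleftrightarrow> (\<forall>i<length xs. lane 1 s i = xs ! i)"

text \<open>Every cell that may have to be blanked is found in the log; repetitions are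
  harmless.\<close>

definition logged :: "ram \<Rightarrow> bool" where
  "logged s \<longleftrightarrow> (\<forall>a. lane 0 s a \<noteq> 0 \<longrightarrow> (\<exists>l<regs s rlog. lane 2 s l = a))"

text \<open>Register number 14 in \<open>R\<close> stands for all hosted registers.\<close>
definition frame :: "nat set \<Rightarrow> nat set \<Rightarrow> ram \<Rightarrow> ram \<Rightarrow> bool" where
  "frame R K s s' \<longleftrightarrow> (\<forall>x<14. x \<notin> R \<longrightarrow> regs s' x = regs s x)
     \<and> (14 \<notin> R \<longrightarrow> hosted_regs s' = hosted_regs s)
     \<and> (\<forall>k<4. k \<notin> K \<longrightarrow> lane k s' = lane k s) \<and> inp s' = inp s"

lemma frame_refl [simp]: "frame R K s s"
  by (simp add: frame_def)

lemma frame_trans: "frame R K s s' \<Longrightarrow> frame R K s' s'' \<Longrightarrow> frame R K s s''"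
  by (simp add: frame_def)

lemma frame_mono: "frame R K s s' \<Longrightarrow> R \<subseteq> R' \<Longrightarrow> K \<subseteq> K' \<Longrightarrow> frame R' K' s s'"
  by (auto simp: frame_def)

lemma frame_reg: "frame R K s s' \<Longrightarrow> x < 14 \<Longrightarrow> x \<notin> R \<Longrightarrow> regs s' x = regs s x"
  by (simp add: frame_def)

lemma frame_lane: "frame R K s s' \<Longrightarrow> k < 4 \<Longrightarrow> k \<notin> K \<Longrightarrow> lane k s' = lane k s"
  by (simp add: frame_def)

lemma frame_set_reg:
  assumes "frame R K s s'" "x \<in> R" "x < 14"
  shows "frame R K s (set_reg x v s')" "frame R K (set_reg x v s) s'"
  using assms by (auto simp: frame_def)

lemma frame_set_lane:
  assumes "frame R K s s'" "k \<in> K" "k < 4"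
  shows "frame R K s (set_lane k a v s')"
  using assms by (auto simp: frame_def)

text \<open>The worst case is \<open>Inp\<close>, where the one step of the access becomes a memory
  access whose address takes four more steps to compute.\<close>

lemma cost_embed: "cost (embed_exp e) \<le> 5 * cost e"
  by (induction e) auto

locale hosting = words +
  fixes V :: nat
  assumes V_le: "V \<le> B"
begin

text \<open>Room for the addresses \<open>4 * a + k\<close> with \<open>a\<close> up to
  \<open>B\<close>.\<close>

lemma W_large: "20 * B \<le> W"
proof -
  have "20 * B \<le> B * B" using B_ge by simp
  also have "\<dots> = B ^ 2" by (simp add: power2_eq_square)
  also have "\<dots> \<le> B ^ 20" using B_ge by (intro power_increasing) auto
  finally show ?thesis using W_ge by simp
qed

text \<open>Hosted expressions may be arbitrarily large and use every operator, so
  \<open>safe\<close> does not apply to them. Instead, each intermediate value is known to be at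
  most \<open>V\<close> because the hosted evaluation succeeds; only the address arithmetic is
  new.\<close>

lemma eval_embed:
  assumes "eval_exp V g e = Some v" "hosts g s" "input_in (inp g) s"
  shows "eval_exp W s (embed_exp e) = Some v"
  using assms(1)
proof (induction e arbitrary: v)
  case (Num n)
  then show ?case using W_large V_le by (auto simp: word_def split: if_splits)
next
  case (Var x)
  then show ?case using W_large V_le assms(2)
    by (auto simp: word_def hosts_def hosted_regs_def fun_eq_iff split: if_splits)
next
  case (Mem e)
  then obtain a where a: "eval_exp V g e = Some a" "mem g a = v" "v \<le> V"
    by (auto simp: word_def split: bind_splits if_splits)
  have "mem s (4 * a) = v" using a(2) assms(2) by (auto simp: hosts_def lane_def fun_eq_iff)
  then show ?case using Mem.IH[OF a(1)] eval_exp_le[OF a(1)] a(3) W_large V_le B_ge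
    by (simp add: word_def)
next
  case (Inp e)
  then obtain a where a: "eval_exp V g e = Some a" "a < length (inp g)" "inp g ! a = v" "v \<le> V"
    by (auto simp: word_def split: bind_splits if_splits)
  have "mem s (4 * a + 1) = v" using a(2,3) assms(3) by (auto simp: input_in_def lane_def)
  then show ?case using Inp.IH[OF a(1)] eval_exp_le[OF a(1)] a(4) W_large V_le B_ge
    by (simp add: word_def)
next
  case (Bin f e e')
  then show ?case using W_large V_le
    by (auto simp: word_def split: bind_splits if_splits)
qed

lemma wp_eval_Assign:
  assumes "eval_exp W s e = Some v" "Q [] (Suc (cost e)) (set_reg x v s)"
  shows "wp W (x ::= e) s Q"
  unfolding wp_def using exec.Assign[OF assms(1)] assms(2) by (fastforce simp: set_reg_def)

lemma wp_eval_Store: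
  assumes "eval_exp W s e = Some (4 * a + k)" "eval_exp W s e' = Some v"
    and "Q [] (Suc (cost e + cost e')) (set_lane k a v s)"
  shows "wp W (Store e e') s Q"
  unfolding wp_def using exec.Store[OF assms(1,2)] assms(3) by (fastforce simp: set_lane_def)

text \<open>Outputs of the hosted run survive only as the flag \<open>rfound\<close>. The log grows
  by at most one entry per hosted step, which makes it affordable to clear.\<close>

definition simulates :: "event list \<Rightarrow> ram \<Rightarrow> ram \<Rightarrow> nat list list \<Rightarrow> nat \<Rightarrow> ram \<Rightarrow> bool" where
  "simulates tr g' s out t s' \<longleftrightarrow> out = [] \<and> t \<le> 20 * length tr \<and> hosts g' s' \<and> bounded B s'
     \<and> frame {rlog, rfound, 14} {0, 2} s s' \<and> (logged s \<longrightarrow> logged s')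
     \<and> regs s' rlog \<le> regs s rlog + length tr
     \<and> regs s' rfound = (if emitted tr = [] then regs s rfound else 1)"

text \<open>Induction on the hosted run. The store is the costly case: its address is evaluated
  twice, once for the log and once for the cell itself, and 20 steps per hosted step suffice for
  this. The bound on the length of the log keeps the addresses of its cells within the
  words.\<close>

lemma wp_embed:
  assumes "exec V c g tr g'" "hosts g s" "input_in (inp g) s" "bounded B s"
    and "regs s rlog + length tr \<le> B"
  shows "wp W (embed c) s (simulates tr g' s)"
  using assms
proof (induction arbitrary: s rule: exec.induct)
  case (Skip g)
  then show ?case by (auto intro!: wp_Skip simp: simulates_def)
next
  case (Assign g e v x)
  have "v \<le> B" using eval_exp_le[OF Assign(1)] V_le by simp
  then show ?case using Assign cost_embed[of e]
    by (auto intro!: wp_eval_Assign[OF eval_embed[OF Assign(1-3)]]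
        simp: simulates_def hosts_def frame_def logged_def)
next
  case (Store g e a e' v)
  have le: "a \<le> B" "v \<le> B" using eval_exp_le[OF Store(1)] eval_exp_le[OF Store(2)] V_le by auto
  let ?log = "Num 4 *\<^sub>e Var rlog +\<^sub>e Num 2"
  let ?s1 = "set_lane 2 (regs s rlog) a s"
  let ?s2 = "set_reg rlog (regs s rlog + 1) ?s1"
  have len: "regs s rlog + 1 \<le> B" using Store.prems(4) by simp
  have s2: "hosts g ?s2" "input_in (inp g) ?s2" "bounded B ?s1" "bounded B ?s2"
    using Store.prems le len by (auto simp: hosts_def input_in_def)
  have 1: "wp W (Store ?log (embed_exp e)) s (\<lambda>out t s'. out = [] \<and> t = 6 + cost (embed_exp e) \<and> s' = ?s1)"
    using Store eval_safe[of s ?log] B_ge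
    by (intro wp_eval_Store[OF _ eval_embed[OF Store(1)]]) auto
  have 2: "wp W (rlog ::= Var rlog +\<^sub>e Num 1) ?s1 (\<lambda>out t s'. out = [] \<and> t = 4 \<and> s' = ?s2)"
    using s2 B_ge by (intro wp_Assign) auto
  have "eval_exp W ?s2 (Num 4 *\<^sub>e embed_exp e) = Some (4 * a + 0)"
    using eval_embed[OF Store(1) s2(1,2)] le B_ge W_large by (simp add: word_def)
  then have 3: "wp W (Store (Num 4 *\<^sub>e embed_exp e) (embed_exp e')) ?s2 (\<lambda>out t s'. out = [] \<and>
      t = 3 + cost (embed_exp e) + cost (embed_exp e') \<and> s' = set_lane 0 a v ?s2)"
    by (rule wp_eval_Store[OF _ eval_embed[OF Store(2) s2(1,2)]]) auto
  have "wp W (embed (Store e e')) s (\<lambda>out t s'. out = [] \<and>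
      t = 13 + 2 * cost (embed_exp e) + cost (embed_exp e') \<and> s' = set_lane 0 a v ?s2)"
    unfolding embed.simps
    by (rule wp_bind[OF 1], elim conjE, hypsubst, rule wp_bind[OF 2], elim conjE, hypsubst,
        rule wp_mono[OF 3]) auto
  then show ?case
  proof (rule wp_mono, elim conjE)
    fix out :: "nat list list" and t s'
    assume *: "out = []" "t = 13 + 2 * cost (embed_exp e) + cost (embed_exp e')"
      "s' = set_lane 0 a v ?s2"
    have "t \<le> 20 * Suc (cost e + cost e')"
      using * cost_embed[of e] cost_embed[of e'] by simp
    \<comment> \<open>The new last entry of the log is \<open>a\<close>; all other cells and entries
      are unchanged.\<close>
    moreover have "logged s'" if "logged s"
      using that unfolding logged_def * by (auto simp: less_Suc_eq) (metis less_irrefl)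
    ultimately show "simulates (ticks (Suc (cost e + cost e')))
        (g\<lparr>mem := (mem g)(a := v)\<rparr>) s out t s'"
      using s2 le Store.prems by (auto simp: * simulates_def hosts_def frame_def)
  qed
next
  case (Out g es vs)
  then show ?case using B_ge
    by (auto intro!: wp_Assign simp: simulates_def hosts_def frame_def logged_def)
next
  case (Seq c g tr g' c' tr' g'')
  have "wp W (embed c) s (simulates tr g' s)"
    by (rule Seq.IH(1)) (use Seq.prems in auto)
  then show ?case unfolding embed.simps
  proof (intro wp_Seq, rule wp_mono)
    fix out t s'
    assume *: "simulates tr g' s out t s'"
    have "wp W (embed c') s' (simulates tr' g'' s')"
      by (rule Seq.IH(2)) (use * Seq.prems exec_inp[OF Seq.hyps(1)] in
        \<open>auto simp: simulates_def input_in_def frame_def\<close>)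
    then show "wp W (embed c') s' (\<lambda>out' t'. simulates (tr @ tr') g'' s (out @ out') (t + t'))"
      by (rule wp_mono) (use * in \<open>auto simp: simulates_def intro: frame_trans\<close>)
  qed
next
  case (If_true g e v c tr g' c')
  obtain tr' s' where run: "exec W (embed c) s tr' s'" "simulates tr g' s (emitted tr') (length tr') s'"
    using If_true.IH[of s] If_true.prems by (auto elim: wp_exec)
  show ?case unfolding wp_def embed.simps
    using exec.If_true[OF eval_embed[OF If_true(1) If_true.prems(1,2)] If_true(2) run(1)]
      run(2) cost_embed[of e] by (fastforce simp: simulates_def)
next
  case (If_false g e c' tr g' c)
  obtain tr' s' where run: "exec W (embed c') s tr' s'" "simulates tr g' s (emitted tr') (length tr') s'"
    using If_false.IH[of s] If_false.prems by (auto elim: wp_exec)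
  show ?case unfolding wp_def embed.simps
    using exec.If_false[OF eval_embed[OF If_false(1) If_false.prems(1,2)] run(1)]
      run(2) cost_embed[of e] by (fastforce simp: simulates_def)
next
  case (While_true g e v c tr g' tr' g'')
  obtain u s' where run: "exec W (embed c) s u s'" "simulates tr g' s (emitted u) (length u) s'"
    using While_true.IH(1)[of s] While_true.prems by (auto elim: wp_exec)
  have "wp W (embed (While e c)) s' (simulates tr' g'' s')"
    by (rule While_true.IH(2)) (use run(2) While_true.prems exec_inp[OF While_true.hyps(3)] in
      \<open>auto simp: simulates_def input_in_def frame_def\<close>)
  then obtain u' s'' where run': "exec W (While (embed_exp e) (embed c)) s' u' s''"
    "simulates tr' g'' s' (emitted u') (length u') s''"
    by (auto elim: wp_exec)
  have "simulates (ticks (Suc (cost e)) @ tr @ tr') g'' s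
      (emitted (ticks (Suc (cost (embed_exp e))) @ u @ u'))
      (length (ticks (Suc (cost (embed_exp e))) @ u @ u')) s''"
    using run(2) run'(2) cost_embed[of e] by (auto simp: simulates_def intro: frame_trans)
  then show ?case unfolding wp_def embed.simps
    using exec.While_true[OF eval_embed[OF While_true(1) While_true.prems(1,2)] While_true(2)
        run(1) run'(1)] by blast
next
  case (While_false g e c)
  have "exec W (embed (While e c)) s (ticks (Suc (cost (embed_exp e)))) s"
    using exec.While_false[OF eval_embed[OF While_false(1) While_false.prems(1,2)]] by simp
  moreover have "simulates (ticks (Suc (cost e))) g s
      (emitted (ticks (Suc (cost (embed_exp e))))) (length (ticks (Suc (cost (embed_exp e))))) s"
    using cost_embed[of e] While_false.prems by (auto simp: simulates_def)
  ultimately show ?case unfolding wp_def by blast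
qed

end

section \<open>Serving requests\<close>

lemma sum_list_gaps: "sum_list (gaps k tr) = k + length tr"
  by (induction k tr rule: gaps.induct) auto

lemma length_gaps: "length (gaps k tr) = Suc (length (emitted tr))"
  by (induction k tr rule: gaps.induct) auto

text \<open>The gaps add up to the length of the trace, and there is one more gap than
  outputs.\<close>

lemma length_le_delay: "length tr \<le> Suc (length (emitted tr)) * delay tr"
proof -
  have "sum_list (gaps 0 tr) \<le> length (gaps 0 tr) * Max (set (gaps 0 tr))"
    using sum_list_mono[of "gaps 0 tr" "\<lambda>x. x" "\<lambda>_. Max (set (gaps 0 tr))"]
    by (simp add: sum_list_triv)
  then show ?thesis by (simp add: sum_list_gaps length_gaps delay_def)
qed

lemma labelled_path_layered:
  assumes "labelled_path D u w v" "\<And>u a v. (u, a, v) \<in> snd D \<Longrightarrow> lev v = Suc (lev u)"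
  shows "lev v = lev u + length w"
  using assms(1) by (induction rule: labelled_path.induct) (auto dest: assms(2))

text \<open>A path labelled \<open>w\<close> climbs \<open>k\<close> levels, so it runs from the
  bottom to the top level, and each of these contains a single number. The conditions on
  \<open>lev\<close> concern all numbers, nodes or not.\<close>

lemma answers_layered:
  assumes layered: "\<And>u a v. (u, a, v) \<in> snd D \<Longrightarrow> lev v = Suc (lev u)"
    and lev: "lev 0 = 0" "lev 1 = k" "\<And>u. lev u \<le> k" "\<And>u. lev u = 0 \<Longrightarrow> u = 0" "\<And>u. lev u = k \<Longrightarrow> u = 1"
    and lang: "lang q = {w}" "length w = k"
  shows "answers q D = (if labelled_path D 0 w 1 then {(0, 1)} else {})"
proof -
  have *: "u = 0 \<and> v = 1" if "labelled_path D u w v" for u v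
  proof -
    have "lev v = lev u + k" using labelled_path_layered[OF that layered] lang(2) by simp
    with lev(3)[of v] have "lev u = 0" "lev v = k" by linarith+
    then show ?thesis using lev(4)[of u] lev(5)[of v] by simp
  qed
  have "answers q D = {(u, v). labelled_path D u w v}" by (simp add: answers_def lang(1))
  moreover have "(\<forall>u v. labelled_path D u w v \<longleftrightarrow> u = 0 \<and> v = 1)
      \<or> \<not> labelled_path D 0 w 1 \<and> (\<forall>u v. \<not> labelled_path D u w v)"
    using * by metis
  ultimately show ?thesis by auto
qed

lemma labelled_path_Nil_iff: "labelled_path D u [] v \<longleftrightarrow> u = v \<and> u \<in> fst D"
  by (auto intro: labelled_path.intros elim: labelled_path.cases)

lemma labelled_path_Cons_iff:
  "labelled_path D u (a # w) v \<longleftrightarrow> (\<exists>x. (u, a, x) \<in> snd D \<and> labelled_path D x w v)"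
  by (auto intro: labelled_path.intros elim: labelled_path.cases)

text \<open>The arguments of a request are evaluated when earlier words of the request are already
  stored; expressions of this kind are not affected by these stores.\<close>

fun memory_free :: "exp \<Rightarrow> bool" where
  "memory_free (Num n) \<longleftrightarrow> True"
| "memory_free (Var x) \<longleftrightarrow> True"
| "memory_free (Mem e) \<longleftrightarrow> False"
| "memory_free (Inp e) \<longleftrightarrow> False"
| "memory_free (Bin f e e') \<longleftrightarrow> memory_free e \<and> memory_free e'"

lemma memory_free_val: "memory_free e \<Longrightarrow> val (set_lane k a v s) e = val s e"
  by (induction e) auto

lemma memory_free_safe: "memory_free e \<Longrightarrow> safe B (set_lane k a v s) e = safe B s e"
  by (induction e) auto

section \<open>Blanking the state of the hosted routines\<close>

context words begin

lemma wp_clear_regs: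
  assumes "bounded B s"
  shows "wp W (seqs (map (\<lambda>x. x + 14 ::= Num 0) xs)) s (\<lambda>out t s'. out = [] \<and> t \<le> 2 * length xs
    \<and> bounded B s' \<and> frame {14} {} s s'
    \<and> hosted_regs s' = (\<lambda>x. if x \<in> set xs then 0 else hosted_regs s x))"
  using assms
proof (induction xs arbitrary: s)
  case Nil
  then show ?case by (auto simp: seqs_def intro!: wp_Skip)
next
  case (Cons x xs)
  have "seqs (map (\<lambda>x. x + 14 ::= Num 0) (x # xs))
      = (x + 14 ::= Num 0 ;; seqs (map (\<lambda>x. x + 14 ::= Num 0) xs))"
    by (simp add: seqs_def)
  then show ?case
  proof (simp only:, intro wp_Seq wp_Assign)
    show "wp W (seqs (map (\<lambda>x. x + 14 ::= Num 0) xs)) (set_reg (x + 14) (val s (Num 0)) s)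
     (\<lambda>out' t' s''. [] @ out' = [] \<and> Suc (cost (Num 0)) + t' \<le> 2 * length (x # xs)
        \<and> bounded B s'' \<and> frame {14} {} s s''
        \<and> hosted_regs s'' = (\<lambda>y. if y \<in> set (x # xs) then 0 else hosted_regs s y))"
      by (rule wp_mono[OF Cons.IH]) (use Cons.prems in \<open>auto simp: frame_def\<close>)
  qed (use Cons.prems in auto)
qed

lemma wp_clear_log:
  assumes "bounded B s" "logged s"
  shows "wp W (While (Var rlog) (rlog ::= Bin Sub (Var rlog) (Num 1) ;;
        Store (Num 4 *\<^sub>e Mem (Num 4 *\<^sub>e Var rlog +\<^sub>e Num 2)) (Num 0))) s
      (\<lambda>out t s'. out = [] \<and> t \<le> 30 * regs s rlog + 2 \<and> bounded B s' \<and> frame {rlog} {0} s s'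
        \<and> regs s' rlog = 0 \<and> lane 0 s' = (\<lambda>_. 0))"
    (is "wp W (While _ ?c) s (?Q s)")
  using assms
proof (induction "regs s rlog" arbitrary: s)
  case 0
  then show ?case by (intro wp_While_false) (auto simp: logged_def)
next
  case (Suc l)
  let ?s1 = "set_reg rlog l s"
  let ?s2 = "set_lane 0 (lane 2 s l) 0 ?s1"
  have l: "regs s rlog = Suc l" using Suc.hyps by simp
  have le: "l \<le> B" using bounded_regs[OF Suc.prems(1), of rlog] l by simp
  \<comment> \<open>Dropping the last entry is sound because the cell it names has just been
    zeroed.\<close>
  have log: "logged ?s2" using Suc.prems(2) l unfolding logged_def by (auto simp: less_Suc_eq)
  have body: "wp W ?c s (\<lambda>out t s'. out = [] \<and> t = 14 \<and> s' = ?s2)"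
  proof (intro wp_Seq wp_Assign)
    show "wp W (Store (Num 4 *\<^sub>e Mem (Num 4 *\<^sub>e Var rlog +\<^sub>e Num 2)) (Num 0))
      (set_reg rlog (val s (Bin Sub (Var rlog) (Num 1))) s)
      (\<lambda>out' t' s''. [] @ out' = [] \<and> Suc (cost (Bin Sub (Var rlog) (Num 1))) + t' = 14 \<and> s'' = ?s2)"
      by (rule wp_Store[where k = 0 and a = "lane 2 s l"])
        (use Suc.prems l le B_ge in \<open>auto simp: lane_def\<close>)
  qed (use Suc.prems l B_ge in auto)
  show ?case
  proof (rule wp_While_true[OF _ _ _ _ wp_mono[OF body]], goal_cases)
    case (5 out t s')
    then have s': "out = []" "t = 14" "s' = ?s2" by simp_all
    have "wp W (While (Var rlog) ?c) ?s2 (?Q ?s2)"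
      by (rule Suc.hyps) (use log Suc.prems le in auto)
    then show ?case unfolding s' by (rule wp_mono) (use l in \<open>auto simp: frame_def\<close>)
  qed (use Suc.prems l in auto)
qed

lemma wp_reset:
  assumes "bounded B s" "logged s" "\<forall>x\<ge>b. hosted_regs s x = 0"
  shows "wp W (reset b) s (\<lambda>out t s'. out = [] \<and> t \<le> 30 * regs s rlog + 2 * b + 2 \<and> bounded B s'
    \<and> frame {rlog, 14} {0} s s' \<and> regs s' rlog = 0 \<and> hosted_regs s' = (\<lambda>_. 0) \<and> lane 0 s' = (\<lambda>_. 0))"
  unfolding reset_def
proof (rule wp_bind[OF wp_clear_log], goal_cases)
  case (3 out t s')
  then show ?case
    by (intro wp_mono[OF wp_clear_regs]) (use assms(3) in \<open>auto simp: frame_def fun_eq_iff\<close>)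
qed (use assms in auto)

end

text \<open>\<open>bu\<close> and \<open>bd\<close> may behave irregularly; \<open>TU\<close> and
  \<open>TD\<close> bound them uniformly over all databases with at most \<open>N\<close>
  nodes.\<close>

locale server = hosting +
  fixes upd enm :: com and q :: rpq and \<sigma> N TU TD :: nat and bu bd :: "nat \<Rightarrow> real"
  assumes bu_le: "v \<le> N \<Longrightarrow> bu v \<le> real TU" and bd_le: "v \<le> N \<Longrightarrow> bd v \<le> real TD"
begin

text \<open>\<open>serves\<close> speaks about one fixed list of requests, so the remaining list is
  part of every invariant. The hosted machine itself stays hidden behind the quantifier.\<close>

definition serving :: "ram \<Rightarrow> db \<Rightarrow> request list \<Rightarrow> bool" where
  "serving s D reqs \<longleftrightarrow> (\<exists>g. hosts g s \<and> serves \<sigma> N V upd enm q bu bd D g reqs)"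

lemma serving_set_reg [simp]: "x < 14 \<Longrightarrow> serving (set_reg x v s) = serving s"
  by (auto simp: serving_def hosts_def fun_eq_iff)

lemma serving_set_lane [simp]: "0 < k \<Longrightarrow> k < 4 \<Longrightarrow> serving (set_lane k a v s) = serving s"
  by (auto simp: serving_def hosts_def fun_eq_iff)

definition called :: "com \<Rightarrow> nat \<Rightarrow> ram \<Rightarrow> nat list list \<Rightarrow> nat \<Rightarrow> ram \<Rightarrow> bool" where
  "called c T s out t s' \<longleftrightarrow> out = [] \<and> t \<le> 20 * T + 100 \<and> bounded B s'
     \<and> frame {rlog, rfound, 14} {0, 1, 2} s s' \<and> (logged s \<longrightarrow> logged s')
     \<and> regs s' rlog \<le> regs s rlog + T \<and> (\<forall>x\<ge>com_regs c. hosted_regs s' x = hosted_regs s x)"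

lemma wp_hosted:
  assumes "exec V c g tr g'" "hosts g s" "input_in (inp g) s" "bounded B s"
    and "length tr \<le> T" "regs s rlog + T \<le> B"
  shows "wp W (embed c) s (\<lambda>out t s'. called c T s out t s' \<and> hosts g' s'
    \<and> regs s' rfound = (if emitted tr = [] then regs s rfound else 1))"
  by (rule wp_mono[OF wp_embed[OF assms(1-4)]])
    (use assms exec_regs[OF assms(1)] in
      \<open>auto simp: simulates_def called_def hosts_def intro: frame_mono\<close>)

lemma wp_update:
  assumes "serving s D (Update x # reqs)" "allowed \<sigma> N D x" "card (fst (apply_update x D)) \<le> N"
    and "input_in (enc_update x) s" "bounded B s" "regs s rlog + TU \<le> B"
  shows "wp W (embed upd) s (\<lambda>out t s'. called upd TU s out t s'
    \<and> regs s' rfound = regs s rfound \<and> serving s' (apply_update x D) reqs)"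
proof -
  obtain g where g: "hosts g s" "serves \<sigma> N V upd enm q bu bd D g (Update x # reqs)"
    using assms(1) by (auto simp: serving_def)
  then obtain tr g' where g': "exec V upd (g\<lparr>inp := enc_update x\<rparr>) tr g'" "emitted tr = []"
    "real (length tr) \<le> bu (card (fst (apply_update x D)))"
    "serves \<sigma> N V upd enm q bu bd (apply_update x D) g' reqs"
    using assms(2) by auto
  have "real (length tr) \<le> real TU" using g'(3) bu_le[OF assms(3)] by linarith
  then have "length tr \<le> TU" by simp
  then have "wp W (embed upd) s (\<lambda>out t s'. called upd TU s out t s' \<and> hosts g' s'
      \<and> regs s' rfound = (if emitted tr = [] then regs s rfound else 1))"
    by (intro wp_hosted[OF g'(1)]) (use g(1) assms(4-6) in \<open>auto simp: hosts_def\<close>)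
  then show ?thesis
    by (rule wp_mono) (use g'(2,4) in \<open>auto simp: serving_def\<close>)
qed

text \<open>With at most one answer the run has at most two gaps. The possible pair is known
  beforehand, so the flag alone tells whether it was output, provided that the flag was cleared
  before.\<close>

lemma wp_enumerate:
  assumes "serving s D (Enumerate # reqs)" "card (fst D) \<le> N"
    and "answers q D = (if p then {(0, 1)} else {})" "bounded B s" "regs s rlog + 2 * TD \<le> B"
  shows "wp W (embed enm) s (\<lambda>out t s'. called enm (2 * TD) s out t s'
    \<and> regs s' rfound = (if p then 1 else regs s rfound) \<and> serving s' D reqs)"
proof -
  obtain g where g: "hosts g s" "serves \<sigma> N V upd enm q bu bd D g (Enumerate # reqs)"
    using assms(1) by (auto simp: serving_def)
  then obtain tr g' where g': "exec V enm (g\<lparr>inp := []\<rparr>) tr g'" "distinct (emitted tr)"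
    "set (emitted tr) = (\<lambda>(u, v). [u, v]) ` answers q D" "real (delay tr) \<le> bd (card (fst D))"
    "serves \<sigma> N V upd enm q bu bd D g' reqs"
    by auto
  have set: "set (emitted tr) = (if p then {[0, 1]} else {})" using g'(3) assms(3) by simp
  then have "length (emitted tr) \<le> 1" using distinct_card[OF g'(2)] by (simp split: if_splits)
  then have "length tr \<le> 2 * delay tr"
    by (intro order_trans[OF length_le_delay mult_le_mono1]) simp
  moreover have "real (delay tr) \<le> real TD" using g'(4) bd_le[OF assms(2)] by linarith
  ultimately have len: "length tr \<le> 2 * TD" by simp
  have emit: "emitted tr = [] \<longleftrightarrow> \<not> p"
    using set by (metis set_empty insert_not_empty)
  have "wp W (embed enm) s (\<lambda>out t s'. called enm (2 * TD) s out t s' \<and> hosts g' s'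
      \<and> regs s' rfound = (if emitted tr = [] then regs s rfound else 1))"
  proof (rule wp_hosted[OF g'(1)])
    show "hosts (g\<lparr>inp := []\<rparr>) s" using g(1) by (simp add: hosts_def)
    show "input_in (inp (g\<lparr>inp := []\<rparr>)) s" by (simp add: input_in_def)
  qed (fact assms(4) len assms(5))+
  then show ?thesis
    by (rule wp_mono) (use g'(5) emit in \<open>auto simp: serving_def\<close>)
qed

lemma input_in_4:
  "input_in [a, b, c, d] s \<longleftrightarrow> lane 1 s 0 = a \<and> lane 1 s 1 = b \<and> lane 1 s 2 = c \<and> lane 1 s 3 = d"
  by (auto simp: input_in_def nth_Cons numeral_eq_Suc less_Suc_eq)

text \<open>In \<open>called\<close>, each unit of the time parameter stands for 20 steps; the
  additional 5 pay for writing the four words of the request.\<close>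

lemma wp_call_update:
  assumes "serving s D (Update x # reqs)" "allowed \<sigma> N D x" "card (fst (apply_update x D)) \<le> N"
    and "enc_update x = [opc, val s e, 0, val s e']" "opc \<le> B" "val s e \<le> B" "val s e' \<le> B"
    and "memory_free e" "memory_free e'" "safe B s e" "safe B s e'" "cost e \<le> 10" "cost e' \<le> 10"
    and "bounded B s" "regs s rlog + TU \<le> B"
  shows "wp W (call_update upd opc e e') s (\<lambda>out t s'. called upd (TU + 5) s out t s'
    \<and> regs s' rfound = regs s rfound \<and> serving s' (apply_update x D) reqs)"
  unfolding call_update_def
proof (intro wp_Seq wp_put, goal_cases)
  \<comment> \<open>Each of the four \<open>put\<close> commands leaves five side conditions; the
    remaining goal is the hosted routine.\<close>
  case 21
  let ?s = "set_lane 1 3 (val s e') (set_lane 1 2 0 (set_lane 1 1 (val s e) (set_lane 1 0 opc s)))"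
  have "wp W (embed upd) ?s (\<lambda>out t s'. called upd TU ?s out t s'
    \<and> regs s' rfound = regs ?s rfound \<and> serving s' (apply_update x D) reqs)"
    by (rule wp_update[OF _ assms(2,3)])
      (use assms in \<open>auto simp: serving_def hosts_def input_in_4\<close>)
  then show ?case using assms
    apply (simp add: memory_free_val)
    apply (erule wp_mono)
    apply (auto simp: called_def frame_def logged_def)
    done
qed (use assms B_ge in \<open>auto simp: memory_free_val memory_free_safe\<close>)

end

section \<open>Writing the layered graph\<close>

lemma length_concat_uniform:
  "(\<And>i. i < k \<Longrightarrow> length (f i) = n) \<Longrightarrow> length (concat (map f [0..<k])) = k * n"
  by (induction k) auto

lemma nth_concat_uniform:
  assumes "\<And>i. i < k \<Longrightarrow> length (f i) = n" "i < k" "j < n"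
  shows "concat (map f [0..<k]) ! (i * n + j) = f i ! j"
  using assms
proof (induction k)
  case (Suc k)
  have len: "length (concat (map f [0..<k])) = k * n"
    using Suc.prems(1) by (intro length_concat_uniform) simp
  show ?case
  proof (cases "i = k")
    case True
    then show ?thesis using len by (simp add: nth_append)
  next
    case False
    then have "i < k" using Suc.prems by simp
    then have "Suc i * n \<le> k * n" by (intro mult_le_mono1) simp
    then have "i * n + j < k * n" using Suc.prems(3) by simp
    then show ?thesis using len Suc \<open>i < k\<close> by (simp add: nth_append)
  qed
qed simp

lemma length_enc_vec [simp]: "length (enc_vec n v) = n"
  by (simp add: enc_vec_def)

lemma nth_enc_vec [simp]: "i < n \<Longrightarrow> enc_vec n v ! i = of_bool (v i)"
  by (simp add: enc_vec_def)

lemma length_enc_mat [simp]: "length (enc_mat n M) = n * n"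
  by (simp add: enc_mat_def length_concat_uniform)

lemma nth_enc_mat [simp]: "i < n \<Longrightarrow> j < n \<Longrightarrow> enc_mat n M ! (i * n + j) = of_bool (M i j)"
  by (simp add: enc_mat_def nth_concat_uniform)

lemma index_less_square: "i < n \<Longrightarrow> j < n \<Longrightarrow> i * n + j < n * (n::nat)"
  using mult_le_mono1[of "Suc i" n n] by simp

lemma concat_map_Nil [simp]: "concat (map (\<lambda>_. []) xs) = []"
  by (induction xs) auto

section \<open>Encoded graphs in the hosted input\<close>

definition holds :: "nat \<Rightarrow> nat list \<Rightarrow> ram \<Rightarrow> bool" where
  "holds p xs s \<longleftrightarrow> (\<forall>i<length xs. lane 1 s (p + i) = xs ! i)"

lemma holds_Nil [simp]: "holds p [] s"
  by (simp add: holds_def)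

lemma holds_Cons: "holds p (x # xs) s \<longleftrightarrow> lane 1 s p = x \<and> holds (Suc p) xs s"
  unfolding holds_def by (auto simp: nth_Cons split: nat.splits)

lemma holds_append: "holds p (xs @ ys) s \<longleftrightarrow> holds p xs s \<and> holds (p + length xs) ys s"
  by (induction xs arbitrary: p) (auto simp: holds_Cons)

lemma holds_set_lane:
  "holds p xs s \<Longrightarrow> a < p \<or> p + length xs \<le> a \<Longrightarrow> holds p xs (set_lane 1 a v s)"
  by (auto simp: holds_def)

lemma holds_set_reg [simp]: "holds p xs (set_reg x v s) = holds p xs s"
  by (simp add: holds_def)

lemma input_in_holds: "input_in xs s \<longleftrightarrow> holds 0 xs s"
  by (simp add: input_in_def holds_def)

definition arc_words :: "(nat \<times> nat) list \<Rightarrow> nat list" where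
  "arc_words l = concat (map (\<lambda>(a, v). [a, v]) l)"

lemma arc_words_simps [simp]:
  "arc_words [] = []" "arc_words (l @ l') = arc_words l @ arc_words l'" "arc_words [(a, v)] = [a, v]"
  by (auto simp: arc_words_def)

lemma length_arc_words [simp]: "length (arc_words l) = 2 * length l"
  by (induction l) (auto simp: arc_words_def)

text \<open>The closing offset is left out, so that a further list contributes exactly one new
  offset and leaves the others unchanged.\<close>

definition offsets :: "adjacency \<Rightarrow> nat list" where
  "offsets ls = map (\<lambda>u. length (concat (take u ls))) [0..<length ls]"

lemma length_offsets [simp]: "length (offsets ls) = length ls"
  by (simp add: offsets_def)

lemma offsets_snoc: "offsets (ls @ [l]) = offsets ls @ [length (concat ls)]"
  by (auto simp: offsets_def)

lemma enc_instance_offsets: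
  "enc_instance ls q = length ls # offsets (ls @ [[]]) @ arc_words (concat ls) @ enc_rpq q"
  by (simp add: enc_instance_def offsets_def arc_words_def)

text \<open>The adjacency list of a node whose successors lie in layer \<open>l\<close>, the layer
  whose nodes are numbered from \<open>2 + l * S\<close>.\<close>

definition row :: "nat \<Rightarrow> nat \<Rightarrow> (nat \<Rightarrow> bool) \<Rightarrow> (nat \<times> nat) list" where
  "row S l p = map (\<lambda>x. (0, 2 + l * S + x)) (filter p [0..<S])"

definition layers :: "nat \<Rightarrow> bmat \<Rightarrow> bmat \<Rightarrow> bmat \<Rightarrow> adjacency" where
  "layers S P1 P2 P3 = [[], []] @ map (\<lambda>i. row S 1 (P1 i)) [0..<S]
     @ map (\<lambda>k. row S 2 (P2 k)) [0..<S] @ map (\<lambda>j. row S 3 (P3 j)) [0..<S] @ replicate S []"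

lemma length_row: "length (row S l p) \<le> S"
  unfolding row_def using length_filter_le[of p "[0..<S]"] by simp

lemma length_concat_rows: "length (concat (map (\<lambda>i. row S l (P i)) [0..<m])) \<le> m * S"
proof (induction m)
  case (Suc m)
  then show ?case using length_row[of S l "P m"] by simp
qed simp

text \<open>The builder keeps the number of arcs in a register, and there may be up to
  \<open>3 * S * S\<close> of them; this is one reason why \<open>B\<close> must be quadratic in
  \<open>n\<close>.\<close>

locale blocks = words +
  fixes n S :: nat and A A' :: bmat
  assumes S_pos: "1 \<le> S" and S_le: "S \<le> n" and n_le: "20 * (n + 1) * (n + 1) \<le> B"
begin

lemma small: "4 * n \<le> B" "n * S \<le> B" "n * n \<le> B" "3 * (S * S) + S \<le> B" "20 * S + 20 \<le> B" "n + S \<le> B"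
  and S_square: "S \<le> S * S" "1 \<le> S * S"
proof -
  have "S * S \<le> n * n" "n * S \<le> n * n" using S_le by (auto intro: mult_le_mono)
  moreover have "20 * (n * n) + 40 * n + 20 \<le> B" using n_le by (simp add: algebra_simps)
  ultimately show "4 * n \<le> B" "n * S \<le> B" "n * n \<le> B" "3 * (S * S) + S \<le> B" "20 * S + 20 \<le> B" "n + S \<le> B"
    using S_le by linarith+
  show "S \<le> S * S" "1 \<le> S * S" using S_pos by auto
qed

definition block_state :: "ram \<Rightarrow> bool" where
  "block_state s \<longleftrightarrow> bounded B s \<and> regs s rn = n \<and> regs s rs = S
     \<and> inp s = n # enc_mat n A @ enc_mat n A'"

lemma block_state_simps [simp]:
  assumes "block_state s"
  shows "bounded B s" "regs s 0 = n" "regs s 1 = S" "regs s (Suc 0) = S"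
    "x \<noteq> 0 \<Longrightarrow> x \<noteq> 1 \<Longrightarrow> v \<le> B \<Longrightarrow> block_state (set_reg x v s)"
    "v \<le> B \<Longrightarrow> block_state (set_lane k a v s)"
  using assms by (auto simp: block_state_def)

lemma block_state_inp: "block_state s \<Longrightarrow> inp s = n # enc_mat n A @ enc_mat n A'"
  unfolding block_state_def by blast

lemma block_state_frame:
  assumes "block_state s" "frame R K s s'" "bounded B s'" "rn \<notin> R" "rs \<notin> R"
  shows "block_state s'"
proof -
  have "regs s' rn = n" "regs s' rs = S" "inp s' = n # enc_mat n A @ enc_mat n A'"
    using assms block_state_inp[OF assms(1)] by (simp_all add: frame_def)
  then show ?thesis using assms(3) unfolding block_state_def by blast
qed

lemma inp_A: "block_state s \<Longrightarrow> i < n \<Longrightarrow> k < n \<Longrightarrow> inp s ! (1 + i * n + k) = of_bool (A i k)"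
  using index_less_square[of i n k] by (simp add: block_state_inp nth_append)

lemma inp_A': "block_state s \<Longrightarrow> k < n \<Longrightarrow> j < n \<Longrightarrow> inp s ! (1 + n * n + k * n + j) = of_bool (A' k j)"
  using index_less_square[of k n j] by (simp add: block_state_inp nth_append add.assoc)

lemma wp_loop:
  assumes "bounded B s" "x \<noteq> rs" "P 0 (set_reg x 0 s)"
    and inv: "\<And>m s. m \<le> S \<Longrightarrow> P m s \<Longrightarrow> bounded B s \<and> regs s x = m \<and> regs s rs = S"
    and body: "\<And>m s. m < S \<Longrightarrow> P m s \<Longrightarrow> wp W c s (\<lambda>out t s'. out = [] \<and> t \<le> T \<and> bounded B s'
        \<and> regs s' x = m \<and> P (Suc m) (set_reg x (Suc m) s'))"
    and post: "\<And>t s'. P S s' \<Longrightarrow> t \<le> S * (T + 50) + 50 \<Longrightarrow> Q [] t s'"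
  shows "wp W (loop x c) s Q"
  unfolding loop_def
proof (rule wp_upto[where \<Phi> = "\<lambda>_. 0" and N = S and S = 1 and M = S and res = "\<lambda>_. []" and P = P and T = T])
  show "\<And>m s. m < S \<Longrightarrow> P m s \<Longrightarrow> wp W c s (\<lambda>out t s'. out = [] \<and> t + 0 \<le> T + 0 \<and> bounded B s' \<and>
      safe B s' (Num 1) \<and> P (Suc m) (set_reg x (regs s' x + val s' (Num 1)) s'))"
    by (rule wp_mono[OF body]) (use B_ge in auto)
qed (use assms B_ge in \<open>auto simp: intro!: post\<close>)

lemma wp_if_in_range:
  assumes "block_state s" "memory_free e" "memory_free e'" "safe B s e" "safe B s e'" "cost e \<le> 10" "cost e' \<le> 10"
    and "val s e < n \<Longrightarrow> val s e' < n \<Longrightarrow> wp W c s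
      (\<lambda>out t. Q out (Suc (cost (e <\<^sub>e Var rn) + Suc (cost (e' <\<^sub>e Var rn) + t))))"
    and "\<And>u. u \<le> 26 \<Longrightarrow> \<not> (val s e < n \<and> val s e' < n) \<Longrightarrow> Q [] u s"
  shows "wp W (if_in_range e e' c) s Q"
  unfolding if_in_range_def using assms B_ge
  by (intro wp_If wp_Skip) (auto simp: algebra_simps split: if_splits)

text \<open>The cost of the guards is blurred: the postcondition must tolerate up to 60 further
  steps. This gives the guards for the ones of \<open>A\<close>, the ones of \<open>A'\<close> and
  the zeros of C one common form.\<close>

lemma wp_if_A:
  assumes "block_state s"
    and "val s gi < n \<Longrightarrow> val s gk < n \<Longrightarrow> A (val s gi) (val s gk) \<Longrightarrow>
      wp W c s (\<lambda>out t s'. \<forall>t'. t \<le> t' \<longrightarrow> t' \<le> t + 60 \<longrightarrow> Q out t' s')"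
    and "\<And>u. u \<le> 60 \<Longrightarrow> \<not> (val s gi < n \<and> val s gk < n \<and> A (val s gi) (val s gk)) \<Longrightarrow> Q [] u s"
  shows "wp W (if_A c) s Q"
  unfolding if_A_def
proof (rule wp_if_in_range[OF assms(1)], goal_cases)
  case 7
  have "val s (Inp (Num 1 +\<^sub>e gi *\<^sub>e Var rn +\<^sub>e gk)) = of_bool (A (val s gi) (val s gk))"
    using inp_A[OF assms(1) 7] assms(1) by simp
  moreover have "val s gi * n + val s gk < n * n" by (rule index_less_square[OF 7])
  ultimately show ?case using assms 7 B_ge
    by (intro wp_If wp_Skip) (auto simp: block_state_inp algebra_simps simp del: val.simps(4), (erule wp_mono, auto)?)
qed (use assms in \<open>auto\<close>)

lemma wp_if_B:
  assumes "block_state s"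
    and "val s gk < n \<Longrightarrow> val s gj < n \<Longrightarrow> A' (val s gk) (val s gj) \<Longrightarrow>
      wp W c s (\<lambda>out t s'. \<forall>t'. t \<le> t' \<longrightarrow> t' \<le> t + 60 \<longrightarrow> Q out t' s')"
    and "\<And>u. u \<le> 60 \<Longrightarrow> \<not> (val s gk < n \<and> val s gj < n \<and> A' (val s gk) (val s gj)) \<Longrightarrow> Q [] u s"
  shows "wp W (if_B c) s Q"
  unfolding if_B_def
proof (rule wp_if_in_range[OF assms(1)], goal_cases)
  case 7
  have "val s (Inp (Num 1 +\<^sub>e Var rn *\<^sub>e Var rn +\<^sub>e gk *\<^sub>e Var rn +\<^sub>e gj)) = of_bool (A' (val s gk) (val s gj))"
    using inp_A'[OF assms(1) 7] assms(1) by simp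
  moreover have "val s gk * n + val s gj < n * n" by (rule index_less_square[OF 7])
  ultimately show ?case using assms 7 B_ge
    by (intro wp_If wp_Skip) (auto simp: block_state_inp algebra_simps simp del: val.simps(4), (erule wp_mono, auto)?)
qed (use assms in \<open>auto\<close>)

lemma wp_if_not_C:
  assumes "block_state s"
    and "val s gi < n \<Longrightarrow> val s gj < n \<Longrightarrow> lane 3 s (val s gi * n + val s gj) = 0 \<Longrightarrow>
      wp W c s (\<lambda>out t s'. \<forall>t'. t \<le> t' \<longrightarrow> t' \<le> t + 60 \<longrightarrow> Q out t' s')"
    and "\<And>u. u \<le> 60 \<Longrightarrow> \<not> (val s gi < n \<and> val s gj < n \<and> lane 3 s (val s gi * n + val s gj) = 0)
      \<Longrightarrow> Q [] u s"
  shows "wp W (if_not_C c) s Q"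
  unfolding if_not_C_def
proof (rule wp_if_in_range[OF assms(1)], goal_cases)
  case 7
  have "val s (Mem (cell_C gi gj)) = lane 3 s (val s gi * n + val s gj)"
    using assms(1) by (simp add: lane_def cell_C_def)
  then show ?case using assms 7 B_ge
    by (intro wp_If wp_Skip) (auto simp: algebra_simps cell_C_def simp del: val.simps(3), (erule wp_mono, auto)?)
qed (use assms in \<open>auto\<close>)

text \<open>The final offset counts as the one of an additional node without arcs.\<close>
definition building :: "adjacency \<Rightarrow> ram \<Rightarrow> bool" where
  "building ls s \<longleftrightarrow> regs s ru = length ls \<and> regs s rm = length (concat ls) \<and> lane 1 s 0 = 2 + 4 * S
     \<and> holds 1 (offsets ls) s \<and> holds (4 + 4 * S) (arc_words (concat ls)) s"

lemma building_set_reg [simp]: "x \<noteq> ru \<Longrightarrow> x \<noteq> rm \<Longrightarrow> building ls (set_reg x v s) = building ls s"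
  by (simp add: building_def)

text \<open>\<open>4 * S + 3\<close> offsets, the closing one included, fit between cell 0 and the
  first arc in cell \<open>4 + 4 * S\<close>.\<close>

lemma wp_put_offset:
  assumes "block_state s" "building ls s" "length ls < 4 * S + 3" "length (concat ls) \<le> B"
  shows "wp W put_offset s (\<lambda>out t s'. out = [] \<and> t \<le> 30 \<and> block_state s' \<and> building (ls @ [[]]) s'
    \<and> frame {ru, rm} {1} s s')"
proof -
  have "building (ls @ [[]]) (set_reg ru (regs s ru + 1) (set_lane 1 (1 + regs s ru) (regs s rm) s))"
    using assms by (auto simp: building_def offsets_snoc holds_append holds_Cons
      simp del: One_nat_def intro!: holds_set_lane)
  then show ?thesis unfolding put_offset_def
    by (intro wp_Seq wp_put wp_Assign)
      (use assms B_ge small in \<open>auto simp: building_def frame_def\<close>)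
qed

text \<open>An arc always extends the last list, so no offset changes.\<close>

lemma wp_put_arc:
  assumes "block_state s" "building (ls @ [l]) s" "length ls < 4 * S + 3" "length (concat ls) + length l < B"
    and "memory_free v" "safe B s v" "cost v \<le> 10" "val s v \<le> B"
  shows "wp W (put_arc v) s (\<lambda>out t s'. out = [] \<and> t \<le> 60 \<and> block_state s'
    \<and> building (ls @ [l @ [(0, val s v)]]) s' \<and> frame {ru, rm} {1} s s')"
proof -
  let ?p = "4 + 4 * S + 2 * regs s rm"
  let ?s = "set_reg rm (regs s rm + 1) (set_lane 1 (?p + 1) (val s v) (set_lane 1 ?p 0 s))"
  have "building (ls @ [l @ [(0, val s v)]]) ?s"
    using assms by (auto simp: building_def offsets_snoc holds_append holds_Cons
      simp del: One_nat_def intro!: holds_set_lane)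
  then show ?thesis unfolding put_arc_def
    by (intro wp_Seq wp_put wp_Assign)
      (use assms B_ge in \<open>auto simp: building_def frame_def memory_free_val memory_free_safe\<close>)
qed

text \<open>The guard is a parameter \<open>sel\<close>, known only by its proof rule; the same
  argument then serves all three layers of arcs.\<close>

lemma wp_row:
  assumes "block_state s" "building ls s" "length ls < 4 * S + 3" "length (concat ls) + S \<le> B"
    and x: "x \<in> {ri, rk, rj}" and l: "l \<le> 3"
    and select: "\<And>k s' Q c. k < S \<Longrightarrow> block_state s' \<Longrightarrow> frame {x, ru, rm} {1} s s' \<Longrightarrow> regs s' x = k \<Longrightarrow>
      (p k \<Longrightarrow> wp W c s' (\<lambda>out t s''. \<forall>t'. t \<le> t' \<longrightarrow> t' \<le> t + 60 \<longrightarrow> Q out t' s'')) \<Longrightarrow>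
      (\<And>u. u \<le> 60 \<Longrightarrow> \<not> p k \<Longrightarrow> Q [] u s') \<Longrightarrow> wp W (sel c) s' Q"
  shows "wp W (put_offset ;; loop x (sel (put_arc (node l x)))) s (\<lambda>out t s'. out = []
    \<and> t \<le> S * 170 + 80 \<and> block_state s' \<and> building (ls @ [row S l p]) s' \<and> frame {x, ru, rm} {1} s s')"
proof (rule wp_bind[OF wp_put_offset[OF assms(1-3)]], goal_cases)
  case (2 out t s1)
  let ?r = "\<lambda>k. map (\<lambda>x. (0 :: nat, 2 + l * S + x)) (filter p [0..<k])"
  let ?P = "\<lambda>k s'. block_state s' \<and> building (ls @ [?r k]) s' \<and> frame {x, ru, rm} {1} s s' \<and> regs s' x = k"
  have s1: "block_state s1" "building (ls @ [[]]) s1" "frame {x, ru, rm} {1} s s1"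
    using 2 by (auto intro: frame_mono)
  have node: "2 + l * S + k \<le> B" if "k < S" for k
    using mult_le_mono1[OF l, of S] small that by linarith
  show ?case
  \<comment> \<open>60 steps for the arc and 60 for the guard.\<close>
  proof (rule wp_loop[where P = ?P and T = 120], goal_cases)
    case (5 k s')
    have short: "length (?r k) \<le> k" using length_filter_le[of p "[0..<k]"] by simp
    then have short': "length (concat ls) + length (?r k) < B" using assms(4) 5 by linarith
    from 5 have s': "regs s' rs = S" by simp
    have "wp W (sel (put_arc (node l x))) s' (\<lambda>out t s''. out = [] \<and> t \<le> 120 \<and> block_state s''
        \<and> building (ls @ [?r (Suc k)]) s'' \<and> frame {ru, rm} {1} s' s'')"
    proof (rule select[of k s'], goal_cases)
      case inner: 5
      have *: "wp W (put_arc (node l x)) s' (\<lambda>out t s''. out = [] \<and> t \<le> 60 \<and> block_state s''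
        \<and> building (ls @ [?r k @ [(0, val s' (node l x))]]) s'' \<and> frame {ru, rm} {1} s' s'')"
        by (rule wp_put_arc) (use 5 short' node[of k] s' l B_ge assms(3) in \<open>auto simp: node_def\<close>)
      show ?case
        by (rule wp_mono[OF *]) (use 5 inner s' in \<open>auto simp: node_def\<close>)
    qed (use 5 in auto)
    then show ?case
    proof (rule wp_mono)
      fix out :: "nat list list" and t s''
      assume as: "out = [] \<and> t \<le> 120 \<and> block_state s'' \<and> building (ls @ [?r (Suc k)]) s''
        \<and> frame {ru, rm} {1} s' s''"
      then have "frame {x, ru, rm} {1} s' s''" by (auto intro: frame_mono)
      then have "frame {x, ru, rm} {1} s s''" using 5 frame_trans by blast
      moreover have "regs s'' x = k" using frame_reg[of "{ru, rm}" "{1}" s' s'' x] as 5 x by auto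
      ultimately show "out = [] \<and> t \<le> 120 \<and> bounded B s'' \<and> regs s'' x = k
          \<and> ?P (Suc k) (set_reg x (Suc k) s'')"
        using as 5 x small by (auto simp: frame_set_reg)
    qed
  qed (use s1 x 2 in \<open>auto simp: row_def frame_set_reg\<close>)
qed (use assms(4) in simp)

lemma wp_layer:
  assumes "block_state s" "building ls s" "length ls + S \<le> 4 * S + 3" "length (concat ls) + S * S \<le> B"
    and xy: "x \<in> {ri, rk, rj}" "y \<in> {ri, rk, rj}" "x \<noteq> y" and l: "l \<le> 3"
    and select: "\<And>i k s' Q c. k < S \<Longrightarrow> block_state s' \<Longrightarrow> frame {y, x, ru, rm} {1} s s' \<Longrightarrow>
      regs s' y = i \<Longrightarrow> regs s' x = k \<Longrightarrow>
      (P i k \<Longrightarrow> wp W c s' (\<lambda>out t s''. \<forall>t'. t \<le> t' \<longrightarrow> t' \<le> t + 60 \<longrightarrow> Q out t' s'')) \<Longrightarrow>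
      (\<And>u. u \<le> 60 \<Longrightarrow> \<not> P i k \<Longrightarrow> Q [] u s') \<Longrightarrow> wp W (sel c) s' Q"
  shows "wp W (loop y (put_offset ;; loop x (sel (put_arc (node l x))))) s (\<lambda>out t s'. out = []
    \<and> t \<le> 400 * (S * S) \<and> block_state s' \<and> building (ls @ map (\<lambda>i. row S l (P i)) [0..<S]) s'
    \<and> frame {ri, rk, rj, ru, rm} {1} s s')"
proof -
  let ?ls = "\<lambda>m. ls @ map (\<lambda>i. row S l (P i)) [0..<m]"
  let ?R = "\<lambda>m s'. block_state s' \<and> building (?ls m) s' \<and> frame {y, x, ru, rm} {1} s s' \<and> regs s' y = m"
  show ?thesis
  proof (rule wp_loop[where P = ?R and T = "S * 170 + 80"], goal_cases)
    case (5 m s')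
    have "length (concat (?ls m)) + S \<le> length (concat ls) + Suc m * S"
      using length_concat_rows[of S l P m] by simp
    also have "\<dots> \<le> length (concat ls) + S * S"
      using mult_le_mono1[of "Suc m" S S] 5 by simp
    finally have len: "length (concat (?ls m)) + S \<le> B" using assms(4) by simp
    have *: "wp W (put_offset ;; loop x (sel (put_arc (node l x)))) s' (\<lambda>out t s''. out = []
    \<and> t \<le> S * 170 + 80 \<and> block_state s'' \<and> building (?ls m @ [row S l (P m)]) s'' \<and> frame {x, ru, rm} {1} s' s'')"
    proof (rule wp_row[OF _ _ _ len xy(1) l], goal_cases)
      case (4 k s'' Q c)
      have "frame {y, x, ru, rm} {1} s' s''" using 4 by (auto intro: frame_mono)
      then have "frame {y, x, ru, rm} {1} s s''" using 5 frame_trans by blast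
      moreover have "regs s'' y = m" using frame_reg[OF 4(3), of y] 5 xy by auto
      ultimately show ?case using 4 by (intro select[of k s'' m c Q]) auto
    qed (use 5 assms(3) in auto)
    show ?case
    proof (rule wp_mono[OF *])
      fix out :: "nat list list" and t s''
      assume as: "out = [] \<and> t \<le> S * 170 + 80 \<and> block_state s'' \<and> building (?ls m @ [row S l (P m)]) s''
        \<and> frame {x, ru, rm} {1} s' s''"
      then have "frame {y, x, ru, rm} {1} s' s''" by (auto intro: frame_mono)
      then have "frame {y, x, ru, rm} {1} s s''" using 5 frame_trans by blast
      moreover have "regs s'' y = m"
        using frame_reg[of "{x, ru, rm}" "{1}" s' s'' y] as 5 xy by auto
      ultimately show "out = [] \<and> t \<le> S * 170 + 80 \<and> bounded B s'' \<and> regs s'' y = m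
          \<and> ?R (Suc m) (set_reg y (Suc m) s'')"
        using 5 as xy small by (auto simp: frame_set_reg)
    qed
  next
    case (6 t s')
    have "t \<le> S * (S * 170 + 80 + 50) + 50" by (rule 6)
    also have "\<dots> = 170 * (S * S) + 130 * S + 50" by (simp add: algebra_simps)
    also have "\<dots> \<le> 400 * (S * S)" using S_square by linarith
    finally show ?case using 6 xy by (auto intro: frame_mono)
  qed (use assms(1-7) in \<open>auto simp: frame_set_reg\<close>)
qed

end

section \<open>The database of the layered graph and its answers\<close>

definition block_arcs :: "nat \<Rightarrow> bmat \<Rightarrow> bmat \<Rightarrow> bmat \<Rightarrow> arc set" where
  "block_arcs S P1 P2 P3 = {(2 + i, 0, 2 + S + k) |i k. i < S \<and> k < S \<and> P1 i k}
     \<union> {(2 + S + k, 0, 2 + 2 * S + j) |k j. k < S \<and> j < S \<and> P2 k j}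
     \<union> {(2 + 2 * S + j, 0, 2 + 3 * S + i) |j i. j < S \<and> i < S \<and> P3 j i}"

lemma length_layers [simp]: "length (layers S P1 P2 P3) = 2 + 4 * S"
  by (simp add: layers_def)

lemma set_row: "set (row S l p) = {(0, 2 + l * S + x) |x. x < S \<and> p x}"
  by (auto simp: row_def)

lemma nth_layers:
  assumes "i < S"
  shows "layers S P1 P2 P3 ! (2 + i) = row S 1 (P1 i)"
    "layers S P1 P2 P3 ! (2 + S + i) = row S 2 (P2 i)"
    "layers S P1 P2 P3 ! (2 + 2 * S + i) = row S 3 (P3 i)"
    "layers S P1 P2 P3 ! (2 + 3 * S + i) = []"
  using assms by (auto simp: layers_def nth_append)

lemma db_of_layers: "db_of (layers S P1 P2 P3) = ({..<2 + 4 * S}, block_arcs S P1 P2 P3)"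
proof -
  have "u < 2 + 4 * S \<and> (a, v) \<in> set (layers S P1 P2 P3 ! u) \<longleftrightarrow> (u, a, v) \<in> block_arcs S P1 P2 P3" for u a v
  proof -
    consider "u = 0" | "u = 1" | "2 \<le> u" "u < 2 + S" | "2 + S \<le> u" "u < 2 + S + S"
      | "2 + 2 * S \<le> u" "u < 2 + 2 * S + S" | "2 + 3 * S \<le> u" "u < 2 + 3 * S + S" | "u \<ge> 2 + 4 * S"
      by linarith
    then show ?thesis
    proof cases
      case 1
      then show ?thesis by (auto simp: layers_def block_arcs_def)
    next
      case 2
      then show ?thesis by (auto simp: layers_def block_arcs_def)
    next
      case 3
      then obtain i where "u = 2 + i" "i < S" by (auto simp: le_iff_add)
      then show ?thesis by (auto simp only: nth_layers set_row block_arcs_def) auto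
    next
      case 4
      then obtain i where "u = 2 + S + i" "i < S" by (auto simp: le_iff_add)
      then show ?thesis by (auto simp only: nth_layers set_row block_arcs_def) auto
    next
      case 5
      then obtain i where "u = 2 + 2 * S + i" "i < S" by (auto simp: le_iff_add)
      then show ?thesis by (auto simp only: nth_layers set_row block_arcs_def) auto
    next
      case 6
      then obtain i where "u = 2 + 3 * S + i" "i < S" by (auto simp: le_iff_add)
      then show ?thesis by (auto simp only: nth_layers list.set block_arcs_def)
    next
      case 7
      then show ?thesis by (auto simp: block_arcs_def)
    qed
  qed
  then show ?thesis by (auto simp: db_of_def)
qed

lemma adjacency_over_layers:
  assumes "1 \<le> \<sigma>"
  shows "adjacency_over \<sigma> (layers S P1 P2 P3)"
proof -
  have "distinct l \<and> (\<forall>(a, v) \<in> set l. a = 0 \<and> v < 2 + 4 * S)" if "l \<in> set (layers S P1 P2 P3)" for l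
  proof -
    have "distinct (row S l p)" for l p by (auto simp: row_def distinct_map inj_on_def)
    moreover have "2 + l * S + x < 2 + 4 * S" if "l \<le> 3" "x < S" for l x
      using mult_le_mono1[OF that(1), of S] that(2) by linarith
    ultimately show ?thesis
      using that by (auto simp: layers_def set_row)
  qed
  then show ?thesis using assms by (fastforce simp: adjacency_over_def)
qed

text \<open>Numbers that are no nodes are put on level 4, so that 0 and 1 are the only numbers on
  the extreme levels 0 and 5.\<close>

definition layer_level :: "nat \<Rightarrow> nat \<Rightarrow> nat" where
  "layer_level S u = (if u = 0 then 0 else if u = 1 then 5 else if u < 2 + S then 1
     else if u < 2 + 2 * S then 2 else if u < 2 + 3 * S then 3 else 4)"

lemma lang_five_arcs: "lang five_arcs = {[0, 0, 0, 0, 0]}"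
  by (auto simp: five_arcs_def)

text \<open>Only row \<open>i\<close> is joined to 0 and only its copy in the last layer is joined
  to 1, so the free choices on a path are the inner index and the column.\<close>

lemma answers_five_arcs:
  fixes S i :: nat and P1 P2 P3 :: bmat
  defines "D \<equiv> ({..<2 + 4 * S}, insert (2 + 3 * S + i, 0, 1) (insert (0, 0, 2 + i) (block_arcs S P1 P2 P3)))"
  assumes "i < S"
  shows "answers five_arcs D = (if \<exists>k<S. \<exists>j<S. P1 i k \<and> P2 k j \<and> P3 j i then {(0, 1)} else {})"
proof -
  have "answers five_arcs D = (if labelled_path D 0 [0, 0, 0, 0, 0] 1 then {(0, 1)} else {})"
    by (rule answers_layered[where lev = "layer_level S", OF _ _ _ _ _ _ lang_five_arcs])
      (use \<open>i < S\<close> in \<open>auto simp: D_def layer_level_def block_arcs_def split: if_splits\<close>)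
  moreover have "labelled_path D 0 [0, 0, 0, 0, 0] 1 \<longleftrightarrow> (\<exists>k<S. \<exists>j<S. P1 i k \<and> P2 k j \<and> P3 j i)"
    (is "?l \<longleftrightarrow> ?r")
  proof
    assume ?l
    then obtain a b c d where path: "(0, 0, a) \<in> snd D" "(a, 0, b) \<in> snd D" "(b, 0, c) \<in> snd D"
      "(c, 0, d) \<in> snd D" "(d, 0, 1) \<in> snd D"
      by (auto simp: labelled_path_Cons_iff labelled_path_Nil_iff)
    have a: "a = 2 + i" using path(1) by (auto simp: D_def block_arcs_def)
    obtain k where k: "b = 2 + S + k" "k < S" "P1 i k"
      using path(2) a assms(2) by (auto simp: D_def block_arcs_def)
    obtain j where j: "c = 2 + 2 * S + j" "j < S" "P2 k j"
      using path(3) k assms(2) by (auto simp: D_def block_arcs_def)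
    obtain i' where i': "d = 2 + 3 * S + i'" "i' < S" "P3 j i'"
      using path(4) j assms(2) by (auto simp: D_def block_arcs_def)
    have "i' = i" using path(5) i' assms(2) by (auto simp: D_def block_arcs_def)
    then show ?r using i' j k by blast
  next
    assume ?r
    then obtain k j where kj: "k < S" "j < S" "P1 i k" "P2 k j" "P3 j i" by blast
    have "(0, 0, 2 + i) \<in> snd D" "(2 + i, 0, 2 + S + k) \<in> snd D" "(2 + S + k, 0, 2 + 2 * S + j) \<in> snd D"
      "(2 + 2 * S + j, 0, 2 + 3 * S + i) \<in> snd D" "(2 + 3 * S + i, 0, 1) \<in> snd D" "1 \<in> fst D"
      using kj assms(2) by (auto simp: D_def block_arcs_def)
    then show ?l unfolding labelled_path_Cons_iff labelled_path_Nil_iff by blast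
  qed
  ultimately show ?thesis by simp
qed

lemma (in words) wp_puts:
  assumes "bounded B s" "k + length xs \<le> 20" "\<forall>x \<in> set xs. x \<le> 20"
    and "memory_free p" "safe B s p" "cost p \<le> 10"
  shows "wp W (seqs (map (\<lambda>(i, x). put (p +\<^sub>e Num i) (Num x)) (zip [k..<k + length xs] xs))) s
    (\<lambda>out t s'. out = [] \<and> t \<le> 30 * length xs \<and> bounded B s' \<and> frame {} {1} s s'
      \<and> holds (val s p + k) xs s' \<and> (\<forall>a<val s p + k. lane 1 s' a = lane 1 s a))"
  using assms
proof (induction xs arbitrary: s k)
  case Nil
  then show ?case by (auto simp: seqs_def intro!: wp_Skip)
next
  case (Cons x xs)
  let ?c = "\<lambda>k xs. seqs (map (\<lambda>(i, x). put (p +\<^sub>e Num i) (Num x)) (zip [k..<k + length xs] xs))"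
  let ?s = "set_lane 1 (val s p + k) x s"
  have eq: "?c k (x # xs) = (put (p +\<^sub>e Num k) (Num x) ;; ?c (Suc k) xs)"
  proof -
    have "[k..<k + length (x # xs)] = k # [Suc k..<Suc k + length xs]"
      by (simp add: upt_conv_Cons del: upt_Suc)
    then show ?thesis by (simp only: zip_Cons_Cons list.map prod.case) (simp add: seqs_def del: upt_Suc)
  qed
  have IH: "wp W (?c (Suc k) xs) ?s (\<lambda>out t s'. out = [] \<and> t \<le> 30 * length xs \<and> bounded B s'
      \<and> frame {} {1} ?s s' \<and> holds (val ?s p + Suc k) xs s'
      \<and> (\<forall>a<val ?s p + Suc k. lane 1 s' a = lane 1 ?s a))"
    by (rule Cons.IH) (use Cons.prems B_ge in \<open>auto simp: memory_free_safe\<close>)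
  show ?case unfolding eq
  proof (intro wp_Seq wp_put, goal_cases)
    case 6
    have pos: "val s (p +\<^sub>e Num k) = val s p + k" by simp
    show ?case unfolding pos val.simps(1)
      by (intro wp_mono[OF IH]) (use Cons.prems in \<open>auto simp: holds_Cons frame_def memory_free_val\<close>)
  qed (use Cons.prems B_ge in auto)
qed

section \<open>Writing a complete instance\<close>

context blocks begin

lemma wp_put_query:
  assumes "block_state s" "building (ls @ [[]]) s" "length ls = 2 + 4 * S"
  shows "wp W put_query s (\<lambda>out t s'. out = [] \<and> t \<le> 500 \<and> block_state s' \<and> frame {} {1} s s'
    \<and> input_in (enc_instance ls five_arcs) s')"
proof -
  have q: "enc_rpq five_arcs = [2, 1, 0, 2, 1, 0, 2, 1, 0, 2, 1, 0, 1, 0]"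
    by (simp add: five_arcs_def)
  have "wp W put_query s (\<lambda>out t s'. out = [] \<and> t \<le> 30 * length (enc_rpq five_arcs) \<and> bounded B s'
      \<and> frame {} {1} s s' \<and> holds (4 + 4 * S + 2 * regs s rm) (enc_rpq five_arcs) s'
      \<and> (\<forall>a<4 + 4 * S + 2 * regs s rm. lane 1 s' a = lane 1 s a))"
    using wp_puts[of s 0 "enc_rpq five_arcs" next_pos] assms(1) B_ge unfolding put_query_def by (simp add: q)
  then show ?thesis
  proof (rule wp_mono, goal_cases)
    case (1 out t s')
    \<comment> \<open>The query is written behind all other parts of the instance, which therefore
      remain intact.\<close>
    have "holds p xs s'" if "holds p xs s" "p + length xs \<le> 4 + 4 * S + 2 * regs s rm" for p xs
      using that 1 by (auto simp: holds_def)
    moreover have pos: "Suc 0 + length (offsets (ls @ [[]])) = 4 + 4 * S"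
      "4 + 4 * S + length (arc_words (concat ls)) = 4 + 4 * S + 2 * length (concat ls)"
      using assms(3) by simp_all
    ultimately have "input_in (enc_instance ls five_arcs) s'"
      using assms(2,3) 1 unfolding input_in_holds enc_instance_offsets holds_Cons holds_append pos
      by (simp add: building_def)
    moreover have "block_state s'" by (rule block_state_frame[OF assms(1)]) (use 1 in auto)
    ultimately show ?case using 1 by (simp add: q)
  qed
qed

lemma wp_replicate:
  assumes "block_state s" "building ls s" "length ls + S \<le> 4 * S + 3" "length (concat ls) \<le> B"
  shows "wp W (loop ri put_offset) s (\<lambda>out t s'. out = [] \<and> t \<le> S * 80 + 50 \<and> block_state s'
    \<and> building (ls @ replicate S []) s' \<and> frame {ri, rk, rj, ru, rm} {1} s s')"
proof -
  let ?P = "\<lambda>m s'. block_state s' \<and> building (ls @ replicate m []) s' \<and> frame {ri, ru, rm} {1} s s' \<and> regs s' ri = m"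
  show ?thesis
  proof (rule wp_loop[where P = ?P and T = 30], goal_cases)
    case (5 m s')
    show ?case
    proof (rule wp_mono[OF wp_put_offset[of s' "ls @ replicate m []"]], goal_cases)
      case (5 out t s'')
      then have fr: "frame {ri, ru, rm} {1} s' s''" "regs s'' ri = m"
        using frame_reg[of "{ru, rm}" "{1}" s' s'' ri] \<open>?P m s'\<close> by (auto intro: frame_mono)
      then have "frame {ri, ru, rm} {1} s s''" using \<open>?P m s'\<close> frame_trans by blast
      then show ?case using 5 fr \<open>m < S\<close> small
        by (auto simp: frame_set_reg replicate_append_same[symmetric] simp del: replicate.simps(2))
           (simp add: replicate_append_same)
    qed (use 5 assms(3,4) in auto)
  next
    case (6 t s')
    then show ?case by (auto simp: algebra_simps intro: frame_mono)
  qed (use assms in \<open>auto simp: frame_set_reg\<close>)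
qed

text \<open>If \<open>S\<close> does not divide \<open>n\<close>, the last blocks stick out of the
  matrices; positions outside yield no arcs.\<close>

definition block_A :: "ram \<Rightarrow> bmat" where
  "block_A s i k \<longleftrightarrow> regs s rI + i < n \<and> regs s rK + k < n \<and> A (regs s rI + i) (regs s rK + k)"

definition block_B :: "ram \<Rightarrow> bmat" where
  "block_B s k j \<longleftrightarrow> regs s rK + k < n \<and> regs s rJ + j < n \<and> A' (regs s rK + k) (regs s rJ + j)"

text \<open>The column comes first because the arcs of this layer lead from columns back to rows.
  Positions outside the matrix do not count as zeros of C, so they can never be reported as new
  ones.\<close>

definition block_not_C :: "ram \<Rightarrow> bmat" where
  "block_not_C s j i \<longleftrightarrow> regs s rI + i < n \<and> regs s rJ + j < n
     \<and> lane 3 s ((regs s rI + i) * n + (regs s rJ + j)) = 0"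

abbreviation graph_of :: "ram \<Rightarrow> adjacency" where
  "graph_of s \<equiv> layers S (block_A s) (block_B s) (block_not_C s)"

lemma wp_build:
  assumes "block_state s"
  shows "wp W build s (\<lambda>out t s'. out = [] \<and> t \<le> 2500 * (S * S) \<and> block_state s'
    \<and> frame {ri, rk, rj, ru, rm} {1} s s' \<and> input_in (enc_instance (graph_of s) five_arcs) s')"
proof -
  let ?F = "frame {ri, rk, rj, ru, rm} {1} s"
  let ?l1 = "[[], []] @ map (\<lambda>i. row S 1 (block_A s i)) [0..<S]"
  let ?l2 = "?l1 @ map (\<lambda>i. row S 2 (block_B s i)) [0..<S]"
  let ?l3 = "?l2 @ map (\<lambda>i. row S 3 (block_not_C s i)) [0..<S]"
  note c = length_concat_rows[of S _ _ S]
  have len: "length (concat ?l1) \<le> S * S" "length (concat ?l2) \<le> 2 * (S * S)" "length (concat ?l3) \<le> 3 * (S * S)"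
    using c[of 1 "block_A s"] c[of 2 "block_B s"] c[of 3 "block_not_C s"] by auto
  let ?s1 = "set_reg ru 0 (set_reg rm 0 (set_lane 1 0 (2 + 4 * S) s))"
  have s1: "block_state ?s1" "building [] ?s1" "?F ?s1"
    using assms small by (auto simp: building_def offsets_def frame_def)
  have put0: "wp W (put (Num 0) (Num 2 +\<^sub>e Num 4 *\<^sub>e Var rs)) s
      (\<lambda>out t s'. out = [] \<and> t \<le> 20 \<and> s' = set_lane 1 0 (2 + 4 * S) s)"
    by (rule wp_put) (use assms B_ge in auto)
  have set0: "wp W (x ::= Num 0) s' (\<lambda>out t s''. out = [] \<and> t \<le> 2 \<and> s'' = set_reg x 0 s')"
    if "block_state s'" for x s'
    by (rule wp_Assign) (use that in auto)
  have step2: "wp W put_offset ?s1 (\<lambda>out t s'. out = [] \<and> t \<le> 30 \<and> block_state s'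
      \<and> building [[]] s' \<and> ?F s')"
    by (rule wp_mono[OF wp_put_offset[OF s1(1,2)]]) (use frame_trans[OF s1(3)] in \<open>auto intro: frame_mono\<close>)
  have step3: "wp W put_offset s' (\<lambda>out t s''. out = [] \<and> t \<le> 30 \<and> block_state s''
      \<and> building [[], []] s'' \<and> ?F s'')" if "block_state s'" "building [[]] s'" "?F s'" for s'
    by (rule wp_mono[OF wp_put_offset[OF that(1,2)]]) (use frame_trans[OF that(3)] in \<open>auto intro: frame_mono\<close>)
  \<comment> \<open>The guards read the corner of the blocks and the matrix C, none of which changes
    while the graph is written.\<close>
  have fr: "?F s''" "regs s'' 2 = regs s 2" "regs s'' 3 = regs s 3" "regs s'' 4 = regs s 4" "lane 3 s'' = lane 3 s"
    if "?F s'" "frame {y, x, ru, rm} {1} s' s''" "x \<in> {ri, rk, rj}" "y \<in> {ri, rk, rj}" for s' s'' x y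
  proof -
    have "frame {ri, rk, rj, ru, rm} {1} s' s''" using that(2-4) by (auto intro: frame_mono)
    then show F: "?F s''" using that(1) frame_trans by blast
    show "regs s'' 2 = regs s 2" "regs s'' 3 = regs s 3" "regs s'' 4 = regs s 4" "lane 3 s'' = lane 3 s"
      using F by (auto simp: frame_def)
  qed
  have step4: "wp W (loop ri (put_offset ;; loop rk (if_A (put_arc (node 1 rk))))) s' (\<lambda>out t s''.
      out = [] \<and> t \<le> 400 * (S * S) \<and> block_state s'' \<and> building ?l1 s'' \<and> ?F s'')"
    if s': "block_state s'" "building [[], []] s'" "?F s'" for s'
  proof (rule wp_mono[OF wp_layer[OF s'(1,2), where P = "block_A s" and sel = if_A]], goal_cases)
    case (7 i k s'' Q c)
    note f = fr[OF s'(3) 7(3)]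
    show ?case by (rule wp_if_A) (use 7 f in \<open>auto simp: block_A_def\<close>)
  next
    case 8
    then show ?case using frame_trans[OF s'(3)] by auto
  qed (use small in auto)
  have step5: "wp W (loop rk (put_offset ;; loop rj (if_B (put_arc (node 2 rj))))) s' (\<lambda>out t s''.
      out = [] \<and> t \<le> 400 * (S * S) \<and> block_state s'' \<and> building ?l2 s'' \<and> ?F s'')"
    if s': "block_state s'" "building ?l1 s'" "?F s'" for s'
  proof (rule wp_mono[OF wp_layer[OF s'(1,2), where P = "block_B s" and sel = if_B]], goal_cases)
    case 2
    then show ?case using len small by simp
  next
    case (7 i k s'' Q c)
    note f = fr[OF s'(3) 7(3)]
    show ?case by (rule wp_if_B) (use 7 f in \<open>auto simp: block_B_def\<close>)
  next
    case 8
    then show ?case using frame_trans[OF s'(3)] by auto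
  qed auto
  have step6: "wp W (loop rj (put_offset ;; loop ri (if_not_C (put_arc (node 3 ri))))) s' (\<lambda>out t s''.
      out = [] \<and> t \<le> 400 * (S * S) \<and> block_state s'' \<and> building ?l3 s'' \<and> ?F s'')"
    if s': "block_state s'" "building ?l2 s'" "?F s'" for s'
  proof (rule wp_mono[OF wp_layer[OF s'(1,2), where P = "block_not_C s" and sel = if_not_C]], goal_cases)
    case 2
    then show ?case using len small by simp
  next
    case (7 i k s'' Q c)
    note f = fr[OF s'(3) 7(3)]
    show ?case by (rule wp_if_not_C) (use 7 f in \<open>auto simp: block_not_C_def\<close>)
  next
    case 8
    then show ?case using frame_trans[OF s'(3)] by auto
  qed auto
  have step7: "wp W (loop ri put_offset) s' (\<lambda>out t s''.
      out = [] \<and> t \<le> S * 80 + 50 \<and> block_state s'' \<and> building (graph_of s) s'' \<and> ?F s'')"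
    if s': "block_state s'" "building ?l3 s'" "?F s'" for s'
    by (rule wp_mono[OF wp_replicate[OF s'(1,2)]])
      (use frame_trans[OF s'(3)] len small in \<open>auto simp: layers_def\<close>)
  have len': "length (concat (graph_of s)) \<le> B" using len(3) small by (simp add: layers_def)
  have step8: "wp W put_offset s' (\<lambda>out t s''. out = [] \<and> t \<le> 30 \<and> block_state s''
      \<and> building (graph_of s @ [[]]) s'' \<and> ?F s'')" if "block_state s'" "building (graph_of s) s'" "?F s'" for s'
    by (rule wp_mono[OF wp_put_offset[OF that(1,2)]])
      (use frame_trans[OF that(3)] len' in \<open>auto intro: frame_mono\<close>)
  have step9: "wp W put_query s' (\<lambda>out t s''. out = [] \<and> t \<le> 500 \<and> block_state s''
      \<and> input_in (enc_instance (graph_of s) five_arcs) s'' \<and> ?F s'')"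
    if "block_state s'" "building (graph_of s @ [[]]) s'" "?F s'" for s'
    by (rule wp_mono[OF wp_put_query[OF that(1,2)]])
      (use frame_trans[OF that(3)] in \<open>auto intro: frame_mono\<close>)
  \<comment> \<open>The three layers of arcs take \<open>400 * (S * S)\<close> steps each, the last
    layer of nodes \<open>S * 80 + 50\<close>; the rest is constant.\<close>
  have bound: "1200 * (S * S) + S * 80 + 690 \<le> 2500 * (S * S)" using S_square by linarith
  show ?thesis
    unfolding build_def
    apply (rule wp_bind[OF put0], elim conjE, hypsubst)
    apply (rule wp_bind[OF set0[of _ rm]], (use assms small in simp; fail), elim conjE, hypsubst)
    apply (rule wp_bind[OF set0[of _ ru]], (use assms small in simp; fail), elim conjE, hypsubst)
    apply (rule wp_bind[OF step2], elim conjE)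
    apply (rule wp_bind[OF step3], assumption+, elim conjE)
    apply (rule wp_bind[OF step4], assumption+, elim conjE)
    apply (rule wp_bind[OF step5], assumption+, elim conjE)
    apply (rule wp_bind[OF step6], assumption+, elim conjE)
    apply (rule wp_bind[OF step7], assumption+, elim conjE)
    apply (rule wp_bind[OF step8], assumption+, elim conjE)
    apply (rule wp_mono[OF step9], assumption+, elim conjE)
    using bound by simp
qed

end

section \<open>Block multiplication with Enum\<close>

lemma index_inj:
  assumes "j < n" "j' < n"
  shows "i * n + j = i' * n + j' \<longleftrightarrow> i = i' \<and> j = (j'::nat)"
proof -
  have "i = i' \<and> j = j'" if "i * n + j = i' * n + j'"
  proof -
    have "(i * n + j) div n = i" "(i * n + j) mod n = j" "(i' * n + j') div n = i'" "(i' * n + j') mod n = j'"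
      using assms by auto
    then show ?thesis using that by metis
  qed
  then show ?thesis by blast
qed

section \<open>Naive multiplication of two blocks\<close>

context blocks begin

definition set_ones :: "ram \<Rightarrow> ram \<Rightarrow> (nat \<times> nat) set \<Rightarrow> bool" where
  "set_ones s s' X \<longleftrightarrow> (\<forall>i<n. \<forall>j<n. lane 3 s' (i * n + j) = (if (i, j) \<in> X then 1 else lane 3 s (i * n + j)))"

lemma set_ones_empty [simp]: "set_ones s s {}"
  by (simp add: set_ones_def)

lemma set_ones_set_reg [simp]: "set_ones s (set_reg x v s') X = set_ones s s' X"
  by (simp add: set_ones_def)

lemma set_ones_store:
  assumes "set_ones s s' X" "i < n" "j < n"
  shows "set_ones s (set_lane 3 (i * n + j) 1 s') (insert (i, j) X)"
  using assms by (auto simp: set_ones_def index_inj)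

lemma wp_multiply_blocks:
  assumes "block_state s"
  shows "wp W multiply_blocks s (\<lambda>out t s'. out = [] \<and> t \<le> 800 * (S * S * S) \<and> block_state s'
    \<and> frame {ri, rk, rj} {3} s s'
    \<and> set_ones s s' {(regs s rI + i, regs s rJ + j) |i j. i < S \<and> j < S \<and> (\<exists>k<S. block_A s i k \<and> block_B s k j)})"
proof -
  let ?F = "frame {ri, rk, rj} {3} s"
  let ?p = "\<lambda>i j. (regs s rI + i, regs s rJ + j)"
  \<comment> \<open>The entries set so far by the loops over columns, inner indices and rows. With
    full range, each set is what one effective iteration of the next outer loop adds.\<close>
  let ?Xj = "\<lambda>i k m. {?p i j |j. j < m \<and> block_B s k j}"
  let ?Xk = "\<lambda>i m. {?p i j |j. j < S \<and> (\<exists>k<m. block_A s i k \<and> block_B s k j)}"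
  let ?Xi = "\<lambda>m. {?p i j |i j. i < m \<and> j < S \<and> (\<exists>k<S. block_A s i k \<and> block_B s k j)}"
  have F: "regs s' rI = regs s rI" "regs s' rJ = regs s rJ" "regs s' rK = regs s rK" if "?F s'" for s'
    using that by (auto simp: frame_def)
  have j: "wp W (loop rj (if_B (Store (cell_C gi gj) (Num 1)))) s'
      (\<lambda>out t s''. out = [] \<and> t \<le> S * 150 + 50 \<and> block_state s'' \<and> ?F s'' \<and> regs s'' ri = i \<and> regs s'' rk = k
        \<and> set_ones s s'' (X \<union> ?Xj i k S))"
    if "block_state s'" "?F s'" "regs s' ri = i" "regs s' rk = k" "set_ones s s' X" "regs s rI + i < n" for s' i k X
  proof (rule wp_loop[where T = 100 and P = "\<lambda>m s''. block_state s'' \<and> ?F s'' \<and> regs s'' ri = i \<and> regs s'' rk = k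
        \<and> set_ones s s'' (X \<union> ?Xj i k m) \<and> regs s'' rj = m"], goal_cases)
    case (5 m s'')
    then have P: "block_state s''" "?F s''" "regs s'' ri = i" "regs s'' rk = k" "set_ones s s'' (X \<union> ?Xj i k m)"
      "regs s'' rj = m" by blast+
    show ?case
    proof (rule wp_if_B[OF P(1)], goal_cases)
      case 1
      then have b: "block_B s k m" "regs s rJ + m < n" using P F[OF P(2)] by (auto simp: block_B_def)
      have "X \<union> ?Xj i k (Suc m) = insert (?p i m) (X \<union> ?Xj i k m)" using b by (auto simp: less_Suc_eq)
      then have X: "set_ones s (set_lane 3 ((regs s rI + i) * n + (regs s rJ + m)) 1 s'') (X \<union> ?Xj i k (Suc m))"
        using set_ones_store[OF P(5) that(6) b(2)] by simp
      have "val s'' (cell_C gi gj) = 4 * ((regs s rI + i) * n + (regs s rJ + m)) + 3"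
        using P(1,3,6) F[OF P(2)] by (simp add: cell_C_def)
      then show ?case
        by (rule wp_Store[rotated 5])
          (use P X B_ge 5 small in \<open>auto simp: cell_C_def frame_set_lane frame_set_reg\<close>)
    next
      case (2 u)
      then have "\<not> block_B s k m" using P F[OF P(2)] by (auto simp: block_B_def)
      then have "X \<union> ?Xj i k (Suc m) = X \<union> ?Xj i k m" by (auto simp: less_Suc_eq)
      then have "set_ones s s'' (X \<union> ?Xj i k (Suc m))" using P(5) by simp
      then show ?case using 2 P 5 small by (auto simp: frame_set_reg)
    qed
  qed (use that in \<open>auto simp: frame_set_reg\<close>)
  have k: "wp W (loop rk (if_A (loop rj (if_B (Store (cell_C gi gj) (Num 1)))))) s'
      (\<lambda>out t s''. out = [] \<and> t \<le> S * (160 + S * 150) + 50 \<and> block_state s'' \<and> ?F s'' \<and> regs s'' ri = i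
        \<and> set_ones s s'' (X \<union> ?Xk i S))"
    if "block_state s'" "?F s'" "regs s' ri = i" "set_ones s s' X" for s' i X
  proof (rule wp_loop[where T = "S * 150 + 110" and P = "\<lambda>m s''. block_state s'' \<and> ?F s'' \<and> regs s'' ri = i
        \<and> set_ones s s'' (X \<union> ?Xk i m) \<and> regs s'' rk = m"], goal_cases)
    case (5 m s'')
    then have P: "block_state s''" "?F s''" "regs s'' ri = i" "regs s'' rk = m" "set_ones s s'' (X \<union> ?Xk i m)"
      by blast+
    show ?case
    proof (rule wp_if_A[OF P(1)], goal_cases)
      case 1
      then have a: "block_A s i m" "regs s rI + i < n" using P F[OF P(2)] by (auto simp: block_A_def)
      have "X \<union> ?Xk i (Suc m) = X \<union> ?Xk i m \<union> ?Xj i m S"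
        using a by (auto simp: less_Suc_eq)
      then have eq: "X \<union> ?Xk i m \<union> ?Xj i m S = X \<union> ?Xk i (Suc m)" by simp
      show ?case
        by (rule wp_mono[OF j[OF P a(2), unfolded eq]]) (use 5 small in \<open>auto simp: frame_set_reg\<close>)
    next
      case (2 u)
      then have "\<not> block_A s i m" using P F[OF P(2)] by (auto simp: block_A_def)
      then have "X \<union> ?Xk i (Suc m) = X \<union> ?Xk i m" by (auto simp: less_Suc_eq)
      then have "set_ones s s'' (X \<union> ?Xk i (Suc m))" using P(5) by simp
      then show ?case using 2 P 5 small by (auto simp: frame_set_reg)
    qed
  qed (use that in \<open>auto simp: frame_set_reg\<close>)
  show ?thesis unfolding multiply_blocks_def
  proof (rule wp_loop[where T = "S * (160 + S * 150) + 50" and P = "\<lambda>m s''. block_state s'' \<and> ?F s''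
        \<and> set_ones s s'' (?Xi m) \<and> regs s'' ri = m"], goal_cases)
    case (5 m s'')
    then have P: "block_state s''" "?F s''" "regs s'' ri = m" "set_ones s s'' (?Xi m)" by blast+
    have eq: "?Xi m \<union> ?Xk m S = ?Xi (Suc m)" by (auto simp: less_Suc_eq)
    show ?case
      by (rule wp_mono[OF k[OF P, unfolded eq]]) (use 5 small in \<open>auto simp: frame_set_reg\<close>)
  next
    case (6 t s')
    have "S * S \<le> S * S * S" using S_pos by simp
    moreover have "S * (S * (160 + S * 150) + 50 + 50) + 50 = 150 * (S * S * S) + 160 * (S * S) + 100 * S + 50"
      by (simp add: algebra_simps)
    ultimately have "t \<le> 800 * (S * S * S)" using 6 S_square by linarith
    then show ?case using 6 by auto
  qed (use assms in \<open>auto simp: frame_set_reg\<close>)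
qed

end

text \<open>\<open>log_le\<close> allows for the log of a complete test, namely the preprocessing
  and the requests for \<open>S\<close> rows, because the log is cleared only at the start of the
  next test.\<close>

locale bmm = blocks W B n S A A' + server W B V upd enm five_arcs \<sigma> N TU TD bu bd
  for W B n S :: nat and A A' :: bmat and V upd enm \<sigma> N TU TD bu bd +
  fixes pre :: com and TP :: nat
  assumes \<sigma>_pos: "1 \<le> \<sigma>" and N_eq: "N = 2 + 4 * S"
    and solves: "adjacency_over \<sigma> ls \<Longrightarrow> length ls = 2 + 4 * S \<Longrightarrow>
      \<exists>tr g. exec V pre (start (enc_instance ls five_arcs)) tr g \<and> emitted tr = [] \<and> length tr \<le> TP
        \<and> serves \<sigma> N V upd enm five_arcs bu bd (db_of ls) g reqs"
    and log_le: "TP + S * (4 * TU + 2 * TD + 20) \<le> B"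
begin

abbreviation reg_count :: nat where
  "reg_count \<equiv> max (com_regs pre) (max (com_regs upd) (com_regs enm))"

text \<open>All that \<open>reset\<close> requires, with \<open>L\<close> as the current allowance
  for the log.\<close>

definition idle :: "nat \<Rightarrow> ram \<Rightarrow> bool" where
  "idle L s \<longleftrightarrow> block_state s \<and> logged s \<and> (\<forall>x\<ge>reg_count. hosted_regs s x = 0) \<and> regs s rlog \<le> L"

lemma logged_set_reg [simp]: "x \<noteq> rlog \<Longrightarrow> logged (set_reg x v s) = logged s"
  by (simp add: logged_def)

lemma idle_mono: "idle L s \<Longrightarrow> L \<le> L' \<Longrightarrow> idle L' s"
  by (auto simp: idle_def)

lemma idle_set_reg: "idle L s \<Longrightarrow> x \<in> {rI, rK, rJ, ri, rk, rj, ru, rm, rfound, ryes} \<Longrightarrow> v \<le> B \<Longrightarrow> idle L (set_reg x v s)"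
  by (auto simp: idle_def)

abbreviation test_frame :: "ram \<Rightarrow> ram \<Rightarrow> bool" where
  "test_frame \<equiv> frame {ri, rk, rj, ru, rm, rlog, rfound, ryes, 14} {0, 1, 2}"

lemma idle_called:
  assumes "called c T s out t s'" "idle L s" "com_regs c \<le> reg_count"
  shows "idle (L + T) s'" "test_frame s s'" "regs s' ri = regs s ri" "regs s' ryes = regs s ryes"
proof -
  have f: "frame {rlog, rfound, 14} {0, 1, 2} s s'" using assms(1) by (simp add: called_def)
  then show "test_frame s s'" by (auto intro: frame_mono)
  show "regs s' ri = regs s ri" "regs s' ryes = regs s ryes" using f by (auto simp: frame_def)
  have "block_state s'"
    by (rule block_state_frame[OF _ f]) (use assms(1,2) in \<open>auto simp: called_def idle_def\<close>)
  then show "idle (L + T) s'" using assms by (auto simp: idle_def called_def)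
qed

text \<open>By \<open>answers_five_arcs\<close> this is the existence of a path from 0 to 1 once row
  \<open>i\<close> is connected.\<close>

definition hit :: "ram \<Rightarrow> nat \<Rightarrow> bool" where
  "hit s i \<longleftrightarrow> (\<exists>k<S. \<exists>j<S. block_A s i k \<and> block_B s k j \<and> block_not_C s j i)"

definition row_requests :: "nat \<Rightarrow> request list" where
  "row_requests i = [Update (InsArc 0 0 (2 + i)), Update (InsArc (2 + 3 * S + i) 0 1), Enumerate,
     Update (DelArc 0 0 (2 + i)), Update (DelArc (2 + 3 * S + i) 0 1)]"

text \<open>Four updates of \<open>TU + 5\<close> each and one enumeration of
  \<open>2 * TD\<close>.\<close>

definition row_log :: nat where
  "row_log = 4 * TU + 2 * TD + 20"

definition row_time :: nat where
  "row_time = 80 * TU + 40 * TD + 1000"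

text \<open>\<open>s0\<close> stands for the state that defines the graph. Every row is tested on
  this same graph, as the two arcs of a row are removed again after the enumeration.\<close>

lemma wp_test_row:
  fixes i :: nat and s0 :: ram and reqs :: "request list"
  defines "D \<equiv> db_of (graph_of s0)"
  assumes "idle L s" "L + row_log \<le> B" "serving s D (row_requests i @ reqs)" "regs s ri = i" "i < S"
    and "regs s ryes = of_bool p"
  shows "wp W (call_update upd 0 (Num 0) (node 0 ri) ;; call_update upd 0 (node 3 ri) (Num 1) ;;
        rfound ::= Num 0 ;; embed enm ;; ryes ::= Bin BitOr (Var ryes) (Var rfound) ;;
        call_update upd 1 (Num 0) (node 0 ri) ;; call_update upd 1 (node 3 ri) (Num 1)) s
      (\<lambda>out t s'. out = [] \<and> t \<le> row_time \<and> idle (L + row_log) s' \<and> serving s' D reqs \<and> test_frame s s'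
        \<and> regs s' ri = i \<and> regs s' ryes = of_bool (p \<or> hit s0 i))"
proof -
  let ?V = "{..<2 + 4 * S}" and ?E = "block_arcs S (block_A s0) (block_B s0) (block_not_C s0)"
  let ?a = "(0, 0, 2 + i)" and ?b = "(2 + 3 * S + i, 0, 1)"
  have D: "D = (?V, ?E)" by (simp add: D_def db_of_layers)
  \<comment> \<open>Freshness serves twice: the insertions are allowed, and the deletions restore
    the original set of arcs.\<close>
  have new: "?a \<notin> ?E" "?b \<notin> insert ?a ?E" using \<open>i < S\<close> by (auto simp: block_arcs_def)
  have V: "0 \<in> ?V" "1 \<in> ?V" "2 + i \<in> ?V" "2 + 3 * S + i \<in> ?V" using \<open>i < S\<close> by auto
  have fin: "card (fst (?V, X)) \<le> N" for X :: "arc set" by (simp add: N_eq)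
  have nodes: "val s' (node 0 ri) = 2 + i" "val s' (node 3 ri) = 2 + 3 * S + i"
    if "idle L' s'" "regs s' ri = i" for s' L'
    using that by (auto simp: node_def idle_def)
  have call: "wp W (call_update upd opc e e') s' (\<lambda>out t s''. out = [] \<and> t \<le> 20 * TU + 200
      \<and> idle (L' + (TU + 5)) s'' \<and> serving s'' (apply_update up D') reqs' \<and> test_frame s s''
      \<and> regs s'' ri = i \<and> regs s'' ryes = regs s' ryes \<and> regs s'' rfound = regs s' rfound)"
    if "idle L' s'" "L' + (TU + 5) \<le> L + row_log" "serving s' D' (Update up # reqs')" "regs s' ri = i"
      "test_frame s s'"
      "allowed \<sigma> N D' up" "card (fst (apply_update up D')) \<le> N" "opc \<le> 1"
      "enc_update up = [opc, val s' e, 0, val s' e']" "e \<in> {Num 0, node 3 ri}" "e' \<in> {Num 1, node 0 ri}"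
    for s' L' D' up reqs' opc e e'
  proof (rule wp_mono[OF wp_call_update[OF that(3,6,7,9)]])
    show "bounded B s'" using that(1) by (simp add: idle_def)
    show "regs s' rlog + TU \<le> B" using that(1,2) assms(3) by (auto simp: idle_def)
    show "val s' e \<le> B" "val s' e' \<le> B" using that(10,11) nodes[OF that(1,4)] small \<open>i < S\<close> by auto
    fix out t s''
    assume as: "called upd (TU + 5) s' out t s'' \<and> regs s'' rfound = regs s' rfound \<and>
      serving s'' (apply_update up D') reqs'"
    note i = idle_called[OF conjunct1[OF as] that(1)]
    have "test_frame s s''" using i(2) frame_trans[OF that(5)] by simp
    moreover have "out = [] \<and> t \<le> 20 * TU + 200" using as by (auto simp: called_def)
    ultimately show "out = [] \<and> t \<le> 20 * TU + 200
      \<and> idle (L' + (TU + 5)) s'' \<and> serving s'' (apply_update up D') reqs' \<and> test_frame s s''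
      \<and> regs s'' ri = i \<and> regs s'' ryes = regs s' ryes \<and> regs s'' rfound = regs s' rfound"
      using i that(4) as by auto
  qed (use that(8,10,11) B_ge in \<open>auto simp: node_def\<close>)
  have step1: "wp W (call_update upd 0 (Num 0) (node 0 ri)) s (\<lambda>out t s''. out = [] \<and> t \<le> 20 * TU + 200
      \<and> idle (L + (TU + 5)) s'' \<and> serving s'' (?V, insert ?a ?E) (drop 1 (row_requests i) @ reqs) \<and> test_frame s s''
      \<and> regs s'' ri = i \<and> regs s'' ryes = of_bool p)"
    by (rule wp_mono[OF call[of _ _ D "InsArc 0 0 (2 + i)" "drop 1 (row_requests i) @ reqs"]])
      (use assms(2-) nodes[OF assms(2,5)] V new \<sigma>_pos in \<open>auto simp: D row_requests_def row_log_def N_eq ac_simps\<close>)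
  have step2: "wp W (call_update upd 0 (node 3 ri) (Num 1)) s' (\<lambda>out t s''. out = [] \<and> t \<le> 20 * TU + 200
      \<and> idle (L + 2 * (TU + 5)) s'' \<and> serving s'' (?V, insert ?b (insert ?a ?E)) (drop 2 (row_requests i) @ reqs)
      \<and> test_frame s s'' \<and> regs s'' ri = i \<and> regs s'' ryes = of_bool p)"
    if "idle (L + (TU + 5)) s'" "serving s' (?V, insert ?a ?E) (drop 1 (row_requests i) @ reqs)" "test_frame s s'"
      "regs s' ri = i" "regs s' ryes = of_bool p" for s'
    by (rule wp_mono[OF call[of _ _ "(?V, insert ?a ?E)" "InsArc (2 + 3 * S + i) 0 1" "drop 2 (row_requests i) @ reqs", OF that(1)]])
      (use that nodes[OF that(1,4)] V new \<sigma>_pos in \<open>auto simp: row_requests_def row_log_def N_eq ac_simps\<close>)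
  have step3: "wp W (rfound ::= Num 0) s' (\<lambda>out t s''. out = [] \<and> t \<le> 10
      \<and> idle (L + 2 * (TU + 5)) s'' \<and> serving s'' (?V, insert ?b (insert ?a ?E)) (drop 2 (row_requests i) @ reqs)
      \<and> test_frame s s'' \<and> regs s'' ri = i \<and> regs s'' ryes = of_bool p \<and> regs s'' rfound = 0)"
    if "idle (L + 2 * (TU + 5)) s'"
      "serving s' (?V, insert ?b (insert ?a ?E)) (drop 2 (row_requests i) @ reqs)" "test_frame s s'"
      "regs s' ri = i" "regs s' ryes = of_bool p" for s'
    by (rule wp_Assign) (use that in \<open>auto simp: idle_def idle_set_reg serving_def hosts_def frame_set_reg\<close>)
  have step4: "wp W (embed enm) s' (\<lambda>out t s''. out = [] \<and> t \<le> 40 * TD + 100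
      \<and> idle (L + 2 * (TU + 5) + 2 * TD) s'' \<and> serving s'' (?V, insert ?b (insert ?a ?E)) (drop 3 (row_requests i) @ reqs)
      \<and> test_frame s s'' \<and> regs s'' ri = i \<and> regs s'' ryes = of_bool p \<and> regs s'' rfound = of_bool (hit s0 i))"
    if "idle (L + 2 * (TU + 5)) s'"
      "serving s' (?V, insert ?b (insert ?a ?E)) (drop 2 (row_requests i) @ reqs)" "test_frame s s'"
      "regs s' ri = i" "regs s' ryes = of_bool p" "regs s' rfound = 0" for s'
  proof (rule wp_mono[OF wp_enumerate])
    show "serving s' (?V, insert ?b (insert ?a ?E)) (Enumerate # drop 3 (row_requests i) @ reqs)"
      using that(2) by (simp add: row_requests_def)
    show "answers five_arcs (?V, insert ?b (insert ?a ?E)) = (if hit s0 i then {(0, 1)} else {})"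
      using answers_five_arcs[OF \<open>i < S\<close>, of "block_A s0" "block_B s0" "block_not_C s0"] by (simp add: hit_def)
    show "bounded B s'" using that(1) by (simp add: idle_def)
    show "regs s' rlog + 2 * TD \<le> B" using that(1) assms(3) by (auto simp: idle_def row_log_def)
    fix out t s''
    assume as: "called enm (2 * TD) s' out t s'' \<and> regs s'' rfound = (if hit s0 i then 1 else regs s' rfound)
      \<and> serving s'' (?V, insert ?b (insert ?a ?E)) (drop 3 (row_requests i) @ reqs)"
    note i = idle_called[OF conjunct1[OF as] that(1)]
    have "test_frame s s''" using i(2) frame_trans[OF that(3)] by simp
    moreover have "out = [] \<and> t \<le> 40 * TD + 100" using as by (auto simp: called_def)
    ultimately show "out = [] \<and> t \<le> 40 * TD + 100
      \<and> idle (L + 2 * (TU + 5) + 2 * TD) s'' \<and> serving s'' (?V, insert ?b (insert ?a ?E)) (drop 3 (row_requests i) @ reqs)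
      \<and> test_frame s s'' \<and> regs s'' ri = i \<and> regs s'' ryes = of_bool p \<and> regs s'' rfound = of_bool (hit s0 i)"
      using i that as by auto
  qed (simp add: N_eq)
  have step5: "wp W (ryes ::= Bin BitOr (Var ryes) (Var rfound)) s' (\<lambda>out t s''. out = [] \<and> t \<le> 10
      \<and> idle (L + 2 * (TU + 5) + 2 * TD) s'' \<and> serving s'' (?V, insert ?b (insert ?a ?E)) (drop 3 (row_requests i) @ reqs)
      \<and> test_frame s s'' \<and> regs s'' ri = i \<and> regs s'' ryes = of_bool (p \<or> hit s0 i))"
    if "idle (L + 2 * (TU + 5) + 2 * TD) s'"
      "serving s' (?V, insert ?b (insert ?a ?E)) (drop 3 (row_requests i) @ reqs)" "test_frame s s'"
      "regs s' ri = i" "regs s' ryes = of_bool p" "regs s' rfound = of_bool (hit s0 i)" for s'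
  proof (rule wp_eval_Assign)
    \<comment> \<open>\<open>BitOr\<close> is not among the operators of \<open>safe\<close>, so
      this expression is evaluated directly.\<close>
    have "1 \<le> W" using W_large B_ge by simp
    then show "eval_exp W s' (Bin BitOr (Var ryes) (Var rfound)) = Some (of_bool (p \<or> hit s0 i))"
      using that(5,6) by (cases p; cases "hit s0 i") (auto simp: word_def)
  qed (use that B_ge in \<open>auto simp: idle_def serving_def hosts_def frame_set_reg\<close>)
  have step6: "wp W (call_update upd 1 (Num 0) (node 0 ri)) s' (\<lambda>out t s''. out = [] \<and> t \<le> 20 * TU + 200
      \<and> idle (L + 3 * (TU + 5) + 2 * TD) s'' \<and> serving s'' (?V, insert ?b ?E) (drop 4 (row_requests i) @ reqs)
      \<and> test_frame s s'' \<and> regs s'' ri = i \<and> regs s'' ryes = of_bool (p \<or> hit s0 i))"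
    if "idle (L + 2 * (TU + 5) + 2 * TD) s'"
      "serving s' (?V, insert ?b (insert ?a ?E)) (drop 3 (row_requests i) @ reqs)" "test_frame s s'"
      "regs s' ri = i" "regs s' ryes = of_bool (p \<or> hit s0 i)" for s'
  proof -
    have "insert ?b (insert ?a ?E) - {?a} = insert ?b ?E" using new by auto
    then show ?thesis
      by (intro wp_mono[OF call[of _ _ "(?V, insert ?b (insert ?a ?E))" "DelArc 0 0 (2 + i)" "drop 4 (row_requests i) @ reqs", OF that(1)]])
       (use that nodes[OF that(1,4)] in \<open>auto simp: row_requests_def row_log_def N_eq ac_simps\<close>)
  qed
  have step7: "wp W (call_update upd 1 (node 3 ri) (Num 1)) s' (\<lambda>out t s''. out = [] \<and> t \<le> 20 * TU + 200
      \<and> idle (L + row_log) s'' \<and> serving s'' D reqs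
      \<and> test_frame s s'' \<and> regs s'' ri = i \<and> regs s'' ryes = of_bool (p \<or> hit s0 i))"
    if "idle (L + 3 * (TU + 5) + 2 * TD) s'"
      "serving s' (?V, insert ?b ?E) (drop 4 (row_requests i) @ reqs)" "test_frame s s'"
      "regs s' ri = i" "regs s' ryes = of_bool (p \<or> hit s0 i)" for s'
  proof -
    have "insert ?b ?E - {?b} = ?E" using new by auto
    then show ?thesis
      by (intro wp_mono[OF call[of _ _ "(?V, insert ?b ?E)" "DelArc (2 + 3 * S + i) 0 1" reqs, OF that(1)]])
       (use that nodes[OF that(1,4)] in \<open>auto simp: row_requests_def row_log_def N_eq D ac_simps elim!: idle_mono\<close>)
  qed
  show ?thesis
    apply (rule wp_bind[OF step1], elim conjE)
    apply (rule wp_bind[OF step2], assumption+, elim conjE)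
    apply (rule wp_bind[OF step3], assumption+, elim conjE)
    apply (rule wp_bind[OF step4], assumption+, elim conjE)
    apply (rule wp_bind[OF step5], assumption+, elim conjE)
    apply (rule wp_bind[OF step6], assumption+, elim conjE)
    apply (rule wp_mono[OF step7], assumption+, elim conjE)
    apply (simp add: row_time_def)
    done
qed

definition log_size :: nat where
  "log_size = TP + S * row_log"

text \<open>The first summand pays for blanking the memory that the previous test has
  written.\<close>

definition test_time :: nat where
  "test_time = 30 * log_size + 2 * reg_count + 2500 * (S * S) + 20 * TP + S * (row_time + 50) + 200"

definition all_requests :: "nat \<Rightarrow> request list" where
  "all_requests m = concat (map row_requests [m..<S])"

lemma all_requests_step: "m < S \<Longrightarrow> all_requests m = row_requests m @ all_requests (Suc m)"
  by (simp add: all_requests_def upt_conv_Cons)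

lemma graph_of_frame:
  assumes "frame R K s s'" "rI \<notin> R" "rK \<notin> R" "rJ \<notin> R" "3 \<notin> K"
  shows "graph_of s' = graph_of s" "hit s' = hit s"
proof -
  have "block_A s' = block_A s" "block_B s' = block_B s" "block_not_C s' = block_not_C s"
    using frame_reg[OF assms(1), of rI] frame_reg[OF assms(1), of rK] frame_reg[OF assms(1), of rJ]
      frame_lane[OF assms(1), of 3] assms(2-5)
    by (auto simp: fun_eq_iff block_A_def block_B_def block_not_C_def)
  then show "graph_of s' = graph_of s" "hit s' = hit s" by (simp_all add: hit_def[abs_def])
qed

text \<open>After \<open>reset\<close> the hosted machine is in its start state, whatever the
  previous test left behind. The whole list of row requests is fixed before \<open>pre\<close> is
  run.\<close>

lemma wp_test_blocks:
  assumes "idle log_size s"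
  shows "wp W (test_blocks pre upd enm) s (\<lambda>out t s'. out = [] \<and> t \<le> test_time \<and> idle log_size s'
    \<and> test_frame s s' \<and> regs s' ryes = of_bool (\<exists>i<S. hit s i))"
proof -
  let ?D = "db_of (graph_of s)"
  let ?Z = "\<lambda>s'. hosted_regs s' = (\<lambda>_. 0) \<and> lane 0 s' = (\<lambda>_. 0) \<and> regs s' rlog = 0"
  have bs: "block_state s" using assms by (simp add: idle_def)
  have test_frame: "test_frame s s''" if "test_frame s s'" "frame R K s' s''"
    "R \<subseteq> {ri, rk, rj, ru, rm, rlog, rfound, ryes, 14}" "K \<subseteq> {0, 1, 2}" for s' s'' R K
    using frame_trans[OF that(1) frame_mono[OF that(2-4)]] .
  have step1: "wp W (reset reg_count) s (\<lambda>out t s'. out = [] \<and> t \<le> 30 * log_size + 2 * reg_count + 2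
      \<and> block_state s' \<and> ?Z s' \<and> test_frame s s')"
  proof (rule wp_mono[OF wp_reset], goal_cases)
    case (4 out t s')
    then have f: "frame {rlog, 14} {0} s s'" by simp
    have "block_state s'" by (rule block_state_frame[OF bs f]) (use 4 in auto)
    moreover have "t \<le> 30 * log_size + 2 * reg_count + 2" using 4 assms unfolding idle_def by linarith
    ultimately show ?case using 4 test_frame[OF frame_refl f] by simp
  qed (use assms in \<open>auto simp: idle_def\<close>)
  have step2: "wp W build s' (\<lambda>out t s''. out = [] \<and> t \<le> 2500 * (S * S) \<and> block_state s'' \<and> ?Z s''
      \<and> test_frame s s'' \<and> input_in (enc_instance (graph_of s) five_arcs) s'')"
    if "block_state s'" "?Z s'" "test_frame s s'" for s'
  proof (rule wp_mono[OF wp_build[OF that(1)]], goal_cases)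
    case (1 out t s'')
    then have f: "frame {ri, rk, rj, ru, rm} {1} s' s''" by simp
    then have "?Z s''" using that(2) by (auto simp: frame_def)
    moreover have "graph_of s' = graph_of s" by (rule graph_of_frame[OF that(3)]) auto
    ultimately show ?case using 1 test_frame[OF that(3) f] by simp
  qed
  have step3: "wp W (embed pre) s' (\<lambda>out t s''. out = [] \<and> t \<le> 20 * TP + 100 \<and> idle TP s''
      \<and> serving s'' ?D (all_requests 0) \<and> test_frame s s'')"
    if "block_state s'" "?Z s'" "test_frame s s'" "input_in (enc_instance (graph_of s) five_arcs) s'" for s'
  proof -
    obtain tr g where g: "exec V pre (start (enc_instance (graph_of s) five_arcs)) tr g" "emitted tr = []"
      "length tr \<le> TP" "serves \<sigma> N V upd enm five_arcs bu bd ?D g (all_requests 0)"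
      using solves[of "graph_of s"] adjacency_over_layers[OF \<sigma>_pos] by fastforce
    have hosts: "hosts (start (enc_instance (graph_of s) five_arcs)) s'"
      using that(2) by (simp add: hosts_def start_def)
    have input: "input_in (inp (start (enc_instance (graph_of s) five_arcs))) s'"
      using that(4) by (simp add: start_def)
    have idle: "idle 0 s'" using that(1,2) by (auto simp: idle_def logged_def)
    show ?thesis
    proof (rule wp_mono[OF wp_hosted[OF g(1) hosts input _ g(3)]], goal_cases)
      case (3 out t s'')
      then have c: "called pre TP s' out t s''" by simp
      have "serving s'' ?D (all_requests 0)" using 3 g(4) unfolding serving_def by blast
      then show ?case using idle_called[OF c idle] frame_trans[OF that(3)] c by (simp add: called_def)
    qed (use that log_le in auto)
  qed
  have step4: "wp W (ryes ::= Num 0) s' (\<lambda>out t s''. out = [] \<and> t \<le> 2 \<and> idle TP s''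
      \<and> serving s'' ?D (all_requests 0) \<and> test_frame s s'' \<and> regs s'' ryes = 0)"
    if "idle TP s'" "serving s' ?D (all_requests 0)" "test_frame s s'" for s'
    by (rule wp_Assign) (use that in \<open>auto simp: idle_set_reg serving_def hosts_def frame_set_reg idle_def\<close>)
  let ?body = "call_update upd 0 (Num 0) (node 0 ri) ;; call_update upd 0 (node 3 ri) (Num 1) ;;
        rfound ::= Num 0 ;; embed enm ;; ryes ::= Bin BitOr (Var ryes) (Var rfound) ;;
        call_update upd 1 (Num 0) (node 0 ri) ;; call_update upd 1 (node 3 ri) (Num 1)"
  have step5: "wp W (loop ri ?body) s' (\<lambda>out t s''. out = [] \<and> t \<le> S * (row_time + 50) + 50
      \<and> idle log_size s'' \<and> test_frame s s'' \<and> regs s'' ryes = of_bool (\<exists>i<S. hit s i))"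
    if "idle TP s'" "serving s' ?D (all_requests 0)" "test_frame s s'" "regs s' ryes = 0" for s'
  proof (rule wp_loop[where T = row_time and P = "\<lambda>m s''. idle (TP + m * row_log) s''
        \<and> serving s'' ?D (all_requests m) \<and> test_frame s s'' \<and> regs s'' ri = m
        \<and> regs s'' ryes = of_bool (\<exists>i<m. hit s i)"], goal_cases)
    case 1
    then show ?case using that by (simp add: idle_def)
  next
    case 3
    then show ?case using that by (auto simp: idle_set_reg serving_def hosts_def frame_set_reg)
  next
    case (4 m s'')
    then show ?case by (auto simp: idle_def)
  next
    case (5 m s'')
    have "TP + Suc m * row_log \<le> TP + S * row_log" using 5(1) by (intro add_left_mono mult_le_mono1) simp
    also have "\<dots> \<le> B" using log_le by (simp add: row_log_def)
    finally have L: "TP + m * row_log + row_log \<le> B" by (simp add: algebra_simps)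
    have ex: "(\<exists>i<Suc m. hit s i) \<longleftrightarrow> (\<exists>i<m. hit s i) \<or> hit s m" by (auto simp: less_Suc_eq)
    have eq: "idle (TP + m * row_log) s''" "serving s'' ?D (row_requests m @ all_requests (Suc m))"
      "regs s'' ri = m" "regs s'' ryes = of_bool (\<exists>i<m. hit s i)" "test_frame s s''"
      using 5 all_requests_step[OF 5(1)] by simp_all
    show ?case
    proof (rule wp_mono[OF wp_test_row[OF eq(1) L eq(2,3) 5(1) eq(4)]], goal_cases)
      case (1 out t s3)
      then have i: "idle (TP + Suc m * row_log) s3" by (simp add: algebra_simps)
      moreover have "test_frame s s3" using frame_trans[OF eq(5)] 1 by simp
      moreover have "bounded B s3" using i by (simp add: idle_def)
      ultimately show ?case using 1 5(1) small
        by (auto simp: idle_set_reg serving_def hosts_def frame_set_reg ex simp del: mult_Suc)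
    qed
  next
    case (6 t s'')
    then show ?case by (auto simp: log_size_def)
  qed simp
  show ?thesis unfolding test_blocks_def
    apply (rule wp_bind[OF step1], elim conjE)
    apply (rule wp_bind[OF step2], assumption, intro conjI, assumption+, elim conjE)
    apply (rule wp_bind[OF step3], assumption, intro conjI, assumption+, elim conjE)
    apply (rule wp_bind[OF step4], assumption+, elim conjE)
    apply (rule wp_mono[OF step5], assumption+, elim conjE)
    apply (simp add: test_time_def)
    done
qed

section \<open>The triple loop: correctness and amortized cost\<close>

definition ones :: "(nat \<Rightarrow> nat) \<Rightarrow> (nat \<times> nat) set" where
  "ones C = {(i, j). i < n \<and> j < n \<and> C (i * n + j) \<noteq> 0}"

definition multiply_time :: nat where
  "multiply_time = 800 * (S * S * S) + 10"

definition potential :: "(nat \<Rightarrow> nat) \<Rightarrow> nat" where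
  "potential C = multiply_time * card (ones C)"

lemma ones_subset: "ones C \<subseteq> {..<n} \<times> {..<n}"
  by (auto simp: ones_def)

lemma finite_ones [simp]: "finite (ones C)"
  using finite_subset[OF ones_subset] by simp

lemma potential_le: "potential C \<le> multiply_time * (n * n)"
  using card_mono[OF _ ones_subset[of C]] by (simp add: potential_def card_cartesian_product)

text \<open>\<open>sound\<close> excludes false ones and \<open>covers\<close> excludes missing
  ones; for the set of all triples the two together determine the product.\<close>

definition sound :: "ram \<Rightarrow> bool" where
  "sound s \<longleftrightarrow> (\<forall>i<n. \<forall>j<n. lane 3 s (i * n + j) = 0 \<or> lane 3 s (i * n + j) = 1 \<and> mat_mul n A A' i j)"

text \<open>\<open>P\<close> collects the index triples already treated, so that the progress of the
  three loops is described by growing sets.\<close>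

definition covers :: "ram \<Rightarrow> (nat \<Rightarrow> nat \<Rightarrow> nat \<Rightarrow> bool) \<Rightarrow> bool" where
  "covers s P \<longleftrightarrow> (\<forall>i<n. \<forall>k<n. \<forall>j<n. P i k j \<longrightarrow> A i k \<longrightarrow> A' k j \<longrightarrow> (i, j) \<in> ones (lane 3 s))"

definition triple_com :: com where
  "triple_com = (test_blocks pre upd enm ;; If (Var ryes) multiply_blocks Skip)"

definition work :: "ram \<Rightarrow> bool" where
  "work s \<longleftrightarrow> idle log_size s \<and> sound s"

text \<open>If no row is hit, every one of the block product is already in C and skipping the
  multiplication loses nothing. If some row is hit, the multiplication creates at least one new one,
  and the gain of potential pays for it.\<close>

lemma wp_triple:
  assumes "work s"
  shows "wp W triple_com s (\<lambda>out t s'. out = [] \<and> t + potential (lane 3 s) \<le> test_time + 10 + potential (lane 3 s')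
    \<and> work s' \<and> regs s' rI = regs s rI \<and> regs s' rK = regs s rK \<and> regs s' rJ = regs s rJ
    \<and> ones (lane 3 s) \<subseteq> ones (lane 3 s')
    \<and> covers s' (\<lambda>i k j. regs s rI \<le> i \<and> i < regs s rI + S \<and> regs s rK \<le> k \<and> k < regs s rK + S
        \<and> regs s rJ \<le> j \<and> j < regs s rJ + S))"
  unfolding triple_com_def
proof (rule wp_bind[OF wp_test_blocks], goal_cases)
  case 1
  then show ?case using assms by (simp add: work_def)
next
  case (2 out t s1)
  let ?P = "\<lambda>i k j. regs s rI \<le> i \<and> i < regs s rI + S \<and> regs s rK \<le> k \<and> k < regs s rK + S
        \<and> regs s rJ \<le> j \<and> j < regs s rJ + S"
  from 2 have s1: "out = []" "t \<le> test_time" "idle log_size s1" "test_frame s s1"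
    "regs s1 ryes = of_bool (\<exists>i<S. hit s i)" by blast+
  have same: "regs s1 rI = regs s rI" "regs s1 rK = regs s rK" "regs s1 rJ = regs s rJ" "lane 3 s1 = lane 3 s"
    using s1(4) by (auto simp: frame_def)
  have hit: "hit s1 = hit s" by (rule graph_of_frame[OF s1(4)]) auto
  have bs: "block_state s1" using s1(3) by (simp add: idle_def)
  have sound1: "sound s1" using assms same by (simp add: work_def sound_def)
  have local: "block_A s1 (i - regs s rI) (k - regs s rK) \<and> block_B s1 (k - regs s rK) (j - regs s rJ)
      \<and> i - regs s rI < S \<and> k - regs s rK < S \<and> j - regs s rJ < S"
    if "?P i k j" "i < n" "k < n" "j < n" "A i k" "A' k j" for i k j
    using that same by (auto simp: block_A_def block_B_def)
  show ?case
  proof (rule wp_If, goal_cases)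
    case 4
    then obtain i0 where i0: "i0 < S" "hit s1 i0" using s1(5) hit by (auto split: if_splits)
    then obtain k0 j0 where hit0: "k0 < S" "j0 < S" "block_A s1 i0 k0" "block_B s1 k0 j0" "block_not_C s1 j0 i0"
      by (auto simp: hit_def)
    let ?X = "{(regs s1 rI + i, regs s1 rJ + j) |i j. i < S \<and> j < S \<and> (\<exists>k<S. block_A s1 i k \<and> block_B s1 k j)}"
    show ?case
    proof (rule wp_mono[OF wp_multiply_blocks[OF bs]], goal_cases)
      case (1 out' t' s2)
      then have s2: "out' = []" "t' \<le> 800 * (S * S * S)" "block_state s2" "frame {ri, rk, rj} {3} s1 s2"
        "set_ones s1 s2 ?X" by blast+
      have regs2: "regs s2 rI = regs s1 rI" "regs s2 rK = regs s1 rK" "regs s2 rJ = regs s1 rJ"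
        using s2(4) by (auto simp: frame_def)
      have one: "lane 3 s2 (i * n + j) = (if (i, j) \<in> ?X then 1 else lane 3 s1 (i * n + j))"
        if "i < n" "j < n" for i j
        using s2(5) that unfolding set_ones_def by blast
      have "idle log_size s2" using s1(3) s2(3,4) by (auto simp: idle_def frame_def logged_def)
      moreover have "sound s2"
        unfolding sound_def
      proof (intro allI impI)
        fix i j assume ij: "i < n" "j < n"
        show "lane 3 s2 (i * n + j) = 0 \<or> lane 3 s2 (i * n + j) = 1 \<and> mat_mul n A A' i j"
        proof (cases "(i, j) \<in> ?X")
          case True
          then have "mat_mul n A A' i j" by (auto simp: mat_mul_def block_A_def block_B_def)
          moreover have "lane 3 s2 (i * n + j) = 1" using one[OF ij] True by (simp only: if_True)
          ultimately show ?thesis by simp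
        next
          case False
          then have "lane 3 s2 (i * n + j) = lane 3 s1 (i * n + j)" using one[OF ij] by (simp only: if_False)
          then show ?thesis using sound1 ij unfolding sound_def by simp
        qed
      qed
      moreover have sub: "ones (lane 3 s1) \<subseteq> ones (lane 3 s2)"
        using one by (auto simp: ones_def)
      moreover have "covers s2 ?P"
        unfolding covers_def
      proof (intro allI impI)
        fix i k j assume as: "i < n" "k < n" "j < n" "?P i k j" "A i k" "A' k j"
        note l = local[OF as(4,1,2,3,5,6)]
        have "(regs s1 rI + (i - regs s rI), regs s1 rJ + (j - regs s rJ)) \<in> ?X" using l by blast
        then have "(i, j) \<in> ?X" using as(4) same by simp
        then show "(i, j) \<in> ones (lane 3 s2)" using one[OF as(1,3)] as by (simp add: ones_def)
      qed
      \<comment> \<open>The witness of the hit was a zero of C and is now a one.\<close>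
      moreover have "card (ones (lane 3 s1)) < card (ones (lane 3 s2))"
      proof (rule psubset_card_mono)
        let ?i = "regs s1 rI + i0" and ?j = "regs s1 rJ + j0"
        have n: "?i < n" "?j < n" "lane 3 s1 (?i * n + ?j) = 0"
          using hit0(5) by (auto simp: block_not_C_def)
        have "(?i, ?j) \<in> ?X" using hit0 i0 by blast
        then have "(?i, ?j) \<in> ones (lane 3 s2)" using one[OF n(1,2)] n by (simp add: ones_def)
        moreover have "(?i, ?j) \<notin> ones (lane 3 s1)" using n by (simp add: ones_def)
        ultimately show "ones (lane 3 s1) \<subset> ones (lane 3 s2)" using sub by blast
      qed simp
      then have "multiply_time * Suc (card (ones (lane 3 s1))) \<le> multiply_time * card (ones (lane 3 s2))"
        by (intro mult_le_mono2) simp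
      then have "multiply_time + potential (lane 3 s1) \<le> potential (lane 3 s2)"
        by (simp add: potential_def)
      ultimately show ?case using s1(1,2) s2(1,2) same regs2 by (simp add: work_def multiply_time_def)
    qed
  next
    case 5
    then have no: "\<not> hit s1 i" if "i < S" for i using s1(5) hit that by (auto split: if_splits)
    have "covers s1 ?P"
      unfolding covers_def
    proof (intro allI impI)
      fix i k j assume as: "i < n" "k < n" "j < n" "?P i k j" "A i k" "A' k j"
      note l = local[OF as(4,1,2,3,5,6)]
      \<comment> \<open>The position is inside the matrix, so the failure of this predicate means
        that the entry of C is already nonzero.\<close>
      have "\<not> block_not_C s1 (j - regs s rJ) (i - regs s rI)" using l no by (auto simp: hit_def)
      then show "(i, j) \<in> ones (lane 3 s1)" using as same by (auto simp: block_not_C_def ones_def)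
    qed
    then show ?case using s1 same sound1 by (intro wp_Skip) (simp add: work_def)
  qed (use bs in auto)
qed

text \<open>The ceiling of n / S.\<close>

definition block_count :: nat where
  "block_count = (n + S - 1) div S"

lemma block_count: "n \<le> block_count * S" "m < block_count \<Longrightarrow> m * S < n" "block_count * S \<le> n + S"
proof -
  define r where "r = (n + S - 1) mod S"
  have "n + S - 1 = block_count * S + r" "r < S"
    using S_pos by (auto simp: block_count_def r_def)
  then have eq: "block_count * S + r + 1 = n + S" and r: "r < S" using S_pos by auto
  show "n \<le> block_count * S" "block_count * S \<le> n + S" using eq r by linarith+
  assume "m < block_count"
  then have "Suc m * S \<le> block_count * S" by (intro mult_le_mono1) simp
  then show "m * S < n" using eq r by simp
qed

text \<open>Nested instances of the bound in \<open>wp_upto\<close>. The innermost 60 contains an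
  allowance of 10 steps for the conditional around the multiplication.\<close>

definition J_time :: nat where "J_time = block_count * (60 + test_time) + 50"
definition K_time :: nat where "K_time = block_count * (J_time + 50) + 50"
definition I_time :: nat where "I_time = block_count * (K_time + 50) + 50"

lemma work_bounded: "work s \<Longrightarrow> bounded B s"
  by (simp add: work_def idle_def)

lemma work_regs: "work s \<Longrightarrow> regs s 0 = n" "work s \<Longrightarrow> regs s 1 = S" "work s \<Longrightarrow> regs s (Suc 0) = S"
  by (simp_all add: work_def idle_def)

lemma work_set_reg: "work s \<Longrightarrow> x \<in> {rI, rK, rJ, ri, rj} \<Longrightarrow> v \<le> B \<Longrightarrow> work (set_reg x v s)"
  unfolding work_def sound_def using idle_set_reg[of log_size s x v] by auto

lemma covers_set_reg [simp]: "covers (set_reg x v s) P = covers s P"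
  by (simp add: covers_def)

lemma covers_mono:
  "covers s P \<Longrightarrow> ones (lane 3 s) \<subseteq> ones (lane 3 s') \<Longrightarrow> (\<And>i k j. i < n \<Longrightarrow> k < n \<Longrightarrow> j < n \<Longrightarrow> P' i k j \<Longrightarrow> P i k j) \<Longrightarrow> covers s' P'"
  unfolding covers_def by blast

lemma covers_or: "covers s P \<Longrightarrow> covers s P' \<Longrightarrow> covers s (\<lambda>i k j. P i k j \<or> P' i k j)"
  unfolding covers_def by blast

text \<open>A block register ends at \<open>block_count * S\<close>, which may exceed
  \<open>n\<close>, but by less than \<open>S\<close>.\<close>

lemma step_le: "m < block_count \<Longrightarrow> m * S + S \<le> B"
  using block_count(2)[of m] small by linarith

text \<open>\<open>P\<close> hands through what the surrounding loops have covered. The loop adds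
  strips of columns until, by \<open>n \<le> block_count * S\<close>, the condition on
  \<open>j\<close> is void.\<close>

lemma wp_blocks_J:
  assumes "work s" "regs s rI = I" "regs s rK = K" "covers s P"
  shows "wp W (upto rJ (Var rn) (Var rs) triple_com) s (\<lambda>out t s'. out = []
    \<and> t + potential (lane 3 s) \<le> J_time + potential (lane 3 s') \<and> work s' \<and> regs s' rI = I \<and> regs s' rK = K
    \<and> covers s' (\<lambda>i k j. P i k j \<or> I \<le> i \<and> i < I + S \<and> K \<le> k \<and> k < K + S))"
proof (rule wp_upto[where M = block_count and N = n and S = S and T = "test_time + 10" and \<Phi> = potential
      and res = "\<lambda>_. []" and P = "\<lambda>m s'. work s' \<and> regs s' rI = I \<and> regs s' rK = K \<and> regs s' rJ = m * S
        \<and> covers s' (\<lambda>i k j. P i k j \<or> I \<le> i \<and> i < I + S \<and> K \<le> k \<and> k < K + S \<and> j < m * S)"], goal_cases)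
  case (8 m s')
  let ?P = "\<lambda>i k j. P i k j \<or> I \<le> i \<and> i < I + S \<and> K \<le> k \<and> k < K + S \<and> j < m * S"
  show ?case
  proof (rule wp_mono[OF wp_triple], goal_cases)
    case (2 out t s'')
    then have sub: "ones (lane 3 s') \<subseteq> ones (lane 3 s'')"
      and new: "covers s'' (\<lambda>i k j. I \<le> i \<and> i < I + S \<and> K \<le> k \<and> k < K + S \<and> m * S \<le> j \<and> j < m * S + S)"
      using 8 by simp_all
    have "covers s'' ?P" using 8 sub by (auto elim: covers_mono)
    from covers_or[OF this new]
    have "covers s'' (\<lambda>i k j. P i k j \<or> I \<le> i \<and> i < I + S \<and> K \<le> k \<and> k < K + S \<and> j < Suc m * S)"
      by (rule covers_mono) auto
    then show ?case using 2 8 step_le[of m]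
      by (auto simp: work_bounded work_regs work_set_reg add.commute)
  qed (use 8 in simp)
next
  case (9 t s')
  have "covers s' (\<lambda>i k j. P i k j \<or> I \<le> i \<and> i < I + S \<and> K \<le> k \<and> k < K + S)"
    using 9(1) block_count(1) by (auto elim!: covers_mono)
  then show ?case using 9 by (simp add: J_time_def)
qed (use assms block_count in \<open>auto simp: work_bounded work_regs work_set_reg elim: covers_mono\<close>)

lemma wp_blocks_K:
  assumes "work s" "regs s rI = I" "covers s P"
  shows "wp W (upto rK (Var rn) (Var rs) (upto rJ (Var rn) (Var rs) triple_com)) s (\<lambda>out t s'. out = []
    \<and> t + potential (lane 3 s) \<le> K_time + potential (lane 3 s') \<and> work s' \<and> regs s' rI = I
    \<and> covers s' (\<lambda>i k j. P i k j \<or> I \<le> i \<and> i < I + S))"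
proof (rule wp_upto[where M = block_count and N = n and S = S and T = J_time and \<Phi> = potential
      and res = "\<lambda>_. []" and P = "\<lambda>m s'. work s' \<and> regs s' rI = I \<and> regs s' rK = m * S
        \<and> covers s' (\<lambda>i k j. P i k j \<or> I \<le> i \<and> i < I + S \<and> k < m * S)"], goal_cases)
  case (8 m s')
  show ?case
  proof (rule wp_mono[OF wp_blocks_J[of s' I "m * S" "\<lambda>i k j. P i k j \<or> I \<le> i \<and> i < I + S \<and> k < m * S"]], goal_cases)
    case (5 out t s'')
    then have "covers s'' (\<lambda>i k j. (P i k j \<or> I \<le> i \<and> i < I + S \<and> k < m * S)
        \<or> I \<le> i \<and> i < I + S \<and> m * S \<le> k \<and> k < m * S + S)" by simp
    then have "covers s'' (\<lambda>i k j. P i k j \<or> I \<le> i \<and> i < I + S \<and> k < Suc m * S)"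
      by (rule covers_mono) auto
    then show ?case using 5 8 step_le[of m]
      by (auto simp: work_bounded work_regs work_set_reg add.commute)
  qed (use 8 in simp_all)
next
  case (9 t s')
  have "covers s' (\<lambda>i k j. P i k j \<or> I \<le> i \<and> i < I + S)"
    using 9(1) block_count(1) by (auto elim!: covers_mono)
  then show ?case using 9 by (simp add: K_time_def)
qed (use assms block_count in \<open>auto simp: work_bounded work_regs work_set_reg elim: covers_mono\<close>)

lemma wp_blocks_I:
  assumes "work s"
  shows "wp W (upto rI (Var rn) (Var rs) (upto rK (Var rn) (Var rs) (upto rJ (Var rn) (Var rs) triple_com))) s
    (\<lambda>out t s'. out = [] \<and> t + potential (lane 3 s) \<le> I_time + potential (lane 3 s') \<and> work s'
      \<and> covers s' (\<lambda>i k j. True))"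
proof (rule wp_upto[where M = block_count and N = n and S = S and T = K_time and \<Phi> = potential
      and res = "\<lambda>_. []" and P = "\<lambda>m s'. work s' \<and> regs s' rI = m * S \<and> covers s' (\<lambda>i k j. i < m * S)"], goal_cases)
  case (8 m s')
  show ?case
  proof (rule wp_mono[OF wp_blocks_K[of s' "m * S" "\<lambda>i k j. i < m * S"]], goal_cases)
    case (4 out t s'')
    then have "covers s'' (\<lambda>i k j. i < m * S \<or> m * S \<le> i \<and> i < m * S + S)" by simp
    then have "covers s'' (\<lambda>i k j. i < Suc m * S)"
      by (rule covers_mono) auto
    then show ?case using 4 8 step_le[of m]
      by (auto simp: work_bounded work_regs work_set_reg add.commute)
  qed (use 8 in simp_all)
next
  case (9 t s')
  have "covers s' (\<lambda>i k j. True)"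
    using 9(1) block_count(1) by (auto elim!: covers_mono)
  then show ?case using 9 by (simp add: I_time_def)
qed (use assms block_count in \<open>auto simp: work_bounded work_regs work_set_reg covers_def\<close>)

lemma entry_eq:
  assumes "work s" "covers s (\<lambda>i k j. True)" "i < n" "j < n"
  shows "lane 3 s (i * n + j) = of_bool (mat_mul n A A' i j)"
proof -
  have "lane 3 s (i * n + j) = 0 \<or> lane 3 s (i * n + j) = 1 \<and> mat_mul n A A' i j"
    using assms(1,3,4) unfolding work_def sound_def by blast
  moreover have "lane 3 s (i * n + j) \<noteq> 0" if "mat_mul n A A' i j"
    using that assms(2-4) by (auto simp: mat_mul_def covers_def ones_def)
  ultimately show ?thesis by auto
qed

lemma wp_output:
  assumes "work s" "covers s (\<lambda>i k j. True)"
  shows "wp W (upto ri (Var rn) (Num 1) (upto rj (Var rn) (Num 1) (Out [Mem (cell_C (Var ri) (Var rj))]))) s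
    (\<lambda>out t s'. out = map (\<lambda>b. [b]) (enc_mat n (mat_mul n A A')) \<and> t \<le> n * (n * 100 + 100) + 50)"
proof -
  have nB: "m < n \<Longrightarrow> Suc m \<le> B" for m using small by linarith
  let ?row = "\<lambda>i. concat (map (\<lambda>j. [[of_bool (mat_mul n A A' i j) :: nat]]) [0..<n])"
  have row: "wp W (upto rj (Var rn) (Num 1) (Out [Mem (cell_C (Var ri) (Var rj))])) s'
    (\<lambda>out t s''. out = ?row i \<and> t \<le> n * 100 + 50 \<and> work s'' \<and> covers s'' (\<lambda>i k j. True) \<and> regs s'' ri = i)"
    if "work s'" "covers s' (\<lambda>i k j. True)" "regs s' ri = i" "i < n" for s' i
  proof (rule wp_upto[where M = n and N = n and S = 1 and T = 20 and \<Phi> = "\<lambda>_. 0"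
      and res = "\<lambda>j. [[of_bool (mat_mul n A A' i j)]]"
      and P = "\<lambda>m s''. work s'' \<and> covers s'' (\<lambda>i k j. True) \<and> regs s'' ri = i \<and> regs s'' rj = m"], goal_cases)
    case (8 j s'')
    have "val s'' (Mem (cell_C (Var ri) (Var rj))) = lane 3 s'' (i * n + j)"
      using 8 by (simp add: cell_C_def lane_def work_regs)
    also have "\<dots> = of_bool (mat_mul n A A' i j)" using 8 that(4) by (intro entry_eq) auto
    finally have v: "val s'' (Mem (cell_C (Var ri) (Var rj))) = of_bool (mat_mul n A A' i j)" .
    show ?case
      by (rule wp_Out, unfold v)
        (use 8 nB[of j] B_ge in \<open>auto simp: work_bounded work_set_reg cell_C_def\<close>)
  qed (use that B_ge small in \<open>auto simp: work_bounded work_regs work_set_reg\<close>)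
  have out: "concat (map ?row [0..<n]) = map (\<lambda>b. [b]) (enc_mat n (mat_mul n A A'))"
  proof -
    have "?row i = map (\<lambda>b. [b]) (enc_vec n (mat_mul n A A' i))" for i
      by (induction n) (auto simp: enc_vec_def)
    then show ?thesis by (simp add: enc_mat_def map_concat o_def)
  qed
  show ?thesis
  proof (rule wp_upto[where M = n and N = n and S = 1 and T = "n * 100 + 50" and \<Phi> = "\<lambda>_. 0" and res = ?row
      and P = "\<lambda>m s''. work s'' \<and> covers s'' (\<lambda>i k j. True) \<and> regs s'' ri = m"], goal_cases)
    case (8 i s')
    then show ?case using nB[of i]
      by (intro wp_mono[OF row[of s' i]]) (auto simp: work_bounded work_set_reg B_ge)
  next
    case (9 t s')
    then show ?case unfolding out by (simp add: algebra_simps)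
  qed (use assms B_ge small in \<open>auto simp: work_bounded work_regs work_set_reg\<close>)
qed

definition total_time :: nat where
  "total_time = I_time + multiply_time * (n * n) + n * (n * 100 + 100) + 30 * S + 200"

text \<open>The two assumptions make \<open>S\<close> the least positive side whose fourth power is
  at least \<open>n\<close>, which is what the search loop computes.\<close>

lemma wp_bmm_via:
  assumes S: "n \<le> S * S * S * S" "\<And>r. 1 \<le> r \<Longrightarrow> r < S \<Longrightarrow> r * r * r * r < n"
  shows "wp W (bmm_via pre upd enm) (start (n # enc_mat n A @ enc_mat n A'))
    (\<lambda>out t s'. out = map (\<lambda>b. [b]) (enc_mat n (mat_mul n A A')) \<and> t \<le> total_time)"
proof -
  let ?cond = "Var rs *\<^sub>e Var rs *\<^sub>e Var rs *\<^sub>e Var rs <\<^sub>e Var rn" and ?inc = "rs ::= Var rs +\<^sub>e Num 1"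
  let ?init = "start (n # enc_mat n A @ enc_mat n A')"
  let ?side = "\<lambda>r. set_reg rs r (set_reg rn n ?init)"
  have "v \<le> 1" if "v \<in> set (enc_mat n M)" for v M
    using that by (auto simp: enc_mat_def enc_vec_def)
  then have s0: "bounded B ?init" using B_ge small by (fastforce simp: bounded_def start_def)
  then have bounded: "bounded B (?side r)" if "r \<le> S" for r
    using that small by simp
  have side: "wp W (While ?cond ?inc) (?side r) (\<lambda>out t s'. out = [] \<and> t \<le> (S - r) * 30 + 20 \<and> s' = ?side S)"
    if "1 \<le> r" "r \<le> S" for r
    using that
  proof (induction "S - r" arbitrary: r)
    case 0
    then have "r = S" by simp
    then show ?case using S(1) bounded B_ge by (intro wp_While_false) auto
  next
    case (Suc d)
    then have r: "r < S" by simp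
    have inc: "set_reg rs (val (?side r) (Var rs +\<^sub>e Num 1)) (?side r) = ?side (r + 1)"
      by (simp add: set_reg_def)
    have eq: "S - r = Suc (S - Suc r)" using r by simp
    show ?case
    proof (rule wp_While_true[OF _ _ _ _ wp_Assign])
      show "wp W (While ?cond ?inc) (set_reg rs (val (?side r) (Var rs +\<^sub>e Num 1)) (?side r))
        (\<lambda>out' t' s''. [] @ out' = [] \<and> Suc (cost ?cond + Suc (cost (Var rs +\<^sub>e Num 1)) + t') \<le> (S - r) * 30 + 20 \<and> s'' = ?side S)"
        unfolding inc by (rule wp_mono[OF Suc.hyps(1)]) (use Suc.hyps(2) Suc.prems r eq in auto)
    qed (use Suc.prems r S(2)[of r] bounded B_ge in auto)
  qed
  have work: "work (?side S)"
  proof -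
    have "block_state (?side S)"
      using bounded[of S] unfolding block_state_def by (simp add: start_def)
    moreover have "hosted_regs (?side S) = (\<lambda>_. 0)" "lane k (?side S) = (\<lambda>_. 0)" "regs (?side S) rlog = 0" for k
      by (auto simp: lane_def start_def hosted_regs_def)
    ultimately show ?thesis
      unfolding work_def idle_def logged_def sound_def by simp
  qed
  have t1: "wp W (rn ::= Inp (Num 0)) ?init (\<lambda>out t s'. out = [] \<and> t \<le> 10 \<and> s' = set_reg rn n ?init)"
    by (rule wp_Assign) (use s0 in \<open>auto simp: start_def\<close>)
  have t2: "wp W (rs ::= Num 1) (set_reg rn n ?init) (\<lambda>out t s'. out = [] \<and> t \<le> 10 \<and> s' = ?side 1)"
    by (rule wp_Assign) (use s0 B_ge small in auto)
  \<comment> \<open>The potential leaves the time bound here: C can never contain more than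
    \<open>n * n\<close> ones.\<close>
  have pot: "t \<le> I_time + multiply_time * (n * n)"
    if "t + potential C \<le> I_time + potential C'" for t C C'
    using that potential_le[of C'] by linarith
  have small_S: "(S - 1) * 30 + 20 \<le> 30 * S + 20" by simp
  show ?thesis
    unfolding bmm_via_def triple_com_def[symmetric]
    apply (rule wp_bind[OF t1], elim conjE, hypsubst)
    apply (rule wp_bind[OF t2], elim conjE, hypsubst)
    apply (rule wp_bind[OF side], simp, rule S_pos, elim conjE, hypsubst)
    apply (rule wp_bind[OF wp_blocks_I[OF work]], elim conjE, hypsubst)
    apply (rule wp_mono[OF wp_output], assumption+, elim conjE)
    apply (drule pot)
    apply (simp add: total_time_def)
    done
qed

end

section \<open>Online matrix-vector multiplication with Enum\<close>

definition three_arcs :: rpq where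
  "three_arcs = Cat (Sym 0) (Cat (Sym 0) (Sym 0))"

lemma lang_three_arcs: "lang three_arcs = {[0, 0, 0]}"
  by (auto simp: three_arcs_def)

definition mat_arcs :: "nat \<Rightarrow> bmat \<Rightarrow> nat \<Rightarrow> arc set" where
  "mat_arcs n M m = {(2 + i, 0, 2 + n + j) |i j. i < m \<and> j < n \<and> M i j}"

text \<open>The set \<open>J\<close> describes a partially loaded vector: an initial segment of the
  columns while arcs are inserted, a final one while they are deleted.\<close>

definition vec_arcs :: "nat \<Rightarrow> bvec \<Rightarrow> nat set \<Rightarrow> arc set" where
  "vec_arcs n v J = {(2 + n + j, 0, 1) |j. j \<in> J \<and> v j}"

definition column_level :: "nat \<Rightarrow> nat \<Rightarrow> nat" where
  "column_level n u = (if u = 0 then 0 else if u = 1 then 3 else if u < 2 + n then 1 else 2)"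

lemma answers_three_arcs:
  fixes n i :: nat and M :: bmat and v :: bvec
  defines "D \<equiv> ({..<2 + 2 * n}, insert (0, 0, 2 + i) (mat_arcs n M n \<union> vec_arcs n v {..<n}))"
  assumes "i < n"
  shows "answers three_arcs D = (if mat_vec n M v i then {(0, 1)} else {})"
proof -
  have "answers three_arcs D = (if labelled_path D 0 [0, 0, 0] 1 then {(0, 1)} else {})"
    by (rule answers_layered[where lev = "column_level n", OF _ _ _ _ _ _ lang_three_arcs])
      (use \<open>i < n\<close> in \<open>auto simp: D_def column_level_def mat_arcs_def vec_arcs_def split: if_splits\<close>)
  moreover have "labelled_path D 0 [0, 0, 0] 1 \<longleftrightarrow> mat_vec n M v i"
  proof
    assume "labelled_path D 0 [0, 0, 0] 1"
    then obtain a b where path: "(0, 0, a) \<in> snd D" "(a, 0, b) \<in> snd D" "(b, 0, 1) \<in> snd D"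
      by (auto simp: labelled_path_Cons_iff labelled_path_Nil_iff)
    have a: "a = 2 + i" using path(1) by (auto simp: D_def mat_arcs_def vec_arcs_def)
    obtain j where j: "b = 2 + n + j" "j < n" "M i j"
      using path(2) a assms(2) by (auto simp: D_def mat_arcs_def vec_arcs_def)
    have "v j" using path(3) j assms(2) by (auto simp: D_def mat_arcs_def vec_arcs_def)
    then show "mat_vec n M v i" using j by (auto simp: mat_vec_def)
  next
    assume "mat_vec n M v i"
    then obtain j where j: "j < n" "M i j" "v j" by (auto simp: mat_vec_def)
    have "(0, 0, 2 + i) \<in> snd D" "(2 + i, 0, 2 + n + j) \<in> snd D" "(2 + n + j, 0, 1) \<in> snd D" "1 \<in> fst D"
      using j assms(2) by (auto simp: D_def mat_arcs_def vec_arcs_def)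
    then show "labelled_path D 0 [0, 0, 0] 1" unfolding labelled_path_Cons_iff labelled_path_Nil_iff by blast
  qed
  ultimately show ?thesis by simp
qed

text \<open>The log is not used here. Clearing it keeps the addresses of its cells bounded.\<close>
definition fresh_update :: "com \<Rightarrow> nat \<Rightarrow> exp \<Rightarrow> exp \<Rightarrow> com" where
  "fresh_update upd opc e e' = (rlog ::= Num 0 ;; call_update upd opc e e')"

abbreviation (input) "row_node \<equiv> Num 2 +\<^sub>e Var ri"
abbreviation (input) "col_node \<equiv> Num 2 +\<^sub>e Var rn +\<^sub>e Var rj"

definition empty_instance :: "nat list" where
  "empty_instance = enc_instance [] three_arcs"

definition put_empty_instance :: com where
  "put_empty_instance = seqs (map (\<lambda>(i, x). put (Num 0 +\<^sub>e Num i) (Num x))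
     (zip [0..<length empty_instance] empty_instance))"

text \<open>The first loop inserts the nodes, where opcode 2 is the insertion of a node; the second
  inserts the ones of the matrix. These updates count towards the total time, but there are only
  O(n^2) of them, each of time O(n^(1 - eps)) if eps is at most 1.\<close>

definition omv_pre :: "com \<Rightarrow> com \<Rightarrow> com" where
  "omv_pre pre upd =
    (rn ::= Inp (Num 0) ;;
     put_empty_instance ;;
     embed pre ;;
     upto ri (Num 2 +\<^sub>e Num 2 *\<^sub>e Var rn) (Num 1)
       (rlog ::= Num 0 ;; put (Num 0) (Num 2) ;; put (Num 1) (Var ri) ;; embed upd) ;;
     upto ri (Var rn) (Num 1) (upto rj (Var rn) (Num 1)
       (If (Inp (Num 1 +\<^sub>e Var ri *\<^sub>e Var rn +\<^sub>e Var rj)) (fresh_update upd 0 row_node col_node) Skip)))"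

text \<open>The arcs of the vector are removed at the end, so that every round starts from the graph
  of the matrix alone. Likewise, each probe removes its arc before the next row is tried.\<close>

definition omv_rnd :: "com \<Rightarrow> com \<Rightarrow> com" where
  "omv_rnd upd enm =
    (upto rj (Var rn) (Num 1) (If (Inp (Var rj)) (fresh_update upd 0 col_node (Num 1)) Skip) ;;
     upto ri (Var rn) (Num 1)
       (fresh_update upd 0 (Num 0) row_node ;;
        rlog ::= Num 0 ;; rfound ::= Num 0 ;; embed enm ;;
        Out [Var rfound] ;;
        fresh_update upd 1 (Num 0) row_node) ;;
     upto rj (Var rn) (Num 1) (If (Inp (Var rj)) (fresh_update upd 1 col_node (Num 1)) Skip))"

text \<open>The log is cleared before every call, so \<open>log_le\<close> only has to cover single
  calls.\<close>

locale omv = server W B V upd enm three_arcs \<sigma> N TU TD bu bd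
  for W B V upd enm \<sigma> N TU TD bu bd +
  fixes n TP :: nat and M :: bmat and pre :: com
  assumes \<sigma>_pos: "1 \<le> \<sigma>" and N_eq: "N = 2 + 2 * n"
    and n_le: "20 * (n + 1) * (n + 1) \<le> B" and log_le: "TP + TU + 2 * TD + 10 \<le> B"
begin

lemma n_bounds: "20 * n + 20 \<le> B"
proof -
  have "20 * (n * n) + 40 * n + 20 \<le> B" using n_le by (simp add: algebra_simps)
  then show ?thesis by linarith
qed

abbreviation call_frame :: "nat \<Rightarrow> ram \<Rightarrow> ram \<Rightarrow> bool" where
  "call_frame x \<equiv> frame {x, rlog, rfound, 14} {0, 1, 2}"

text \<open>The assumptions on \<open>set_reg rlog 0 s\<close> express that the arguments do not
  depend on the log register, which is overwritten first.\<close>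

lemma wp_fresh_update:
  assumes "serving s D (Update up # reqs)" "allowed \<sigma> N D up" "card (fst (apply_update up D)) \<le> N"
    and "enc_update up = [opc, val s e, 0, val s e']" "opc \<le> 1" "val s e \<le> B" "val s e' \<le> B"
    and "memory_free e" "memory_free e'" "safe B s e" "safe B s e'" "cost e \<le> 10" "cost e' \<le> 10"
    and "val (set_reg rlog 0 s) e = val s e" "val (set_reg rlog 0 s) e' = val s e'"
    and "safe B (set_reg rlog 0 s) e" "safe B (set_reg rlog 0 s) e'"
    and "bounded B s"
  shows "wp W (fresh_update upd opc e e') s (\<lambda>out t s'. out = [] \<and> t \<le> 20 * TU + 250 \<and> bounded B s'
    \<and> serving s' (apply_update up D) reqs \<and> call_frame rlog s s')"
  unfolding fresh_update_def
proof (intro wp_Seq wp_Assign, goal_cases)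
  case 4
  show ?case unfolding val.simps(1)
  proof (rule wp_mono[OF wp_call_update[of "set_reg rlog 0 s" D up reqs]], goal_cases)
    case (16 out t s')
    then show ?case by (auto simp: called_def frame_def)
  qed (use assms B_ge log_le in auto)
qed (use assms in auto)

section \<open>Loading and unloading by loops of conditional updates\<close>

definition cond_requests :: "(nat \<Rightarrow> bool) \<Rightarrow> (nat \<Rightarrow> update) \<Rightarrow> nat \<Rightarrow> request list" where
  "cond_requests p up j = concat (map (\<lambda>j. if p j then [Update (up j)] else []) [j..<n])"

lemma cond_requests_step:
  "j < n \<Longrightarrow> cond_requests p up j = (if p j then [Update (up j)] else []) @ cond_requests p up (Suc j)"
  by (simp add: cond_requests_def upt_conv_Cons)

text \<open>\<open>D j\<close> is the database before iteration \<open>j\<close>. The same loop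
  loads a row of the matrix, loads a vector and unloads it.\<close>

lemma wp_update_loop:
  assumes s: "bounded B s" "regs s rn = n" "serving s (D 0) (cond_requests p up 0 @ reqs)"
    and step: "\<And>j. j < n \<Longrightarrow> p j \<Longrightarrow> allowed \<sigma> N (D j) (up j) \<and> apply_update (up j) (D j) = D (Suc j)"
    and skip: "\<And>j. j < n \<Longrightarrow> \<not> p j \<Longrightarrow> D (Suc j) = D j"
    and nodes: "\<And>j. card (fst (D j)) \<le> N"
    and exps: "\<And>s' j. j < n \<Longrightarrow> call_frame rj s s' \<Longrightarrow> regs s' rj = j \<Longrightarrow> regs s' rn = n \<Longrightarrow>
      safe B s' c \<and> val s' c = of_bool (p j) \<and> safe B s' e \<and> safe B s' e'
      \<and> val s' e \<le> B \<and> val s' e' \<le> B \<and> enc_update (up j) = [opc, val s' e, 0, val s' e']"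
    and costs: "cost c \<le> 20" "cost e \<le> 10" "cost e' \<le> 10" "opc \<le> 1" "memory_free e" "memory_free e'"
  shows "wp W (upto rj (Var rn) (Num 1) (If c (fresh_update upd opc e e') Skip)) s (\<lambda>out t s'. out = []
    \<and> t \<le> n * (350 + 20 * TU) + 50 \<and> bounded B s' \<and> serving s' (D n) reqs \<and> call_frame rj s s')"
proof (rule wp_upto[where M = n and N = n and S = 1 and T = "20 * TU + 300" and \<Phi> = "\<lambda>_. 0" and res = "\<lambda>_. []"
      and P = "\<lambda>j s'. bounded B s' \<and> regs s' rn = n \<and> regs s' rj = j \<and> call_frame rj s s'
        \<and> serving s' (D j) (cond_requests p up j @ reqs)"], goal_cases)
  case (8 j s')
  then have s': "bounded B s'" "regs s' rn = n" "regs s' rj = j" "call_frame rj s s'"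
    "serving s' (D j) (cond_requests p up j @ reqs)" by blast+
  note ex = exps[OF 8(1) s'(4,3,2)]
  \<comment> \<open>\<open>exps\<close> covers all states that agree with \<open>s\<close> up to the
    frame, in particular the one with a cleared log register.\<close>
  have ex': "safe B (set_reg rlog 0 s') e" "safe B (set_reg rlog 0 s') e'"
    "enc_update (up j) = [opc, val (set_reg rlog 0 s') e, 0, val (set_reg rlog 0 s') e']"
    using exps[OF 8(1), of "set_reg rlog 0 s'"] s' frame_set_reg(1)[OF s'(4), of rlog 0] by auto
  have jB: "Suc j \<le> B" using 8(1) n_bounds by simp
  show ?case
  proof (rule wp_If[OF s'(1)], goal_cases)
    case 3
    then have p: "p j" using ex by auto
    have val: "val (set_reg rlog 0 s') e = val s' e" "val (set_reg rlog 0 s') e' = val s' e'"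
      using ex ex' by auto
    have "wp W (fresh_update upd opc e e') s' (\<lambda>out t s''. out = [] \<and> t \<le> 20 * TU + 250 \<and> bounded B s''
      \<and> serving s'' (apply_update (up j) (D j)) (cond_requests p up (Suc j) @ reqs) \<and> call_frame rlog s' s'')"
      by (rule wp_fresh_update)
        (use ex ex' s' step[OF 8(1) p] nodes costs cond_requests_step[OF 8(1), of p up] p val in \<open>auto\<close>)
    then show ?case
    proof (rule wp_mono, goal_cases)
      case (1 out t s'')
      then have fr: "call_frame rlog s' s''" by blast
      then have "call_frame rj s' s''" by (rule frame_mono) auto
      then have "call_frame rj s s''" by (rule frame_trans[OF s'(4)])
      moreover have "regs s'' rn = n" "regs s'' rj = j" using fr s'(2,3) by (simp_all add: frame_def)
      ultimately show ?case using 1 step[OF 8(1) p] costs jB by (auto simp: frame_set_reg)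
    qed
  next
    case 4
    then have p: "\<not> p j" using ex by auto
    then show ?case using s' skip[OF 8(1) p] cond_requests_step[OF 8(1), of p up] costs jB
      by (intro wp_Skip) (auto simp: frame_set_reg)
  qed (use ex costs in auto)
qed (use assms(1-3) B_ge n_bounds in \<open>auto simp: frame_set_reg cond_requests_def\<close>)

abbreviation matrix_db :: db where
  "matrix_db \<equiv> ({..<2 + 2 * n}, mat_arcs n M n)"

definition row_insertions :: "nat \<Rightarrow> request list" where
  "row_insertions m = concat (map (\<lambda>i. cond_requests (M i) (\<lambda>j. InsArc (2 + i) 0 (2 + n + j)) 0) [m..<n])"

definition load_requests :: "request list" where
  "load_requests = map (\<lambda>v. Update (InsNode v)) [0..<2 + 2 * n] @ row_insertions 0"

definition load_time :: nat where
  "load_time = 20 * TP + (2 + 2 * n) * (250 + 20 * TU) + n * (n * (350 + 20 * TU) + 100) + 1000"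

lemma entries_le: "v \<in> set (enc_mat n M) \<Longrightarrow> v \<le> 1" "v \<in> set (enc_vec n w) \<Longrightarrow> v \<le> 1"
  by (auto simp: enc_mat_def enc_vec_def)

lemma wp_load:
  assumes "exec V pre (start empty_instance) tr g" "length tr \<le> TP"
    and "serves \<sigma> N V upd enm three_arcs bu bd (db_of []) g (load_requests @ reqs)"
  shows "wp W (omv_pre pre upd) (start (n # enc_mat n M)) (\<lambda>out t s'. out = [] \<and> t \<le> load_time
    \<and> bounded B s' \<and> regs s' rn = n \<and> serving s' matrix_db reqs)"
proof -
  let ?inp = "n # enc_mat n M" and ?nodes = "\<lambda>m. map (\<lambda>v. Update (InsNode v)) [m..<2 + 2 * n]"
  let ?init = "start ?inp"
  have db: "db_of [] = ({}, {})" by (simp add: db_of_def)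
  have bounded0: "bounded B ?init"
    using entries_le(1) n_bounds by (fastforce simp: bounded_def start_def)
  have step1: "wp W (rn ::= Inp (Num 0)) ?init (\<lambda>out t s'. out = [] \<and> t \<le> 10 \<and> s' = set_reg rn n ?init)"
    by (rule wp_Assign) (use bounded0 in \<open>auto simp: start_def\<close>)
  have list: "empty_instance = [0, 0, 2, 1, 0, 2, 1, 0, 1, 0]"
    by (simp add: empty_instance_def enc_instance_def three_arcs_def)
  have step2: "wp W (put_empty_instance) (set_reg rn n ?init) (\<lambda>out t s'. out = [] \<and> t \<le> 300 \<and> bounded B s'
      \<and> regs s' rn = n \<and> inp s' = ?inp \<and> regs s' rlog = 0 \<and> hosts (start empty_instance) s' \<and> input_in empty_instance s')"
    unfolding put_empty_instance_def
  proof (rule wp_mono[OF wp_puts[of _ 0 empty_instance "Num 0", unfolded add_0]], goal_cases)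
    case (7 out t s')
    then have f: "frame {} {1} (set_reg rn n ?init) s'" by blast
    have "lane 0 ?init = (\<lambda>_. 0)" "hosted_regs ?init = (\<lambda>_. 0)"
      by (auto simp: lane_def start_def hosted_regs_def)
    then have "hosts (start empty_instance) s'" "regs s' rn = n" "inp s' = ?inp" "regs s' rlog = 0"
      using f by (auto simp: frame_def hosts_def start_def)
    then show ?case using 7 by (simp add: list input_in_holds)
  qed (use bounded0 n_bounds in \<open>auto simp: list\<close>)
  \<comment> \<open>The empty database is written as \<open>({..<0}, {})\<close>, the instance for 0
    of the invariant of the next loop.\<close>
  have step3: "wp W (embed pre) s (\<lambda>out t s'. out = [] \<and> t \<le> 20 * TP + 100 \<and> bounded B s'
      \<and> regs s' rn = n \<and> inp s' = ?inp \<and> serving s' ({..<0}, {}) (?nodes 0 @ row_insertions 0 @ reqs))"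
    if "bounded B s" "regs s rn = n" "inp s = ?inp" "regs s rlog = 0" "hosts (start empty_instance) s"
      "input_in empty_instance s" for s
  proof (rule wp_mono[OF wp_hosted[OF assms(1) that(5) _ that(1) assms(2)]], goal_cases)
    case 1
    then show ?case using that(6) by (simp add: start_def)
  next
    case 2
    then show ?case using that(4) log_le by simp
  next
    case (3 out t s')
    then have "serving s' ({..<0}, {}) (?nodes 0 @ row_insertions 0 @ reqs)"
      using assms(3) by (auto simp: serving_def load_requests_def db simp del: upt_Suc)
    then show ?case using 3 that(2,3) by (auto simp: called_def frame_def)
  qed
  have step4: "wp W (upto ri (Num 2 +\<^sub>e Num 2 *\<^sub>e Var rn) (Num 1)
       (rlog ::= Num 0 ;; put (Num 0) (Num 2) ;; put (Num 1) (Var ri) ;; embed upd)) s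
      (\<lambda>out t s'. out = [] \<and> t \<le> (2 + 2 * n) * (250 + 20 * TU) + 50 \<and> bounded B s'
      \<and> regs s' rn = n \<and> inp s' = ?inp \<and> serving s' ({..<2 + 2 * n}, {}) (row_insertions 0 @ reqs))"
    if "bounded B s" "regs s rn = n" "inp s = ?inp"
      "serving s ({..<0}, {}) (?nodes 0 @ row_insertions 0 @ reqs)" for s
  proof (rule wp_upto[where M = "2 + 2 * n" and N = "2 + 2 * n" and S = 1 and T = "20 * TU + 200"
        and \<Phi> = "\<lambda>_. 0" and res = "\<lambda>_. []" and P = "\<lambda>m s'. bounded B s' \<and> regs s' rn = n \<and> regs s' ri = m
        \<and> inp s' = ?inp \<and> serving s' ({..<m}, {}) (?nodes m @ row_insertions 0 @ reqs)"], goal_cases)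
    case (8 m s')
    let ?s = "set_lane 1 1 m (set_lane 1 0 2 (set_reg rlog 0 s'))"
    have s': "bounded B s'" "regs s' rn = n" "regs s' ri = m" "inp s' = ?inp"
      "serving s' ({..<m}, {}) (Update (InsNode m) # ?nodes (Suc m) @ row_insertions 0 @ reqs)"
      using 8 by (simp_all add: upt_conv_Cons del: upt_Suc)
    have mB: "Suc m \<le> B" using 8(1) n_bounds by linarith
    have mN: "Suc m \<le> N" using 8(1) N_eq by linarith
    have "wp W (embed upd) ?s (\<lambda>out t s''. called upd TU ?s out t s'' \<and> regs s'' rfound = regs ?s rfound
        \<and> serving s'' (apply_update (InsNode m) ({..<m}, {})) (?nodes (Suc m) @ row_insertions 0 @ reqs))"
      by (rule wp_update)
        (use s' mN mB B_ge log_le in \<open>auto simp: input_in_def nth_Cons split: nat.splits simp del: upt_Suc\<close>)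
    then have "wp W (embed upd) ?s (\<lambda>out t s''. out = [] \<and> t \<le> 20 * TU + 100 \<and> bounded B s''
        \<and> regs s'' rn = n \<and> regs s'' ri = m \<and> inp s'' = ?inp
        \<and> serving s'' ({..<Suc m}, {}) (?nodes (Suc m) @ row_insertions 0 @ reqs))"
      by (rule wp_mono) (use s' in \<open>auto simp: called_def frame_def lessThan_Suc simp del: upt_Suc\<close>)
    then have "wp W (rlog ::= Num 0 ;; put (Num 0) (Num 2) ;; put (Num 1) (Var ri) ;; embed upd) s'
       (\<lambda>out t s''. out = [] \<and> t \<le> 20 * TU + 200 \<and> bounded B s''
        \<and> regs s'' rn = n \<and> regs s'' ri = m \<and> inp s'' = ?inp
        \<and> serving s'' ({..<Suc m}, {}) (?nodes (Suc m) @ row_insertions 0 @ reqs))"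
      by (intro wp_Seq wp_put wp_Assign)
        (use s' B_ge in \<open>auto elim!: wp_mono simp del: upt_Suc\<close>)
    then show ?case
      by (rule wp_mono) (use mB B_ge in \<open>auto simp del: upt_Suc\<close>)
  next
    case (9 t s')
    then show ?case by simp
  qed (use that B_ge n_bounds in \<open>auto simp del: upt_Suc\<close>)
  have step5: "wp W (upto ri (Var rn) (Num 1) (upto rj (Var rn) (Num 1)
       (If (Inp (Num 1 +\<^sub>e Var ri *\<^sub>e Var rn +\<^sub>e Var rj)) (fresh_update upd 0 row_node col_node) Skip))) s
      (\<lambda>out t s'. out = [] \<and> t \<le> n * (n * (350 + 20 * TU) + 100) + 50 \<and> bounded B s'
      \<and> regs s' rn = n \<and> serving s' matrix_db reqs)"
    if "bounded B s" "regs s rn = n" "inp s = ?inp"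
      "serving s ({..<2 + 2 * n}, {}) (row_insertions 0 @ reqs)" for s
  proof (rule wp_upto[where M = n and N = n and S = 1 and T = "n * (350 + 20 * TU) + 50"
        and \<Phi> = "\<lambda>_. 0" and res = "\<lambda>_. []" and P = "\<lambda>m s'. bounded B s' \<and> regs s' rn = n \<and> regs s' ri = m
        \<and> inp s' = ?inp \<and> serving s' ({..<2 + 2 * n}, mat_arcs n M m) (row_insertions m @ reqs)"], goal_cases)
    case 5
    then show ?case using that n_bounds by (simp add: mat_arcs_def)
  next
    case (8 m s')
    \<comment> \<open>Row \<open>m\<close> with its first \<open>j\<close> entries loaded.\<close>
    let ?D = "\<lambda>j. ({..<2 + 2 * n}, mat_arcs n M m \<union> {(2 + m, 0, 2 + n + j') |j'. j' < j \<and> M m j'})"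
    have D: "?D 0 = ({..<2 + 2 * n}, mat_arcs n M m)" "?D n = ({..<2 + 2 * n}, mat_arcs n M (Suc m))"
      by (auto simp: mat_arcs_def less_Suc_eq)
    have s': "bounded B s'" "regs s' rn = n" "regs s' ri = m" "inp s' = ?inp"
      "serving s' (?D 0) (cond_requests (M m) (\<lambda>j. InsArc (2 + m) 0 (2 + n + j)) 0 @ row_insertions (Suc m) @ reqs)"
      using 8 unfolding D by (simp_all add: row_insertions_def upt_conv_Cons)
    have mB: "Suc m \<le> B" using 8(1) n_bounds by linarith
    show ?case
    proof (rule wp_mono[OF wp_update_loop[of s' ?D, OF s'(1,2,5)]], goal_cases)
      case (1 j)
      then show ?case using 8(1) \<sigma>_pos by (auto simp: mat_arcs_def less_Suc_eq)
    next
      case (2 j)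
      then show ?case by (auto simp: less_Suc_eq)
    next
      case (3 j)
      then show ?case by (simp add: N_eq)
    next
      case (4 s'' j)
      then have "regs s'' ri = m" "inp s'' = ?inp" using s'(3,4) by (simp_all add: frame_def)
      moreover have "m * n + j < n * n" by (rule index_less_square) (use 4 8 in auto)
      ultimately show ?case using 4 8(1) n_bounds by (auto simp: add.assoc)
    next
      case (11 out t s'')
      then have f: "call_frame rj s' s''" by blast
      then have "regs s'' rn = n" "regs s'' ri = m" "inp s'' = ?inp" using s' by (simp_all add: frame_def)
      then show ?case using 11 mB B_ge unfolding D by auto
    qed auto
  next
    case (9 t s')
    then show ?case by (simp add: row_insertions_def algebra_simps)
  qed (use that B_ge n_bounds in \<open>auto simp: mat_arcs_def\<close>)
  show ?thesis
    unfolding omv_pre_def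
    apply (rule wp_bind[OF step1], elim conjE, hypsubst)
    apply (rule wp_bind[OF step2], elim conjE)
    apply (rule wp_bind[OF step3], assumption+, elim conjE)
    apply (rule wp_bind[OF step4], assumption+, elim conjE)
    apply (rule wp_mono[OF step5], assumption+, elim conjE)
    apply (simp add: load_time_def)
    done
qed

section \<open>One round of the online problem\<close>

definition probe_requests :: "nat \<Rightarrow> request list" where
  "probe_requests i = [Update (InsArc 0 0 (2 + i)), Enumerate, Update (DelArc 0 0 (2 + i))]"

definition round_requests :: "bvec \<Rightarrow> request list" where
  "round_requests v = cond_requests v (\<lambda>j. InsArc (2 + n + j) 0 1) 0
     @ concat (map probe_requests [0..<n]) @ cond_requests v (\<lambda>j. DelArc (2 + n + j) 0 1) 0"

definition round_time :: nat where
  "round_time = n * (80 * TU + 40 * TD + 2000) + 200"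

lemma wp_probe:
  assumes "bounded B s" "regs s rn = n" "regs s ri = i" "i < n"
    and "serving s ({..<2 + 2 * n}, mat_arcs n M n \<union> vec_arcs n v {..<n}) (probe_requests i @ reqs)"
  shows "wp W (fresh_update upd 0 (Num 0) row_node ;; rlog ::= Num 0 ;; rfound ::= Num 0 ;; embed enm ;;
        Out [Var rfound] ;; fresh_update upd 1 (Num 0) row_node) s
     (\<lambda>out t s'. out = [[of_bool (mat_vec n M v i)]] \<and> t \<le> 40 * TU + 40 * TD + 900 \<and> bounded B s'
        \<and> regs s' rn = n \<and> regs s' ri = i \<and> inp s' = inp s
        \<and> serving s' ({..<2 + 2 * n}, mat_arcs n M n \<union> vec_arcs n v {..<n}) reqs)"
proof -
  let ?V = "{..<2 + 2 * n}" and ?E = "mat_arcs n M n \<union> vec_arcs n v {..<n}" and ?a = "(0, 0, 2 + i)"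
  have new: "?a \<notin> ?E" by (auto simp: mat_arcs_def vec_arcs_def)
  have call: "wp W (fresh_update upd opc (Num 0) row_node) s1 (\<lambda>out t s'. out = [] \<and> t \<le> 20 * TU + 250
      \<and> bounded B s' \<and> regs s' rn = n \<and> regs s' ri = i \<and> inp s' = inp s \<and> serving s' (?V, E') reqs')"
    if "bounded B s1" "regs s1 rn = n" "regs s1 ri = i" "inp s1 = inp s"
      "serving s1 (?V, E1) (Update up # reqs')" "allowed \<sigma> N (?V, E1) up" "apply_update up (?V, E1) = (?V, E')"
      "enc_update up = [opc, 0, 0, 2 + i]" "opc \<le> 1" for s1 up E1 E' reqs' opc
    by (rule wp_mono[OF wp_fresh_update[OF that(5,6)]])
      (use that \<open>i < n\<close> n_bounds in \<open>auto simp: frame_def N_eq\<close>)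
  have step1: "wp W (fresh_update upd 0 (Num 0) row_node) s (\<lambda>out t s'. out = [] \<and> t \<le> 20 * TU + 250
      \<and> bounded B s' \<and> regs s' rn = n \<and> regs s' ri = i \<and> inp s' = inp s
      \<and> serving s' (?V, insert ?a ?E) (drop 1 (probe_requests i) @ reqs))"
    by (rule call[of _ ?E "InsArc 0 0 (2 + i)"])
      (use assms new \<sigma>_pos in \<open>auto simp: probe_requests_def\<close>)
  have step2: "wp W (rlog ::= Num 0) s1 (\<lambda>out t s'. out = [] \<and> t \<le> 10
      \<and> bounded B s' \<and> regs s' rn = n \<and> regs s' ri = i \<and> inp s' = inp s \<and> regs s' rlog = 0
      \<and> serving s' (?V, insert ?a ?E) (drop 1 (probe_requests i) @ reqs))"
    if "bounded B s1" "regs s1 rn = n" "regs s1 ri = i" "inp s1 = inp s"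
      "serving s1 (?V, insert ?a ?E) (drop 1 (probe_requests i) @ reqs)" for s1
    by (rule wp_Assign) (use that in auto)
  have step3: "wp W (rfound ::= Num 0) s1 (\<lambda>out t s'. out = [] \<and> t \<le> 10
      \<and> bounded B s' \<and> regs s' rn = n \<and> regs s' ri = i \<and> inp s' = inp s \<and> regs s' rlog = 0 \<and> regs s' rfound = 0
      \<and> serving s' (?V, insert ?a ?E) (drop 1 (probe_requests i) @ reqs))"
    if "bounded B s1" "regs s1 rn = n" "regs s1 ri = i" "inp s1 = inp s" "regs s1 rlog = 0"
      "serving s1 (?V, insert ?a ?E) (drop 1 (probe_requests i) @ reqs)" for s1
    by (rule wp_Assign) (use that in auto)
  have step4: "wp W (embed enm) s1 (\<lambda>out t s'. out = [] \<and> t \<le> 40 * TD + 100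
      \<and> bounded B s' \<and> regs s' rn = n \<and> regs s' ri = i \<and> inp s' = inp s
      \<and> regs s' rfound = of_bool (mat_vec n M v i)
      \<and> serving s' (?V, insert ?a ?E) (drop 2 (probe_requests i) @ reqs))"
    if "bounded B s1" "regs s1 rn = n" "regs s1 ri = i" "inp s1 = inp s" "regs s1 rlog = 0" "regs s1 rfound = 0"
      "serving s1 (?V, insert ?a ?E) (drop 1 (probe_requests i) @ reqs)" for s1
  proof (rule wp_mono[OF wp_enumerate])
    show "serving s1 (?V, insert ?a ?E) (Enumerate # drop 2 (probe_requests i) @ reqs)"
      using that(7) by (simp add: probe_requests_def)
    show "answers three_arcs (?V, insert ?a ?E) = (if mat_vec n M v i then {(0, 1)} else {})"
      by (rule answers_three_arcs[OF \<open>i < n\<close>])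
  qed (use that log_le in \<open>auto simp: N_eq called_def frame_def\<close>)
  have step5: "wp W (Out [Var rfound]) s1 (\<lambda>out t s'. out = [[of_bool (mat_vec n M v i)]] \<and> t \<le> 10
      \<and> bounded B s' \<and> regs s' rn = n \<and> regs s' ri = i \<and> inp s' = inp s
      \<and> serving s' (?V, insert ?a ?E) (drop 2 (probe_requests i) @ reqs))"
    if "bounded B s1" "regs s1 rn = n" "regs s1 ri = i" "inp s1 = inp s"
      "regs s1 rfound = of_bool (mat_vec n M v i)"
      "serving s1 (?V, insert ?a ?E) (drop 2 (probe_requests i) @ reqs)" for s1
    by (rule wp_Out) (use that in auto)
  have step6: "wp W (fresh_update upd 1 (Num 0) row_node) s1 (\<lambda>out t s'. out = [] \<and> t \<le> 20 * TU + 250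
      \<and> bounded B s' \<and> regs s' rn = n \<and> regs s' ri = i \<and> inp s' = inp s \<and> serving s' (?V, ?E) reqs)"
    if "bounded B s1" "regs s1 rn = n" "regs s1 ri = i" "inp s1 = inp s"
      "serving s1 (?V, insert ?a ?E) (drop 2 (probe_requests i) @ reqs)" for s1
    by (rule call[of _ "insert ?a ?E" "DelArc 0 0 (2 + i)"])
      (use that new in \<open>auto simp: probe_requests_def\<close>)
  show ?thesis
    apply (rule wp_bind[OF step1], elim conjE)
    apply (rule wp_bind[OF step2], assumption+, elim conjE)
    apply (rule wp_bind[OF step3], assumption+, elim conjE)
    apply (rule wp_bind[OF step4], assumption+, elim conjE)
    apply (rule wp_bind[OF step5], assumption+, elim conjE)
    apply (rule wp_mono[OF step6], assumption+, elim conjE)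
    apply simp
    done
qed

lemma wp_round:
  assumes "bounded B s" "regs s rn = n" "inp s = enc_vec n v" "serving s matrix_db (round_requests v @ reqs)"
  shows "wp W (omv_rnd upd enm) s (\<lambda>out t s'. out = map (\<lambda>b. [b]) (enc_vec n (mat_vec n M v))
    \<and> t \<le> round_time \<and> bounded B s' \<and> regs s' rn = n \<and> serving s' matrix_db reqs)"
proof -
  let ?V = "{..<2 + 2 * n}" and ?E = "\<lambda>J. mat_arcs n M n \<union> vec_arcs n v J"
  let ?del = "cond_requests v (\<lambda>j. DelArc (2 + n + j) 0 1)"
  have mB: "m < n \<Longrightarrow> Suc m \<le> B" for m using n_bounds by linarith
  have empty: "?E {} = mat_arcs n M n" by (simp add: vec_arcs_def)
  have J0: "{..<0::nat} = {}" "{n..<n} = {}" "{0..<n} = {..<n}" by auto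
  have step1: "wp W (upto rj (Var rn) (Num 1) (If (Inp (Var rj)) (fresh_update upd 0 col_node (Num 1)) Skip)) s
    (\<lambda>out t s'. out = [] \<and> t \<le> n * (350 + 20 * TU) + 50 \<and> bounded B s' \<and> regs s' rn = n \<and> inp s' = enc_vec n v
      \<and> serving s' (?V, ?E {..<n}) (concat (map probe_requests [0..<n]) @ ?del 0 @ reqs))"
  proof (rule wp_mono[OF wp_update_loop[of s "\<lambda>j. (?V, ?E {..<j})" v "\<lambda>j. InsArc (2 + n + j) 0 1"
          "concat (map probe_requests [0..<n]) @ ?del 0 @ reqs"]], goal_cases)
    case 3
    then show ?case using assms(4) by (simp add: round_requests_def J0 empty)
  next
    case (4 j)
    then show ?case using \<sigma>_pos by (auto simp: mat_arcs_def vec_arcs_def less_Suc_eq)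
  next
    case (5 j)
    then show ?case by (auto simp: vec_arcs_def less_Suc_eq)
  next
    case (7 s' j)
    then have "inp s' = enc_vec n v" using assms(3) by (simp add: frame_def)
    then show ?case using 7 n_bounds by auto
  next
    case (14 out t s')
    then show ?case using assms(2,3) by (auto simp: frame_def)
  qed (use assms in \<open>auto simp: N_eq\<close>)
  have step2: "wp W (upto ri (Var rn) (Num 1) (fresh_update upd 0 (Num 0) row_node ;; rlog ::= Num 0 ;;
        rfound ::= Num 0 ;; embed enm ;; Out [Var rfound] ;; fresh_update upd 1 (Num 0) row_node)) s1
    (\<lambda>out t s'. out = concat (map (\<lambda>i. [[of_bool (mat_vec n M v i)]]) [0..<n])
      \<and> t \<le> n * (40 * TU + 40 * TD + 950) + 50 \<and> bounded B s' \<and> regs s' rn = n \<and> inp s' = enc_vec n v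
      \<and> serving s' (?V, ?E {..<n}) (?del 0 @ reqs))"
    if "bounded B s1" "regs s1 rn = n" "inp s1 = enc_vec n v"
      "serving s1 (?V, ?E {..<n}) (concat (map probe_requests [0..<n]) @ ?del 0 @ reqs)" for s1
  proof (rule wp_upto[where M = n and N = n and S = 1 and T = "40 * TU + 40 * TD + 900"
        and \<Phi> = "\<lambda>_. 0" and res = "\<lambda>i. [[of_bool (mat_vec n M v i)]]"
        and P = "\<lambda>m s'. bounded B s' \<and> regs s' rn = n \<and> regs s' ri = m \<and> inp s' = enc_vec n v
        \<and> serving s' (?V, ?E {..<n}) (concat (map probe_requests [m..<n]) @ ?del 0 @ reqs)"], goal_cases)
    case (8 m s')
    then have "serving s' (?V, ?E {..<n}) (probe_requests m @ concat (map probe_requests [Suc m..<n]) @ ?del 0 @ reqs)"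
      by (simp add: upt_conv_Cons)
    then show ?case using 8 mB[of m] B_ge
      by (intro wp_mono[OF wp_probe]) auto
  next
    case (9 t s')
    then show ?case by (simp add: algebra_simps)
  qed (use that B_ge n_bounds in auto)
  have step3: "wp W (upto rj (Var rn) (Num 1) (If (Inp (Var rj)) (fresh_update upd 1 col_node (Num 1)) Skip)) s1
    (\<lambda>out t s'. out = [] \<and> t \<le> n * (350 + 20 * TU) + 50 \<and> bounded B s' \<and> regs s' rn = n
      \<and> serving s' matrix_db reqs)"
    if "bounded B s1" "regs s1 rn = n" "inp s1 = enc_vec n v" "serving s1 (?V, ?E {..<n}) (?del 0 @ reqs)" for s1
  proof (rule wp_mono[OF wp_update_loop[of s1 "\<lambda>j. (?V, ?E {j..<n})" v "\<lambda>j. DelArc (2 + n + j) 0 1" reqs]],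
        goal_cases)
    case 3
    then show ?case using that(4) by (simp add: J0)
  next
    case (4 j)
    have "{j..<n} = insert j {Suc j..<n}" using 4(1) by auto
    then have "vec_arcs n v {j..<n} = insert (2 + n + j, 0, 1) (vec_arcs n v {Suc j..<n})"
      using 4(2) by (auto simp: vec_arcs_def)
    moreover have "(2 + n + j, 0, 1) \<notin> vec_arcs n v {Suc j..<n} \<union> mat_arcs n M n"
      by (auto simp: vec_arcs_def mat_arcs_def)
    ultimately show ?case by auto
  next
    case (5 j)
    have "{j..<n} = insert j {Suc j..<n}" using 5(1) by auto
    then show ?case using 5 by (auto simp: vec_arcs_def)
  next
    case (7 s' j)
    then have "inp s' = enc_vec n v" using that(3) by (simp add: frame_def)
    then show ?case using 7 n_bounds by auto
  next
    case (14 out t s')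
    then show ?case using that(2,3) by (auto simp: frame_def J0 empty)
  qed (use that in \<open>auto simp: N_eq\<close>)
  have time: "n * (350 + 20 * TU) + 50 + (n * (40 * TU + 40 * TD + 950) + 50 + (n * (350 + 20 * TU) + 50)) \<le> round_time"
    by (simp add: round_time_def algebra_simps)
  show ?thesis
    unfolding omv_rnd_def
    apply (rule wp_bind[OF step1], elim conjE)
    apply (rule wp_bind[OF step2], assumption+, elim conjE)
    apply (rule wp_mono[OF step3], assumption+, elim conjE)
    using time by (simp add: enc_vec_def)
qed

text \<open>The later vectors occur only in the list of requests that the invariant carries; the
  machine itself sees one vector at a time.\<close>

lemma omv_rounds:
  assumes "bounded B s" "regs s rn = n" "serving s matrix_db (concat (map round_requests vs))"
  shows "\<exists>t \<le> length vs * round_time. omv_rounds W (omv_rnd upd enm) n M s vs t"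
  using assms
proof (induction vs arbitrary: s)
  case Nil
  then show ?case by (auto intro: omv_rounds.nil)
next
  case (Cons v vs)
  let ?s = "s\<lparr>inp := enc_vec n v\<rparr>"
  have "wp W (omv_rnd upd enm) ?s (\<lambda>out t s'. out = map (\<lambda>b. [b]) (enc_vec n (mat_vec n M v))
    \<and> t \<le> round_time \<and> bounded B s' \<and> regs s' rn = n \<and> serving s' matrix_db (concat (map round_requests vs)))"
    by (rule wp_round)
      (use Cons.prems entries_le(2) B_ge in \<open>fastforce simp: bounded_def serving_def hosts_def\<close>)+
  then obtain tr s' where run: "exec W (omv_rnd upd enm) ?s tr s'"
    "emitted tr = map (\<lambda>b. [b]) (enc_vec n (mat_vec n M v))" "length tr \<le> round_time"
    "bounded B s'" "regs s' rn = n" "serving s' matrix_db (concat (map round_requests vs))"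
    by (auto elim: wp_exec)
  obtain t where "t \<le> length vs * round_time" "omv_rounds W (omv_rnd upd enm) n M s' vs t"
    using Cons.IH[OF run(4-6)] by blast
  then show ?case using omv_rounds.cons[OF run(1,2)] run(3)
    by (intro exI[of _ "length tr + t"]) auto
qed

end

section \<open>Running times\<close>

definition ceil_bound :: "real \<Rightarrow> nat" where
  "ceil_bound r = nat \<lceil>r\<rceil>"

lemma ceil_bound_ge: "r \<le> real (ceil_bound r)"
  unfolding ceil_bound_def by linarith

lemma ceil_bound_le: "0 \<le> r \<Longrightarrow> real (ceil_bound r) \<le> r + 1"
  unfolding ceil_bound_def by linarith

lemma ceil_bound_mono: "r \<le> real m \<Longrightarrow> ceil_bound r \<le> m"
  unfolding ceil_bound_def by linarith

text \<open>\<open>c\<close> and \<open>y\<close> may be negative, hence the absolute value. With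
  \<open>min \<epsilon> 1\<close> the exponent is nonnegative because \<open>1 \<le> a\<close>, so
  the power is monotone in \<open>v\<close>.\<close>

lemma powr_bound_le:
  fixes a c y \<epsilon> :: real and v N :: nat
  assumes "v \<le> N" "1 \<le> N" "1 \<le> a"
  shows "c * (real (max 1 v) powr (a - \<epsilon>) * y) \<le> real (ceil_bound \<bar>c * y\<bar>) * real N powr (a - min \<epsilon> 1)"
proof -
  have "real (max 1 v) powr (a - \<epsilon>) \<le> real (max 1 v) powr (a - min \<epsilon> 1)"
    by (rule powr_mono) auto
  also have "\<dots> \<le> real N powr (a - min \<epsilon> 1)"
    using assms by (intro powr_mono2) auto
  finally have p: "real (max 1 v) powr (a - \<epsilon>) \<le> real N powr (a - min \<epsilon> 1)" .
  have "c * (real (max 1 v) powr (a - \<epsilon>) * y) = (c * y) * real (max 1 v) powr (a - \<epsilon>)" by simp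
  also have "\<dots> \<le> \<bar>c * y\<bar> * real (max 1 v) powr (a - \<epsilon>)"
    by (intro mult_right_mono) auto
  also have "\<dots> \<le> real (ceil_bound \<bar>c * y\<bar>) * real N powr (a - min \<epsilon> 1)"
    using p ceil_bound_ge by (intro mult_mono) auto
  finally show ?thesis .
qed

lemma powr_scale_le:
  fixes k x a :: real
  assumes "1 \<le> k" "0 \<le> x" "a \<le> real m"
  shows "(k * x) powr a \<le> k ^ m * x powr a"
proof -
  have "(k * x) powr a = k powr a * x powr a" using assms by (simp add: powr_mult)
  also have "\<dots> \<le> k powr real m * x powr a"
    using assms by (intro mult_right_mono powr_mono) auto
  also have "k powr real m = k ^ m" using assms by (simp add: powr_realpow)
  finally show ?thesis .
qed

lemma powr_le_power: "1 \<le> (x::real) \<Longrightarrow> a \<le> real m \<Longrightarrow> x powr a \<le> x ^ m"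
  using powr_mono[of a "real m" x] by (simp add: powr_realpow)

lemma power_times_powr: "0 < (x::real) \<Longrightarrow> x ^ m * x powr a = x powr (real m + a)"
  by (simp add: powr_add powr_realpow)

lemma power_times_power: "(c * m ^ k) ^ j = c ^ j * (m :: nat) ^ (j * k)"
  by (simp add: power_mult_distrib power_mult[symmetric] mult.commute)

lemma times_power_mono: "c \<le> c' \<Longrightarrow> k \<le> k' \<Longrightarrow> c * (n + 2) ^ k \<le> c' * (n + 2 :: nat) ^ k'"
  by (intro mult_mono power_increasing) auto

text \<open>The load phase and the n rounds together make O(n^2) calls, and a call takes
  O(\<open>TU\<close>), which is O(n^(1 - e)). The single bound \<open>TU\<close> serves for updates
  and delay.\<close>

lemma omv_time_bound:
  fixes n TP TU K :: nat and e :: real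
  assumes "1 \<le> n" "0 < e" "e \<le> 1" "TU = ceil_bound (real K * real (2 + 2 * n) powr (1 - e))"
  shows "real (20 * TP + (2 + 2 * n) * (250 + 20 * TU) + n * (n * (350 + 20 * TU) + 100) + 1000
      + n * (n * (80 * TU + 40 * TU + 2000) + 200))
    \<le> real (20 * TP + 4870 + 880 * K) * real n powr (3 - e)"
proof -
  let ?x = "real n" and ?y = "real n powr (1 - e)"
  have y1: "1 \<le> ?y" using assms by (intro ge_one_powr_ge_zero) auto
  have "real (2 + 2 * n) powr (1 - e) \<le> (4 * ?x) powr (1 - e)"
    using assms by (intro powr_mono2) auto
  also have "\<dots> \<le> 4 ^ 1 * ?y" using assms by (intro powr_scale_le) auto
  finally have "real K * real (2 + 2 * n) powr (1 - e) \<le> real K * (4 * ?y)"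
    by (intro mult_left_mono) auto
  then have TU: "real TU \<le> 4 * real K * ?y + 1"
    using ceil_bound_le[of "real K * real (2 + 2 * n) powr (1 - e)"] unfolding assms(4) by simp
  have n2: "n \<le> n * n" "1 \<le> n * n" using assms(1) by auto
  have nT: "n * TU \<le> n * n * TU" "TU \<le> n * n * TU" using n2 by (simp_all add: mult_le_mono1)
  have nP: "TP \<le> n * n * TP" using n2 by simp
  have "20 * TP + (2 + 2 * n) * (250 + 20 * TU) + n * (n * (350 + 20 * TU) + 100) + 1000
      + n * (n * (80 * TU + 40 * TU + 2000) + 200)
    = 20 * TP + 1500 + 40 * TU + 800 * n + 40 * (n * TU) + 140 * (n * n * TU) + 2350 * (n * n)"
    by (simp add: algebra_simps)
  \<comment> \<open>Every lower term is rounded up to a multiple of \<open>n * n\<close>: 4650 =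
    1500 + 800 + 2350 and 220 = 40 + 40 + 140.\<close>
  also have "\<dots> \<le> 20 * (n * n * TP) + 220 * (n * n * TU) + 4650 * (n * n)"
    using n2 nT nP by linarith
  finally have "real (20 * TP + (2 + 2 * n) * (250 + 20 * TU) + n * (n * (350 + 20 * TU) + 100) + 1000
      + n * (n * (80 * TU + 40 * TU + 2000) + 200)) \<le> real (20 * (n * n * TP) + 220 * (n * n * TU) + 4650 * (n * n))"
    by (rule of_nat_mono)
  also have "\<dots> = ?x\<^sup>2 * (20 * real TP + 4650 + 220 * real TU)"
    by (simp add: algebra_simps power2_eq_square)
  \<comment> \<open>Inserting the bound on \<open>TU\<close> turns 4650 into 4870 = 4650 + 220 and
    contributes \<open>K\<close> times 880 = 4 * 220.\<close>
  also have "\<dots> \<le> ?x\<^sup>2 * (real (20 * TP + 4870 + 880 * K) * ?y)"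
  proof (intro mult_left_mono)
    have "(20 * real TP + 4870) * 1 \<le> (20 * real TP + 4870) * ?y" using y1 by (intro mult_left_mono) auto
    then show "20 * real TP + 4650 + 220 * real TU \<le> real (20 * TP + 4870 + 880 * K) * ?y"
      using TU by (simp add: algebra_simps)
  qed simp
  also have "\<dots> = real (20 * TP + 4870 + 880 * K) * (?x\<^sup>2 * ?y)" by simp
  also have "?x\<^sup>2 * ?y = ?x powr (3 - e)"
    using assms(1) power_times_powr[of ?x 2 "1 - e"] by simp
  finally show ?thesis .
qed

theorem solves_OMv_of_Enum:
  fixes \<sigma> :: nat and f :: "nat \<Rightarrow> real" and \<epsilon> :: real
  assumes \<sigma>: "1 \<le> \<sigma>" and eps: "0 < \<epsilon>"
    and enum: "solves_Enum \<sigma> pre upd enm tp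
      (\<lambda>v l. real (max 1 v) powr (1 - \<epsilon>) * f l) (\<lambda>v l. real (max 1 v) powr (1 - \<epsilon>) * f l)"
  shows "solves_OMv (omv_pre pre upd) (omv_rnd upd enm) (\<lambda>n. real n powr (3 - min \<epsilon> 1))"
proof -
  define l where "l = rpq_length three_arcs"
  define e where "e = min \<epsilon> 1"
  obtain C d :: nat and c :: real where solves: "\<And>ls q N reqs. adjacency_over \<sigma> ls \<Longrightarrow> rpq_over \<sigma> q \<Longrightarrow> length ls \<le> N \<Longrightarrow>
      \<exists>tr s. exec (C * (N + rpq_length q + 2) ^ d) pre (start (enc_instance ls q)) tr s \<and> emitted tr = []
        \<and> real (length tr) \<le> c * tp (length ls) (rpq_length q)
        \<and> serves \<sigma> N (C * (N + rpq_length q + 2) ^ d) upd enm q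
            (\<lambda>v. c * (real (max 1 v) powr (1 - \<epsilon>) * f (rpq_length q)))
            (\<lambda>v. c * (real (max 1 v) powr (1 - \<epsilon>) * f (rpq_length q))) (db_of ls) s reqs"
    using enum unfolding solves_Enum_def Let_def by blast
  define K where "K = ceil_bound \<bar>c * f l\<bar>"
  define TP where "TP = ceil_bound (c * tp 0 l)"
  define TU where "TU n = ceil_bound (real K * real (2 + 2 * n) powr (1 - e))" for n
  \<comment> \<open>The summands meet the demands of the locale: the hosted word bound, where 2 n +
    9 is at most 9 (n + 2), the numerals and the quadratic bound, and the log, with
    \<open>TU\<close> linear in n by \<open>TU_le\<close>. The 2 in the exponent of \<open>B\<close>
    serves the quadratic bound.\<close>
  define C' where "C' = C * 9 ^ d + 50 + TP + 10 * K"
  define B where "B n = C' * (n + 2) ^ (d + 2)" for n :: nat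
  define V where "V n = C * (2 + 2 * n + l + 2) ^ d" for n :: nat
  have l: "l = 5" by (simp add: l_def three_arcs_def)
  have e: "0 < e" "e \<le> 1" using eps by (auto simp: e_def)
  have TU_le: "TU n \<le> 2 * K * (n + 2) ^ 1" for n
  proof -
    have "real (2 + 2 * n) powr (1 - e) \<le> real (2 + 2 * n) ^ 1" using e by (intro powr_le_power) auto
    then have "real K * real (2 + 2 * n) powr (1 - e) \<le> real K * real (2 + 2 * n)"
      by (intro mult_left_mono) auto
    also have "\<dots> \<le> real (2 * K * (n + 2) ^ 1)" by (simp add: algebra_simps)
    finally show ?thesis unfolding TU_def by (rule ceil_bound_mono)
  qed
  have W: "B n ^ 20 = C' ^ 20 * (n + 2) ^ (20 * (d + 2))" for n
    unfolding B_def by (rule power_times_power)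
  have run: "\<exists>tr s t. exec (B n ^ 20) (omv_pre pre upd) (start (n # enc_mat n M)) tr s \<and> emitted tr = []
      \<and> omv_rounds (B n ^ 20) (omv_rnd upd enm) n M s vs t
      \<and> real (length tr + t) \<le> real (20 * TP + 4870 + 880 * K) * real n powr (3 - e)"
    if n: "1 \<le> n" and vs: "length vs = n" for n M and vs :: "bvec list"
  proof -
    let ?b = "\<lambda>v. c * (real (max 1 v) powr (1 - \<epsilon>) * f l)"
    have VB: "V n \<le> C * 9 ^ d * (n + 2) ^ d"
    proof -
      have "(2 + 2 * n + l + 2) ^ d \<le> (9 * (n + 2)) ^ d" using l by (intro power_mono) auto
      then have "C * (2 + 2 * n + l + 2) ^ d \<le> C * (9 * (n + 2)) ^ d" by (rule mult_le_mono2)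
      then show ?thesis by (simp only: V_def power_mult_distrib mult.assoc)
    qed
    have bound: "?b v \<le> real (TU n)" if "v \<le> 2 + 2 * n" for v
      using powr_bound_le[OF that, of 1 c \<epsilon> "f l"] ceil_bound_ge[of "real K * real (2 + 2 * n) powr (1 - e)"]
      unfolding TU_def K_def e_def by simp
    interpret omv "B n ^ 20" "B n" "V n" upd enm \<sigma> "2 + 2 * n" "TU n" "TU n" ?b ?b n TP M pre
    proof unfold_locales
      have "20 * (n + 2) ^ 0 \<le> B n" unfolding B_def by (rule times_power_mono) (auto simp: C'_def)
      then show "20 \<le> B n" by simp
      have "V n \<le> C * 9 ^ d * (n + 2) ^ d" by (rule VB)
      also have "\<dots> \<le> B n" unfolding B_def by (rule times_power_mono) (auto simp: C'_def)
      finally show "V n \<le> B n" .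
      have "20 * (n + 1) * (n + 1) \<le> 20 * (n + 2) ^ 2" by (simp add: power2_eq_square algebra_simps)
      also have "\<dots> \<le> B n" unfolding B_def by (rule times_power_mono) (auto simp: C'_def)
      finally show "20 * (n + 1) * (n + 1) \<le> B n" .
      have "TP + TU n + 2 * TU n + 10 \<le> (TP + 6 * K + 10) * (n + 2) ^ 1"
        using TU_le[of n] by (simp add: algebra_simps)
      also have "\<dots> \<le> B n" unfolding B_def by (rule times_power_mono) (auto simp: C'_def)
      finally show "TP + TU n + 2 * TU n + 10 \<le> B n" .
    qed (use bound \<sigma> in auto)
    have "adjacency_over \<sigma> []" "rpq_over \<sigma> three_arcs" using \<sigma> by (auto simp: adjacency_over_def three_arcs_def)
    \<comment> \<open>The name bound is \<open>2 + 2 * n\<close> although the initial graph is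
      empty; the requests for all \<open>n\<close> vectors are fixed here.\<close>
    from solves[OF this, of "2 + 2 * n" "load_requests @ concat (map round_requests vs)"]
    obtain tr0 g where g: "exec (V n) pre (start empty_instance) tr0 g" "real (length tr0) \<le> c * tp 0 l"
      "serves \<sigma> (2 + 2 * n) (V n) upd enm three_arcs ?b ?b (db_of []) g (load_requests @ concat (map round_requests vs))"
      unfolding V_def l_def empty_instance_def by auto
    have "length tr0 \<le> TP" using g(2) ceil_bound_ge[of "c * tp 0 l"] unfolding TP_def by linarith
    from wp_load[OF g(1) this g(3)] obtain tr s where tr: "exec (B n ^ 20) (omv_pre pre upd) (start (n # enc_mat n M)) tr s"
      "emitted tr = []" "length tr \<le> load_time" "bounded (B n) s" "regs s rn = n"
      "serving s matrix_db (concat (map round_requests vs))"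
      by (auto elim: wp_exec)
    obtain t where t: "t \<le> length vs * round_time" "omv_rounds (B n ^ 20) (omv_rnd upd enm) n M s vs t"
      using omv_rounds[OF tr(4-6)] by blast
    have "length tr + t \<le> load_time + n * round_time" using tr(3) t(1) vs by simp
    then have "real (length tr + t) \<le> real (load_time + n * round_time)" by (rule of_nat_mono)
    also have "\<dots> \<le> real (20 * TP + 4870 + 880 * K) * real n powr (3 - e)"
      using omv_time_bound[OF n e TU_def[of n], of TP] unfolding load_time_def round_time_def by simp
    finally show ?thesis using tr(1,2) t(2) by blast
  qed
  show ?thesis
    unfolding solves_OMv_def Let_def e_def[symmetric]
    by (intro exI[of _ "C' ^ 20"] exI[of _ "20 * (d + 2)"] exI[of _ "real (20 * TP + 4870 + 880 * K)"] allI impI)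
      (use run[unfolded W] in blast)
qed

text \<open>A test costs O(y) with y = x^(3 - e): the preprocessing and O(S) calls of time O(x^(2 -
  e)) are of this size, and building the graph takes O(x^2), which is O(y) because e is at most 1.
  There are b^3, hence O(x^9), tests. The multiplications take O(x^11), which is absorbed by x^(12 -
  e), again because e is at most 1.\<close>

lemma bmm_time_bound:
  fixes n S b K R TP TU :: nat and e x :: real
  defines "T \<equiv> 30 * (TP + S * (4 * TU + 2 * TU + 20)) + 2 * R + 2500 * (S * S) + 20 * TP
      + S * (80 * TU + 40 * TU + 1000 + 50) + 200"
  assumes x: "1 \<le> x" "real n = x ^ 4" and e: "0 < e" "e \<le> 1"
    and S: "real S \<le> 2 * x" and b: "real b \<le> 2 * x ^ 3"
    and TP: "TP = ceil_bound (real K * real (2 + 4 * S) powr (3 - e))"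
    and TU: "TU = ceil_bound (real K * real (2 + 4 * S) powr (2 - e))" and S1: "1 \<le> S"
  shows "real (b * (b * (b * (60 + T) + 50 + 50) + 50 + 50) + 50 + (800 * (S * S * S) + 10) * (n * n)
      + n * (n * 100 + 100) + 30 * S + 200) \<le> real (4000000 * (K + R + 1)) * x powr (12 - e)"
proof -
  let ?y = "x powr (3 - e)"
  have y: "1 \<le> ?y" using x e by (intro ge_one_powr_ge_zero) auto
  have xy: "x \<le> ?y" "x * x \<le> ?y"
    using powr_mono[of 1 "3 - e" x] powr_mono[of 2 "3 - e" x] x e by (simp_all add: power2_eq_square)
  \<comment> \<open>Since S is at least 1, 2 + 4 S is at most 6 S, and S is at most 2 x.\<close>
  have N: "real (2 + 4 * S) \<le> 12 * x" using S S1 by simp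
  have "real (2 + 4 * S) powr (3 - e) \<le> (12 * x) powr (3 - e)" using N e by (intro powr_mono2) auto
  also have "\<dots> \<le> 12 ^ 3 * ?y" using x e by (intro powr_scale_le) auto
  finally have "real K * real (2 + 4 * S) powr (3 - e) \<le> real K * (12 ^ 3 * ?y)" by (intro mult_left_mono) auto
  then have TP_le: "real TP \<le> 1728 * (real K * ?y) + 1"
    using ceil_bound_le[of "real K * real (2 + 4 * S) powr (3 - e)"] unfolding TP by simp
  have "real (2 + 4 * S) powr (2 - e) \<le> (12 * x) powr (2 - e)" using N e by (intro powr_mono2) auto
  also have "\<dots> \<le> 12\<^sup>2 * x powr (2 - e)" using x e by (intro powr_scale_le) auto
  finally have "real K * real (2 + 4 * S) powr (2 - e) \<le> real K * (12\<^sup>2 * x powr (2 - e))"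
    by (intro mult_left_mono) auto
  then have "real TU \<le> 144 * (real K * x powr (2 - e)) + 1"
    using ceil_bound_le[of "real K * real (2 + 4 * S) powr (2 - e)"] unfolding TU by simp
  then have "real S * real TU \<le> (2 * x) * (144 * (real K * x powr (2 - e)) + 1)"
    using S x by (intro mult_mono) auto
  also have "\<dots> = 288 * real K * (x * x powr (2 - e)) + 2 * x" by (simp add: algebra_simps)
  also have "x * x powr (2 - e) = ?y" using x power_times_powr[of x 1 "2 - e"] by simp
  finally have STU: "real S * real TU \<le> 288 * (real K * ?y) + 2 * x" by simp
  have SS: "real S * real S \<le> 4 * (x * x)"
    using mult_mono[OF S S] x by simp
  have "real T = 50 * real TP + 300 * (real S * real TU) + 1650 * real S + 2 * real R + 2500 * (real S * real S) + 200"
    unfolding T_def by (simp add: algebra_simps)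
  also have "\<dots> \<le> 50 * (1728 * (real K * ?y) + 1) + 300 * (288 * (real K * ?y) + 2 * x) + 3300 * x + 2 * real R
      + 10000 * (x * x) + 200"
  proof -
    have "50 * p + 300 * q + 1650 * u + 2 * real R + 2500 * v + 200
        \<le> 50 * p' + 300 * q' + 3300 * u' + 2 * real R + 10000 * v' + 200"
      if "p \<le> p'" "q \<le> q'" "u \<le> 2 * u'" "v \<le> 4 * v'" for p q u v p' q' u' v' :: real
      using that by linarith
    then show ?thesis using TP_le STU S SS by blast
  qed
  \<comment> \<open>172800 = 50 * 1728 + 300 * 288; the constants 50, 600, 3300, 10000 and 200 of
    the other terms add up to less than 14200.\<close>
  also have "\<dots> \<le> 172800 * (real K * ?y) + 2 * (real R * ?y) + 14200 * ?y"
  proof -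
    have "real R * 1 \<le> real R * ?y" using y by (intro mult_left_mono) auto
    then show ?thesis using xy y by simp
  qed
  finally have T: "real T \<le> 172800 * (real K * ?y) + 2 * (real R * ?y) + 14200 * ?y" .
  let ?\<beta> = "2 * x ^ 3"
  have x3: "1 \<le> x ^ 3" using x(1) by (rule one_le_power)
  have \<beta>: "1 \<le> ?\<beta>" "0 \<le> real b" using x3 by auto
  have bb: "real b * real b \<le> ?\<beta> * ?\<beta>" by (intro mult_mono) (use b \<beta> x(1) in auto)
  have bbb: "real b * (real b * real b) \<le> ?\<beta> * (?\<beta> * ?\<beta>)" by (intro mult_mono) (use b bb \<beta> x(1) in auto)
  have \<beta>2: "?\<beta> \<le> ?\<beta> * ?\<beta>" "1 \<le> ?\<beta> * ?\<beta>" "?\<beta> * ?\<beta> \<le> ?\<beta> * (?\<beta> * ?\<beta>)"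
    using \<beta> mult_mono[of 1 ?\<beta> ?\<beta> ?\<beta>] mult_mono[of 1 ?\<beta> 1 ?\<beta>] mult_mono[of 1 ?\<beta> "?\<beta> * ?\<beta>" "?\<beta> * ?\<beta>"] x(1) by auto
  have "real (b * (b * (b * (60 + T) + 50 + 50) + 50 + 50) + 50)
      = (real b * (real b * real b)) * (60 + real T) + 100 * (real b * real b) + 100 * real b + 50"
    by (simp add: algebra_simps)
  \<comment> \<open>250 = 100 + 100 + 50, as the lower powers of b are bounded by the cube of
    \<open>?\<beta>\<close>.\<close>
  also have "\<dots> \<le> (?\<beta> * (?\<beta> * ?\<beta>)) * (60 + real T) + 250 * (?\<beta> * (?\<beta> * ?\<beta>))"
  proof -
    have "(real b * (real b * real b)) * (60 + real T) \<le> (?\<beta> * (?\<beta> * ?\<beta>)) * (60 + real T)"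
      using bbb by (intro mult_right_mono) auto
    then show ?thesis using bb b \<beta>2 by linarith
  qed
  also have "\<dots> = 8 * x ^ 9 * (310 + real T)"
    by (simp add: algebra_simps power_add[symmetric] eval_nat_numeral)
  also have "\<dots> \<le> 8 * x ^ 9 * ((172800 * real K + 2 * real R + 14510) * ?y)"
    using T y x by (intro mult_left_mono) (auto simp: algebra_simps)
  also have "\<dots> = 8 * (172800 * real K + 2 * real R + 14510) * (x ^ 9 * ?y)" by simp
  also have "x ^ 9 * ?y = x powr (12 - e)"
    using x power_times_powr[of x 9 "3 - e"] by simp
  finally have I: "real (b * (b * (b * (60 + T) + 50 + 50) + 50 + 50) + 50)
      \<le> 8 * (172800 * real K + 2 * real R + 14510) * x powr (12 - e)" .
  have x11: "x ^ 11 \<le> x powr (12 - e)"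
    using powr_mono[of 11 "12 - e" x] powr_realpow[of x 11] x e by simp
  have le11: "x ^ 8 \<le> x ^ 11" "x ^ 4 \<le> x ^ 11" "1 \<le> x ^ 11" "x \<le> x ^ 11"
    using x power_increasing[of 8 11 x] power_increasing[of 4 11 x] power_increasing[of 1 11 x] by auto
  have "real S * real S * real S \<le> (4 * (x * x)) * (2 * x)"
    by (rule mult_mono[OF SS S]) (use x(1) in auto)
  then have "(800 * (real S * real S * real S) + 10) * (x ^ 4 * x ^ 4) \<le> (6400 * x ^ 3 + 10) * (x ^ 4 * x ^ 4)"
    using x by (intro mult_right_mono) (auto simp: power3_eq_cube)
  also have "\<dots> = 6400 * x ^ 11 + 10 * x ^ 8" by (simp add: algebra_simps power_add[symmetric])
  finally have M: "real ((800 * (S * S * S) + 10) * (n * n)) \<le> 6410 * x ^ 11" using le11 x(2) by simp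
  have "real (n * (n * 100 + 100) + 30 * S + 200) = 100 * x ^ 8 + 100 * x ^ 4 + 30 * real S + 200"
    using x(2) by (simp add: algebra_simps power_add[symmetric])
  also have "\<dots> \<le> 460 * x ^ 11" using le11 S by linarith
  finally have O: "real (n * (n * 100 + 100) + 30 * S + 200) \<le> 460 * x ^ 11" .
  have "real (b * (b * (b * (60 + T) + 50 + 50) + 50 + 50) + 50 + (800 * (S * S * S) + 10) * (n * n)
      + n * (n * 100 + 100) + 30 * S + 200)
    = real (b * (b * (b * (60 + T) + 50 + 50) + 50 + 50) + 50) + real ((800 * (S * S * S) + 10) * (n * n))
      + real (n * (n * 100 + 100) + 30 * S + 200)" by simp
  also have "\<dots> \<le> 8 * (172800 * real K + 2 * real R + 14510) * x powr (12 - e) + 6870 * x powr (12 - e)"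
    using I M O x11 by linarith
  \<comment> \<open>1382400 = 8 * 172800 and 122950 = 8 * 14510 + 6870.\<close>
  also have "\<dots> = (1382400 * real K + 16 * real R + 122950) * x powr (12 - e)" by (simp add: algebra_simps)
  also have "\<dots> \<le> real (4000000 * (K + R + 1)) * x powr (12 - e)"
    by (intro mult_right_mono) auto
  finally show ?thesis .
qed

text \<open>\<open>S\<close> is the ceiling of the fourth root. By minimality \<open>S - 1\<close>
  is at most the root, and the root is at least 1, whence the factor 2.\<close>

lemma quartic_side:
  assumes "1 \<le> (n::nat)"
  obtains S where "1 \<le> S" "S \<le> n" "n \<le> S * S * S * S" "\<And>r. 1 \<le> r \<Longrightarrow> r < S \<Longrightarrow> r * r * r * r < n"
    "real S \<le> 2 * root 4 (real n)" "root 4 (real n) \<le> real S"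
proof -
  let ?P = "\<lambda>s. 1 \<le> s \<and> n \<le> s * s * s * s"
  define S where "S = (LEAST s. ?P s)"
  have "?P n" using assms by (auto intro: order_trans[OF _ mult_le_mono1[of 1]])
  then have S: "?P S" and le: "S \<le> n" unfolding S_def by (rule LeastI, rule Least_le)
  have min: "r * r * r * r < n" if "1 \<le> r" "r < S" for r
    using not_less_Least[of r ?P] that unfolding S_def by simp
  have pow: "real (s * s * s * s) = real s ^ 4" for s by (simp add: eval_nat_numeral)
  have "1 \<le> root 4 (real n)" using assms by simp
  moreover have "real (S - 1) \<le> root 4 (real n)"
  proof (cases "S = 1")
    case False
    then have "1 \<le> S - 1" "S - 1 < S" using S by auto
    then have "(S - 1) * (S - 1) * (S - 1) * (S - 1) \<le> n" using min[of "S - 1"] by (intro less_imp_le)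
    then have "real ((S - 1) * (S - 1) * (S - 1) * (S - 1)) \<le> real n" by (rule of_nat_mono)
    then have "root 4 (real (S - 1) ^ 4) \<le> root 4 (real n)" unfolding pow by simp
    then show ?thesis by (simp add: real_root_power_cancel)
  qed simp
  moreover have "real (S - 1) = real S - 1" using S by (simp add: of_nat_diff)
  ultimately have "real S \<le> 2 * root 4 (real n)" by linarith
  moreover have "root 4 (real n) \<le> root 4 (real S ^ 4)"
    using S of_nat_mono[of n "S * S * S * S", where 'a = real] unfolding pow by simp
  then have "root 4 (real n) \<le> real S" by (simp add: real_root_power_cancel)
  ultimately show ?thesis using that S le min by blast
qed

theorem solves_BMM_of_Enum:
  fixes \<sigma> :: nat and f :: "nat \<Rightarrow> real" and \<epsilon> :: real
  assumes \<sigma>: "1 \<le> \<sigma>" and eps: "0 < \<epsilon>"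
    and enum: "solves_Enum \<sigma> pre upd enm (\<lambda>v l. real (max 1 v) powr (3 - \<epsilon>) * f l)
      (\<lambda>v l. real (max 1 v) powr (2 - \<epsilon>) * f l) (\<lambda>v l. real (max 1 v) powr (2 - \<epsilon>) * f l)"
  shows "solves_BMM (bmm_via pre upd enm) (\<lambda>n. real n powr (3 - min \<epsilon> 1 / 4))"
proof -
  define l where "l = rpq_length five_arcs"
  define e where "e = min \<epsilon> 1"
  obtain C d :: nat and c :: real where solves: "\<And>ls q N reqs. adjacency_over \<sigma> ls \<Longrightarrow> rpq_over \<sigma> q \<Longrightarrow> length ls \<le> N \<Longrightarrow>
      \<exists>tr s. exec (C * (N + rpq_length q + 2) ^ d) pre (start (enc_instance ls q)) tr s \<and> emitted tr = []
        \<and> real (length tr) \<le> c * (real (max 1 (length ls)) powr (3 - \<epsilon>) * f (rpq_length q))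
        \<and> serves \<sigma> N (C * (N + rpq_length q + 2) ^ d) upd enm q
            (\<lambda>v. c * (real (max 1 v) powr (2 - \<epsilon>) * f (rpq_length q)))
            (\<lambda>v. c * (real (max 1 v) powr (2 - \<epsilon>) * f (rpq_length q))) (db_of ls) s reqs"
    using enum unfolding solves_Enum_def Let_def by blast
  define K where "K = ceil_bound \<bar>c * f l\<bar>"
  define TP where "TP S = ceil_bound (real K * real (2 + 4 * S) powr (3 - e))" for S :: nat
  define TU where "TU S = ceil_bound (real K * real (2 + 4 * S) powr (2 - e))" for S :: nat
  \<comment> \<open>The hosted word bound needs 4 S + 13, at most 13 (n + 2). The steepest demand is
    the log: \<open>TP S\<close> and \<open>S\<close> times \<open>TU S\<close> are cubic in n + 2
    with coefficients proportional to \<open>K\<close>, whence the exponent \<open>d + 3\<close> in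
    \<open>B\<close>.\<close>
  define C' where "C' = C * 13 ^ d + 60 + 2000 * K"
  define B where "B n = C' * (n + 2) ^ (d + 3)" for n :: nat
  define V where "V S = C * (2 + 4 * S + l + 2) ^ d" for S :: nat
  define R where "R = max (com_regs pre) (max (com_regs upd) (com_regs enm))"
  have l: "l = 9" by (simp add: l_def five_arcs_def)
  have e: "0 < e" "e \<le> 1" using eps by (auto simp: e_def)
  have ceil_le: "ceil_bound (real K * real m powr (a - e)) \<le> K * m ^ k" if "1 \<le> m" "a - e \<le> real k" for m k :: nat and a
  proof -
    have "real m powr (a - e) \<le> real m ^ k" using that by (intro powr_le_power) auto
    then have "real K * real m powr (a - e) \<le> real (K * m ^ k)"
      by (simp add: mult_left_mono)
    then show ?thesis by (rule ceil_bound_mono)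
  qed
  have W: "B n ^ 20 = C' ^ 20 * (n + 2) ^ (20 * (d + 3))" for n
    unfolding B_def by (rule power_times_power)
  have run: "\<exists>tr s. exec (B n ^ 20) (bmm_via pre upd enm) (start (n # enc_mat n A @ enc_mat n A')) tr s
      \<and> emitted tr = map (\<lambda>b. [b]) (enc_mat n (mat_mul n A A'))
      \<and> real (length tr) \<le> real (4000000 * (K + R + 1)) * real n powr (3 - e / 4)"
    if n: "1 \<le> n" for n A A'
  proof -
    let ?b = "\<lambda>v. c * (real (max 1 v) powr (2 - \<epsilon>) * f l)"
    define x where "x = root 4 (real n)"
    obtain S where S: "1 \<le> S" "S \<le> n" "n \<le> S * S * S * S" "\<And>r. 1 \<le> r \<Longrightarrow> r < S \<Longrightarrow> r * r * r * r < n"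
      "real S \<le> 2 * x" "x \<le> real S"
      using quartic_side[OF n] unfolding x_def by blast
    have x: "1 \<le> x" "real n = x ^ 4" using n by (simp_all add: x_def)
    have bound: "?b v \<le> real (TU S)" if "v \<le> 2 + 4 * S" for v
      using powr_bound_le[OF that, of 2 c \<epsilon> "f l"] ceil_bound_ge[of "real K * real (2 + 4 * S) powr (2 - e)"]
      unfolding TU_def K_def e_def by simp
    interpret bmm "B n ^ 20" "B n" n S A A' "V S" upd enm \<sigma> "2 + 4 * S" "TU S" "TU S" ?b ?b pre "TP S"
    proof unfold_locales
      have "20 * (n + 2) ^ 0 \<le> B n" unfolding B_def by (rule times_power_mono) (auto simp: C'_def)
      then show "20 \<le> B n" by simp
      have "(2 + 4 * S + l + 2) ^ d \<le> (13 * (n + 2)) ^ d" using l S(2) by (intro power_mono) auto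
      then have "C * (2 + 4 * S + l + 2) ^ d \<le> C * (13 * (n + 2)) ^ d" by (rule mult_le_mono2)
      then have "V S \<le> C * 13 ^ d * (n + 2) ^ d" by (simp only: V_def power_mult_distrib mult.assoc)
      also have "\<dots> \<le> B n" unfolding B_def by (rule times_power_mono) (auto simp: C'_def)
      finally show "V S \<le> B n" .
      have "20 * (n + 1) * (n + 1) \<le> 20 * (n + 2) ^ 2" by (simp add: power2_eq_square algebra_simps)
      also have "\<dots> \<le> B n" unfolding B_def by (rule times_power_mono) (auto simp: C'_def)
      finally show "20 * (n + 1) * (n + 1) \<le> B n" .
      let ?m = "n + 2"
      have m: "2 + 4 * S \<le> 6 * ?m" "S \<le> ?m" using S(2) by auto
      have "TP S \<le> K * (2 + 4 * S) ^ 3" unfolding TP_def by (rule ceil_le) (use e in auto)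
      also have "\<dots> \<le> K * (6 * ?m) ^ 3" using m(1) by (intro mult_le_mono2 power_mono) auto
      finally have P: "TP S \<le> 216 * (K * ?m ^ 3)" by (simp only: power_mult_distrib) simp
      have "TU S \<le> K * (2 + 4 * S) ^ 2" unfolding TU_def by (rule ceil_le) (use e in auto)
      also have "\<dots> \<le> K * (6 * ?m) ^ 2" using m(1) by (intro mult_le_mono2 power_mono) auto
      finally have U: "TU S \<le> 36 * (K * ?m ^ 2)" by (simp only: power_mult_distrib) simp
      have "S * (4 * TU S + 2 * TU S + 20) \<le> ?m * (216 * (K * ?m ^ 2) + 20 * ?m ^ 2)"
      proof (rule mult_le_mono[OF m(2)])
        have "1 \<le> ?m ^ 2" by simp
        then show "4 * TU S + 2 * TU S + 20 \<le> 216 * (K * ?m ^ 2) + 20 * ?m ^ 2" using U by linarith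
      qed
      also have "\<dots> = (216 * K + 20) * ?m ^ 3" by (simp only: power3_eq_cube power2_eq_square distrib_left distrib_right ac_simps)
      finally have "TP S + S * (4 * TU S + 2 * TU S + 20) \<le> (432 * K + 20) * ?m ^ 3"
        using P by (simp only: distrib_right mult.assoc)
      also have "\<dots> \<le> B n" unfolding B_def by (rule times_power_mono) (auto simp: C'_def)
      finally show "TP S + S * (4 * TU S + 2 * TU S + 20) \<le> B n" .
      fix ls :: adjacency and reqs
      assume ls: "adjacency_over \<sigma> ls" "length ls = 2 + 4 * S"
      have "rpq_over \<sigma> five_arcs" using \<sigma> by (simp add: five_arcs_def)
      from solves[OF ls(1) this, of "2 + 4 * S" reqs] ls(2)
      obtain tr g where g: "exec (V S) pre (start (enc_instance ls five_arcs)) tr g" "emitted tr = []"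
        "real (length tr) \<le> c * (real (max 1 (2 + 4 * S)) powr (3 - \<epsilon>) * f l)"
        "serves \<sigma> (2 + 4 * S) (V S) upd enm five_arcs ?b ?b (db_of ls) g reqs"
        unfolding V_def l_def by auto
      have "real (length tr) \<le> real (TP S)"
        using g(3) powr_bound_le[of "2 + 4 * S" "2 + 4 * S" 3 c \<epsilon> "f l"]
          ceil_bound_ge[of "real K * real (2 + 4 * S) powr (3 - e)"]
        unfolding TP_def K_def e_def by simp
      then show "\<exists>tr g. exec (V S) pre (start (enc_instance ls five_arcs)) tr g \<and> emitted tr = [] \<and> length tr \<le> TP S
        \<and> serves \<sigma> (2 + 4 * S) (V S) upd enm five_arcs ?b ?b (db_of ls) g reqs"
        using g by auto
    qed (use bound \<sigma> S(1,2) in auto)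
    \<comment> \<open>Divide \<open>block_count * S \<le> n + S\<close> by \<open>S\<close>: n / S
      is at most x^3 because S is at least x, and 1 is at most x^3.\<close>
    have "real block_count \<le> 2 * x ^ 3"
    proof -
      have "real block_count * real S \<le> real n + real S"
        using of_nat_mono[OF block_count(3), where 'a = real] by simp
      also have "\<dots> \<le> x ^ 3 * real S + x ^ 3 * real S"
      proof (rule add_mono)
        have "real n = x ^ 3 * x" using x(2) by (simp add: eval_nat_numeral)
        also have "\<dots> \<le> x ^ 3 * real S" using S(6) x(1) by (intro mult_left_mono) auto
        finally show "real n \<le> x ^ 3 * real S" .
        show "real S \<le> x ^ 3 * real S"
          using mult_right_mono[of 1 "x ^ 3" "real S"] x(1) one_le_power[of x 3] by simp
      qed
      finally have "real block_count * real S \<le> (2 * x ^ 3) * real S" by (simp add: algebra_simps)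
      then show ?thesis using S(1) by (simp add: mult_le_cancel_right)
    qed
    note time = bmm_time_bound[OF x e S(5) this TP_def[of S] TU_def[of S] S(1), of R]
    obtain tr s where tr: "exec (B n ^ 20) (bmm_via pre upd enm) (start (n # enc_mat n A @ enc_mat n A')) tr s"
      "emitted tr = map (\<lambda>b. [b]) (enc_mat n (mat_mul n A A'))" "length tr \<le> total_time"
      using wp_bmm_via[OF S(3,4)] by (auto elim: wp_exec)
    have "real (length tr) \<le> real total_time" using tr(3) by (rule of_nat_mono)
    also have "\<dots> \<le> real (4000000 * (K + R + 1)) * x powr (12 - e)"
      using time unfolding total_time_def I_time_def K_time_def J_time_def test_time_def log_size_def row_log_def
        row_time_def multiply_time_def R_def by assumption
    also have "x powr (12 - e) = real n powr (3 - e / 4)"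
    proof -
      have "real n = x powr 4" using x by simp
      then have "real n powr (3 - e / 4) = x powr (4 * (3 - e / 4))" by (simp only: powr_powr)
      then show ?thesis by (simp add: algebra_simps)
    qed
    finally show ?thesis using tr(1,2) by blast
  qed
  show ?thesis
    unfolding solves_BMM_def e_def[symmetric]
    by (intro exI[of _ "C' ^ 20"] exI[of _ "20 * (d + 3)"] exI[of _ "real (4000000 * (K + R + 1))"] allI impI)
      (use run[unfolded W] in blast)
qed

section \<open>The two conditional lower bounds\<close>

theorem theorem6p3:
  fixes \<sigma> :: nat and f :: "nat \<Rightarrow> real" and \<epsilon> :: real
  assumes alphabet: "\<sigma> \<ge> 1" and eps: "\<epsilon> > 0"
  shows
    "((\<exists>pre upd enm tp. solves_Enum \<sigma> pre upd enm
          tp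
          (\<lambda>v l. real (max 1 v) powr (1 - \<epsilon>) * f l)
          (\<lambda>v l. real (max 1 v) powr (1 - \<epsilon>) * f l))
        \<longrightarrow> \<not> OMv_hypothesis)
     \<and> (\<forall>comb. closed_under_reduction comb \<longrightarrow>
        (\<exists>pre upd enm. comb pre \<and> comb upd \<and> comb enm \<and> solves_Enum \<sigma> pre upd enm
          (\<lambda>v l. real (max 1 v) powr (3 - \<epsilon>) * f l)
          (\<lambda>v l. real (max 1 v) powr (2 - \<epsilon>) * f l)
          (\<lambda>v l. real (max 1 v) powr (2 - \<epsilon>) * f l))
        \<longrightarrow> \<not> combinatorial_BMM_hypothesis comb)"
proof (intro conjI allI impI)
  assume "\<exists>pre upd enm tp. solves_Enum \<sigma> pre upd enm tp
      (\<lambda>v l. real (max 1 v) powr (1 - \<epsilon>) * f l) (\<lambda>v l. real (max 1 v) powr (1 - \<epsilon>) * f l)"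
  then obtain pre rnd where "solves_OMv pre rnd (\<lambda>n. real n powr (3 - min \<epsilon> 1))"
    by (elim exE) (rule that[OF solves_OMv_of_Enum[OF alphabet eps]])
  moreover have "0 < min \<epsilon> 1" using eps by simp
  ultimately show "\<not> OMv_hypothesis" unfolding OMv_hypothesis_def by blast
next
  fix comb
  assume closed: "closed_under_reduction comb"
    and "\<exists>pre upd enm. comb pre \<and> comb upd \<and> comb enm \<and> solves_Enum \<sigma> pre upd enm
      (\<lambda>v l. real (max 1 v) powr (3 - \<epsilon>) * f l)
      (\<lambda>v l. real (max 1 v) powr (2 - \<epsilon>) * f l) (\<lambda>v l. real (max 1 v) powr (2 - \<epsilon>) * f l)"
  then obtain pre upd enm where "comb pre" "comb upd" "comb enm"
    and enum: "solves_Enum \<sigma> pre upd enm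
      (\<lambda>v l. real (max 1 v) powr (3 - \<epsilon>) * f l)
      (\<lambda>v l. real (max 1 v) powr (2 - \<epsilon>) * f l) (\<lambda>v l. real (max 1 v) powr (2 - \<epsilon>) * f l)"
    by (elim exE conjE) (rule that)
  then have "comb (bmm_via pre upd enm)" using closed unfolding closed_under_reduction_def by blast
  moreover note solves_BMM_of_Enum[OF alphabet eps enum]
  moreover have "0 < min \<epsilon> 1 / 4" using eps by simp
  ultimately show "\<not> combinatorial_BMM_hypothesis comb"
    unfolding combinatorial_BMM_hypothesis_def by blast
qed

end
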